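(* Let $Q_\infty=\Phi((T_\infty,\ell),\eta)$, where $((T_\infty,\ell),\eta)$ has law $\mu\otimes\mathcal B(1/2)$, and let $(\mathcal X_n)_{n\ge0}$ be the simple random walk on $Q_\infty$. Then almost surely the integer-valued process $(\ell(\mathcal X_n))_{n\ge0}$ is recurrent, i.e. it visits every integer infinitely often.
   Context: **The law $\mu$.** $\rho_l$ is the law of a Galton–Watson plane tree with offspring law $P(k)=2^{-k-1}$, root label $l$, and each non-root vertex labeled by its parent's label plus an independent uniform element of $\{-1,0,1\}$. $\mu$ is the law of $(T_\infty,\ell)$, which has a spine $\varnothing=S(0),S(1),\dots$ whose labels $X_n$ form a random walk from 0 with i.i.d. uniform steps in $\{-1,0,1\}$. Conditionally on $(X_n)$, independent trees with law $\rho_{X_n}$ are grafted to the left and to the right of each $S(n)$. **The Schaeffer map $\Phi$.** Corners are indexed by $\mathbb Z$: $c_0,c_1,\dots$ are the left-side corners in clockwise contour order from the root corner $c_0$, and negative indices are the right-side corners in counterclockwise order. The successor of $c_i$ is the first $c_j$, $j>i$, with label $\ell(c_i)-1$. $\Phi$ produces the quadrangulation on $V(T_\infty)$ made of arcs from corners to successors. It is rooted at the oriented edge $e^*$, the arc from $c_0$ to its successor, with orientation reversed iff $\eta=1$. Vertices of $Q_\infty$ carry the labels $\ell$. **Simple random walk.** Conditionally on $Q_\infty$, define oriented edges as follows: $E_0=e^*$, and $E_{j+1}$ is chosen uniformly among the oriented edges whose origin is the target $(E_j)_+$ of $E_j$. Then $\mathcal X_k$ is the origin of $E_k$. *)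

theory Defs
  imports "HOL-Probability.Probability"
begin

datatype ltree = Node int "ltree list"

fun root_label :: "ltree \<Rightarrow> int" where
  "root_label (Node l cs) = l"

text \<open>Weight of a labelled plane tree: each vertex with k children contributes
  2^(-k-1) (geometric offspring law), each non-root vertex contributes 1/3 if its
  label differs from its parent's by an element of {-1,0,1}, and 0 otherwise.\<close>
fun gw_weight :: "ltree \<Rightarrow> real" where
  "gw_weight (Node l cs) =
     (1/2) ^ (length cs + 1) *
     prod_list (map (\<lambda>c. (if root_label c - l \<in> {-1,0,1} then 1/3 else 0) * gw_weight c) cs)"

definition rho_w :: "int \<Rightarrow> ltree \<Rightarrow> real" where
  "rho_w l t = (if root_label t = l then gw_weight t else 0)"

definition rho :: "int \<Rightarrow> ltree measure" where
  "rho l = density (count_space UNIV) (\<lambda>t. ennreal (rho_w l t))"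

text \<open>Clockwise contour sequence of corners, each corner given by the Ulam-Harris
  path of its vertex and its label.  It starts and ends at the root.\<close>
fun contour :: "ltree \<Rightarrow> (nat list \<times> int) list"
and contours :: "int \<Rightarrow> nat \<Rightarrow> ltree list \<Rightarrow> (nat list \<times> int) list" where
  "contour (Node l cs) = ([], l) # contours l 0 cs"
| "contours l i [] = []"
| "contours l i (c # cs) =
     map (\<lambda>(p, x). (i # p, x)) (contour c) @ [([], l)] @ contours l (Suc i) cs"

text \<open>Counterclockwise contour (contour of the mirror image), same vertex names.\<close>
fun rcontour :: "ltree \<Rightarrow> (nat list \<times> int) list"
and rcontours :: "int \<Rightarrow> nat \<Rightarrow> ltree list \<Rightarrow> (nat list \<times> int) list" where
  "rcontour (Node l cs) = ([], l) # rcontours l 0 cs"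
| "rcontours l i [] = []"
| "rcontours l i (c # cs) =
     rcontours l (Suc i) cs @ map (\<lambda>(p, x). (i # p, x)) (rcontour c) @ [([], l)]"

function pick :: "(nat \<Rightarrow> 'a list) \<Rightarrow> nat \<Rightarrow> nat \<Rightarrow> 'a" where
  "pick f n k = (if k < length (f n) \<or> f n = [] then f n ! k
                 else pick f (Suc n) (k - length (f n)))"
  by auto
termination
  by (relation "Wellfounded.measure (\<lambda>(f, n, k). k)") (auto simp: length_greater_0_conv[symmetric] simp del: length_greater_0_conv)

text \<open>A sample point: (eta, (n \<mapsto> (xi_n, L_n, R_n, U_n))), where xi_n is the
  n-th step of the spine label walk, L_n, R_n are the trees grafted left/right of
  S(n) (drawn from rho 0 and shifted by X_n, which gives law rho (X_n)), and U_n
  is a uniform variable used for the n-th step of the simple random walk.\<close>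
type_synonym sample = "bool \<times> (nat \<Rightarrow> int \<times> ltree \<times> ltree \<times> real)"

definition coord_measure :: "(int \<times> ltree \<times> ltree \<times> real) measure" where
  "coord_measure =
     measure_pmf (pmf_of_set {-1, 0, 1 :: int}) \<Otimes>\<^sub>M
       (rho 0 \<Otimes>\<^sub>M (rho 0 \<Otimes>\<^sub>M uniform_measure lborel {0..<1 :: real}))"

definition sample_space :: "sample measure" where
  "sample_space = measure_pmf (bernoulli_pmf (1/2)) \<Otimes>\<^sub>M (\<Pi>\<^sub>M n\<in>UNIV. coord_measure)"

definition eta :: "sample \<Rightarrow> bool" where "eta \<omega> = fst \<omega>"
definition step :: "sample \<Rightarrow> nat \<Rightarrow> int" where "step \<omega> n = fst (snd \<omega> n)"
definition Ltree :: "sample \<Rightarrow> nat \<Rightarrow> ltree" where "Ltree \<omega> n = fst (snd (snd \<omega> n))"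
definition Rtree :: "sample \<Rightarrow> nat \<Rightarrow> ltree" where "Rtree \<omega> n = fst (snd (snd (snd \<omega> n)))"
definition Unif :: "sample \<Rightarrow> nat \<Rightarrow> real" where "Unif \<omega> n = snd (snd (snd (snd \<omega> n)))"

definition spineX :: "sample \<Rightarrow> nat \<Rightarrow> int" where
  "spineX \<omega> n = (\<Sum>k<n. step \<omega> k)"

text \<open>Vertices of T_infinity: (n, side, path) = vertex with Ulam-Harris path inside
  the tree grafted on side (False = left, True = right) of S(n); the root of both
  grafted trees is S(n) itself, normalised to side False.\<close>
type_synonym vertex = "nat \<times> bool \<times> nat list"

definition vtx :: "nat \<Rightarrow> bool \<Rightarrow> nat list \<Rightarrow> vertex" where
  "vtx n s p = (n, if p = [] then False else s, p)"

definition left_corners :: "sample \<Rightarrow> nat \<Rightarrow> (vertex \<times> int) list" where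
  "left_corners \<omega> n =
     map (\<lambda>(p, x). (vtx n False p, spineX \<omega> n + x)) (contour (Ltree \<omega> n))"

definition right_corners :: "sample \<Rightarrow> nat \<Rightarrow> (vertex \<times> int) list" where
  "right_corners \<omega> n =
     map (\<lambda>(p, x). (vtx n True p, spineX \<omega> n + x)) (rcontour (Rtree \<omega> n))"

text \<open>Corner c_i (its vertex and label), i \<in> \<int>: c_0, c_1, ... left side clockwise;
  c_(-1), c_(-2), ... right side counterclockwise.\<close>
definition corner :: "sample \<Rightarrow> int \<Rightarrow> vertex \<times> int" where
  "corner \<omega> i = (if 0 \<le> i then pick (left_corners \<omega>) 0 (nat i)
                  else pick (right_corners \<omega>) 0 (nat (- i)))"

definition succ_corner :: "sample \<Rightarrow> int \<Rightarrow> int" where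
  "succ_corner \<omega> i = (LEAST j. i < j \<and> snd (corner \<omega> j) = snd (corner \<omega> i) - 1)"

text \<open>Arcs of Q_infinity are indexed by the corner i they start from; an oriented
  edge is (i, b), b = True meaning the arc traversed from the successor to c_i.\<close>
type_synonym oedge = "int \<times> bool"

definition oe_origin_corner :: "sample \<Rightarrow> oedge \<Rightarrow> int" where
  "oe_origin_corner \<omega> e = (if snd e then succ_corner \<omega> (fst e) else fst e)"

definition oe_target_corner :: "sample \<Rightarrow> oedge \<Rightarrow> int" where
  "oe_target_corner \<omega> e = (if snd e then fst e else succ_corner \<omega> (fst e))"

definition oe_origin :: "sample \<Rightarrow> oedge \<Rightarrow> vertex" where
  "oe_origin \<omega> e = fst (corner \<omega> (oe_origin_corner \<omega> e))"

definition oe_target :: "sample \<Rightarrow> oedge \<Rightarrow> vertex" where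
  "oe_target \<omega> e = fst (corner \<omega> (oe_target_corner \<omega> e))"

text \<open>Integer code of an oriented edge, used only to enumerate a finite set of them.\<close>
definition oe_code :: "oedge \<Rightarrow> int" where
  "oe_code e = 2 * fst e + (if snd e then 1 else 0)"

definition oe_decode :: "int \<Rightarrow> oedge" where
  "oe_decode k = (k div 2, k mod 2 = 1)"

definition out_edges :: "sample \<Rightarrow> vertex \<Rightarrow> oedge set" where
  "out_edges \<omega> v = {e. oe_origin \<omega> e = v}"

text \<open>Root edge e* = (0, eta); E_(k+1) is chosen uniformly among the oriented edges
  leaving the target of E_k, using the uniform variable U_k.\<close>
fun walk_edge :: "sample \<Rightarrow> nat \<Rightarrow> oedge" where
  "walk_edge \<omega> 0 = (0, eta \<omega>)"
| "walk_edge \<omega> (Suc k) =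
     (let L = map oe_decode (sorted_list_of_set
                 (oe_code ` out_edges \<omega> (oe_target \<omega> (walk_edge \<omega> k))))
      in L ! nat \<lfloor>Unif \<omega> k * real (length L)\<rfloor>)"

definition walk_label :: "sample \<Rightarrow> nat \<Rightarrow> int" where
  "walk_label \<omega> k = snd (corner \<omega> (oe_origin_corner \<omega> (walk_edge \<omega> k)))"

end

theory Submission
  imports Defs
begin

text \<open>
  Fix a sign \<open>\<sigma>\<close>, and let \<open>u_m(x)\<close> be the quenched probability that the walk started at \<open>x\<close> keeps
  \<open>\<sigma> \<ell> \<le> m\<close> forever. It is harmonic on \<open>{\<sigma> \<ell> \<le> m}\<close> and vanishes elsewhere. The law of the labelled tree
  is invariant when the root corner is moved to the next corner, and the arcs of the quadrangulation
  are indexed by the corners; this gives a mass transport principle for arcs. Applied to the flux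
  \<open>u_m(x) (u_m(x) - u_m(y))\<close>, summed over the levels \<open>m = \<sigma> \<ell>(x), \<dots>, \<sigma> \<ell>(x) + K\<close>, it yields
  \<open>\<Sum>k\<le>K. a_k \<le> sqrt (a_(K+1))\<close>, where \<open>a_k\<close> is the mean square of the increment of \<open>u_m\<close> along the root arc
  at relative level \<open>k\<close>. This forces \<open>a_k = 0\<close> for every \<open>k\<close>, so each \<open>u_m\<close> is constant along arcs. As the
  chains of successors merge and the labels are unbounded, \<open>u_m = 0\<close>. Hence \<open>\<ell>(X_n)\<close>, which moves by
  unit steps, is unbounded above and below.
\<close>

text \<open>The law is invariant only up to renaming the vertices and adding a constant to all
  labels, so a level cannot be fixed once and for all: it has to be counted from the label of the
  origin of an edge. This shapes the energy estimate. On an arc with ends x, y the two fluxes at a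
  common level add up to (u(x) - u(y))^2, but the windows of levels attached to x and to y are
  shifted by one against each other. At the bottom nothing is lost, since u vanishes there at the
  upper end. At the top one term survives; it costs at most the absolute jump at level K + 1, whose
  mean Cauchy--Schwarz bounds by the square root. The fluxes leaving a vertex cancel by harmonicity,
  and mass transport turns this into a zero mean at the root arc. An edge shares out a bounded
  amount in equal parts among the edges with its origin, so the bound K + 1 on the flux suffices
  whatever the degrees are.\<close>

section \<open>The Galton--Watson law has total mass one\<close>

instance ltree :: countable
  by countable_datatype

lemma nn_integral_lists_of_length:
  fixes \<phi> :: "'a::countable \<Rightarrow> ennreal"
  shows "(\<integral>\<^sup>+ xs. (if length xs = k then prod_list (map \<phi> xs) else 0) \<partial>count_space UNIV)
    = (\<integral>\<^sup>+ x. \<phi> x \<partial>count_space UNIV) ^ k"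
proof (induction k)
  case 0
  have "(\<integral>\<^sup>+ xs. (if length xs = 0 then prod_list (map \<phi> xs) else 0) \<partial>count_space UNIV)
     = (\<integral>\<^sup>+ xs. 1 * indicator {[] :: 'a list} xs \<partial>count_space UNIV)"
    by (intro nn_integral_cong) (auto simp: indicator_def)
  then show ?case by simp
next
  case (Suc k)
  have "(\<integral>\<^sup>+ xs. (if length xs = Suc k then prod_list (map \<phi> xs) else 0) \<partial>count_space UNIV)
     = (\<integral>\<^sup>+ xs. (if length xs = Suc k then prod_list (map \<phi> xs) else 0) \<partial>count_space (range (\<lambda>(x::'a, xs). x # xs)))"
    by (rule nn_integral_count_space_eq) (auto split: if_splits simp: length_Suc_conv image_iff)
  also have "\<dots> = (\<integral>\<^sup>+ p. (case p of (x, xs) \<Rightarrow> if length (x # xs) = Suc k then prod_list (map \<phi> (x # xs)) else 0) \<partial>count_space UNIV)"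
    by (subst nn_integral_bij_count_space[where g = "\<lambda>(x, xs). x # xs" and A = UNIV, symmetric])
      (auto simp: bij_betw_def inj_on_def split_beta intro!: nn_integral_cong split: prod.split)
  also have "\<dots> = (\<integral>\<^sup>+ p. (case p of (x, xs) \<Rightarrow> \<phi> x * (if length xs = k then prod_list (map \<phi> xs) else 0)) \<partial>count_space UNIV)"
    by (intro nn_integral_cong) auto
  also have "\<dots> = (\<integral>\<^sup>+ x. \<integral>\<^sup>+ xs. \<phi> x * (if length xs = k then prod_list (map \<phi> xs) else 0) \<partial>count_space UNIV \<partial>count_space UNIV)"
    by (subst nn_integral_fst_count_space[symmetric]) simp
  also have "\<dots> = (\<integral>\<^sup>+ x. \<phi> x \<partial>count_space UNIV) ^ Suc k"
    by (simp add: nn_integral_cmult nn_integral_multc Suc)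
  finally show ?case .
qed

lemma nn_integral_lists:
  fixes \<phi> :: "'a::countable \<Rightarrow> ennreal"
  shows "(\<integral>\<^sup>+ xs. f (length xs) * prod_list (map \<phi> xs) \<partial>count_space UNIV)
    = (\<Sum>k. f k * (\<integral>\<^sup>+ x. \<phi> x \<partial>count_space UNIV) ^ k)"
proof -
  have "f (length xs) * prod_list (map \<phi> xs)
      = (\<Sum>k. f k * (if length xs = k then prod_list (map \<phi> xs) else 0))" for xs
    by (subst suminf_finite[of "{length xs}"]) auto
  then have "(\<integral>\<^sup>+ xs. f (length xs) * prod_list (map \<phi> xs) \<partial>count_space UNIV)
     = (\<integral>\<^sup>+ xs. (\<Sum>k. f k * (if length xs = k then prod_list (map \<phi> xs) else 0)) \<partial>count_space UNIV)"
    by simp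
  also have "\<dots> = (\<Sum>k. (\<integral>\<^sup>+ xs. f k * (if length xs = k then prod_list (map \<phi> xs) else 0) \<partial>count_space UNIV))"
    by (rule nn_integral_suminf) auto
  also have "\<dots> = (\<Sum>k. f k * (\<integral>\<^sup>+ x. \<phi> x \<partial>count_space UNIV) ^ k)"
    by (simp add: nn_integral_cmult nn_integral_lists_of_length)
  finally show ?thesis .
qed

lemma gw_weight_nonneg: "0 \<le> gw_weight t"
proof (induction t)
  case (Node l cs)
  then show ?case
    by (auto intro!: mult_nonneg_nonneg prod_list_nonneg)
qed

fun children :: "ltree \<Rightarrow> ltree list" where
  "children (Node l cs) = cs"

lemma ennreal_prod_list:
  "(\<And>x. x \<in> set xs \<Longrightarrow> 0 \<le> f x) \<Longrightarrow> ennreal (prod_list (map f xs)) = prod_list (map (\<lambda>x. ennreal (f x)) xs)"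
proof (induction xs)
  case (Cons a xs)
  have "0 \<le> prod_list (map f xs)" using Cons.prems by (intro prod_list_nonneg) auto
  then show ?case using Cons by (simp add: ennreal_mult)
qed simp

lemma prod_list_map_indicator:
  "prod_list (map (\<lambda>x. f x * indicator A x) xs) = prod_list (map f xs) * (indicator {xs. set xs \<subseteq> A} xs :: ennreal)"
  by (induction xs) (auto simp: indicator_def)

text \<open>The weight of a tree is a product over the subtrees of its root, so summing over lists
  of children gives the generating function of the geometric law at the average mass for the labels
  l - 1, l, l + 1. The set \<open>H\<close> is free: \<open>UNIV\<close> yields total masses, a
  bound on the height yields truncated ones.\<close>

lemma nn_integral_rho_w_children:
  "(\<integral>\<^sup>+ t. ennreal (rho_w l t) * indicator {t. set (children t) \<subseteq> H} t \<partial>count_space UNIV)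
   = (\<Sum>k. ennreal ((1/2)^(k+1)) *
       ((\<integral>\<^sup>+ t. ennreal (rho_w (l-1) t) * indicator H t \<partial>count_space UNIV) / 3
      + (\<integral>\<^sup>+ t. ennreal (rho_w l t) * indicator H t \<partial>count_space UNIV) / 3
      + (\<integral>\<^sup>+ t. ennreal (rho_w (l+1) t) * indicator H t \<partial>count_space UNIV) / 3) ^ k)"
proof -
  let ?p = "\<lambda>c. ennreal ((if root_label c - l \<in> {-1,0,1} then 1/3 else 0) * gw_weight c) * indicator H c"
  have nn: "0 \<le> (if root_label c - l \<in> {-1,0,1} then 1/3 else 0) * gw_weight c" for c
    by (simp add: gw_weight_nonneg)
  have "(\<integral>\<^sup>+ t. ennreal (rho_w l t) * indicator {t. set (children t) \<subseteq> H} t \<partial>count_space UNIV)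
     = (\<integral>\<^sup>+ t. ennreal (rho_w l t) * indicator {t. set (children t) \<subseteq> H} t \<partial>count_space (range (Node l)))"
    by (rule nn_integral_count_space_eq) (auto simp: rho_w_def image_iff, metis root_label.elims)
  also have "\<dots> = (\<integral>\<^sup>+ cs. ennreal (gw_weight (Node l cs)) * indicator {cs. set cs \<subseteq> H} cs \<partial>count_space UNIV)"
    by (subst nn_integral_bij_count_space[where g = "Node l" and A = UNIV, symmetric])
      (auto simp: bij_betw_def inj_on_def rho_w_def indicator_def intro!: nn_integral_cong)
  also have "\<dots> = (\<integral>\<^sup>+ cs. ennreal ((1/2)^(length cs + 1)) * prod_list (map ?p cs) \<partial>count_space UNIV)"
    unfolding gw_weight.simps
    by (intro nn_integral_cong, subst ennreal_mult)
      (use nn in \<open>auto simp: ennreal_prod_list prod_list_map_indicator mult.assoc intro!: prod_list_nonneg\<close>)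
  also have "\<dots> = (\<Sum>k. ennreal ((1/2)^(k+1)) * (\<integral>\<^sup>+ c. ?p c \<partial>count_space UNIV) ^ k)"
    by (rule nn_integral_lists)
  also have "(\<integral>\<^sup>+ c. ?p c \<partial>count_space UNIV) = (\<integral>\<^sup>+ c. 
      ennreal (rho_w (l-1) c) * indicator H c / 3 + ennreal (rho_w l c) * indicator H c / 3
      + ennreal (rho_w (l+1) c) * indicator H c / 3 \<partial>count_space UNIV)"
  proof (intro nn_integral_cong)
    fix c
    have "ennreal (1/3 * gw_weight c) = ennreal (gw_weight c) / 3"
      by (metis divide_ennreal ennreal_numeral gw_weight_nonneg mult.commute mult_1 times_divide_eq_right zero_le_numeral zero_less_numeral)
    then show "?p c = ennreal (rho_w (l-1) c) * indicator H c / 3 + ennreal (rho_w l c) * indicator H c / 3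
      + ennreal (rho_w (l+1) c) * indicator H c / 3"
      by (auto simp: rho_w_def indicator_def)
  qed
  also have "\<dots> = (\<integral>\<^sup>+ t. ennreal (rho_w (l-1) t) * indicator H t \<partial>count_space UNIV) / 3
      + (\<integral>\<^sup>+ t. ennreal (rho_w l t) * indicator H t \<partial>count_space UNIV) / 3
      + (\<integral>\<^sup>+ t. ennreal (rho_w (l+1) t) * indicator H t \<partial>count_space UNIV) / 3"
    by (simp add: nn_integral_add nn_integral_divide)
  finally show ?thesis .
qed

fun height_below :: "nat \<Rightarrow> ltree \<Rightarrow> bool" where
  "height_below 0 t = False"
| "height_below (Suc n) t = (\<forall>c\<in>set (children t). height_below n c)"

lemma height_below_mono: "height_below n t \<Longrightarrow> n \<le> m \<Longrightarrow> height_below m t"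
proof (induction n arbitrary: t m)
  case (Suc n)
  then show ?case by (cases m) auto
qed simp

lemma ex_height_below: "\<exists>n. height_below n t"
proof (induction t)
  case (Node l cs)
  then obtain f where f: "\<And>c. c \<in> set cs \<Longrightarrow> height_below (f c) c" by metis
  have "height_below (Suc (Max (insert 0 (f ` set cs)))) (Node l cs)"
    using f by (auto intro!: height_below_mono[OF f])
  then show ?case by blast
qed

lemma suminf_half_powers: "(\<Sum>k. ennreal ((1/2)^(k+1))) = 1"
  using power_half_series by (subst suminf_ennreal2) (auto simp: sums_iff)

lemma ennreal_thirds: "(x::ennreal) / 3 + x / 3 + x / 3 = x"
proof (cases x)
  case (real r)
  have "ennreal r / 3 = ennreal (r / 3)"
    using divide_ennreal[of r 3] real by simp
  then show ?thesis using real by (simp flip: ennreal_plus)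
qed (simp add: ennreal_top_divide)

definition rho_mass :: "int \<Rightarrow> ennreal" where
  "rho_mass l = (\<integral>\<^sup>+ t. ennreal (rho_w l t) \<partial>count_space UNIV)"

text \<open>The recursion averages over three labels, so by induction on the height the mass is the
  same for every root label. The bound by 1 keeps the fixed point equation below within finite
  values.\<close>

lemma rho_mass_below:
  "\<exists>w\<le>1. \<forall>l. (\<integral>\<^sup>+ t. ennreal (rho_w l t) * indicator {t. height_below n t} t \<partial>count_space UNIV) = w"
proof (induction n)
  case 0
  show ?case by (intro exI[of _ 0]) simp
next
  case (Suc n)
  then obtain w where w: "w \<le> 1"
    "\<And>l. (\<integral>\<^sup>+ t. ennreal (rho_w l t) * indicator {t. height_below n t} t \<partial>count_space UNIV) = w" by auto
  have *: "(\<integral>\<^sup>+ t. ennreal (rho_w l t) * indicator {t. height_below (Suc n) t} t \<partial>count_space UNIV)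
     = (\<Sum>k. ennreal ((1/2)^(k+1)) * w ^ k)" for l
    using nn_integral_rho_w_children[of l "{t. height_below n t}"]
    by (simp add: w ennreal_thirds subset_eq)
  have "w ^ k \<le> 1" for k using power_mono[OF w(1), of k] by simp
  then have "(\<Sum>k. ennreal ((1/2)^(k+1)) * w ^ k) \<le> (\<Sum>k. ennreal ((1/2)^(k+1)) * 1)"
    by (intro suminf_le mult_left_mono) auto
  then show ?case using * suminf_half_powers by (auto intro!: exI[of _ "\<Sum>k. ennreal ((1/2)^(k+1)) * w ^ k"])
qed

lemma rho_mass_const: "\<exists>w\<le>1. \<forall>l. rho_mass l = w"
proof -
  obtain w where w: "\<And>n. w n \<le> 1"
    "\<And>n l. (\<integral>\<^sup>+ t. ennreal (rho_w l t) * indicator {t. height_below n t} t \<partial>count_space UNIV) = w n"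
    using rho_mass_below by metis
  \<comment> \<open>Every tree has finite height, so the truncated masses exhaust the total
    mass.\<close>
  have "rho_mass l = (\<integral>\<^sup>+ t. (SUP n. ennreal (rho_w l t) * indicator {t. height_below n t} t) \<partial>count_space UNIV)" for l
    unfolding rho_mass_def
  proof (rule nn_integral_cong, rule antisym)
    fix t
    obtain n where "height_below n t" using ex_height_below by auto
    then show "ennreal (rho_w l t) \<le> (SUP n. ennreal (rho_w l t) * indicator {t. height_below n t} t)"
      by (intro SUP_upper2[of n]) auto
  qed (auto intro!: SUP_least simp: indicator_def)
  also have "\<dots> l = (SUP n. w n)" for l
    by (subst nn_integral_monotone_convergence_SUP)
      (auto simp: w(2) incseq_def le_fun_def split: split_indicator dest: height_below_mono)
  finally show ?thesis using w(1) by (intro exI[of _ "SUP n. w n"]) (auto intro: SUP_least)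
qed

lemma rho_mass_eq_1: "rho_mass l = 1"
proof -
  obtain w where w: "w \<le> 1" "\<And>l. rho_mass l = w" using rho_mass_const by metis
  have rec: "w = (\<Sum>k. ennreal ((1/2)^(k+1)) * w ^ k)"
    using nn_integral_rho_w_children[of l UNIV] w(2)[unfolded rho_mass_def]
    by (simp add: ennreal_thirds)
  obtain r where r: "w = ennreal r" "0 \<le> r" "r \<le> 1"
    using w(1) by (cases w) (auto simp: ennreal_le_1 top_unique)
  have s: "(\<lambda>k. 1/2 * (r/2)^k) sums (1/2 * (1 / (1 - r/2)))"
    by (intro sums_mult geometric_sums) (use r in auto)
  have "w = (\<Sum>k. ennreal (1/2 * (r/2)^k))"
    by (subst rec) (simp add: r ennreal_power ennreal_mult[symmetric] power_divide field_simps)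
  also have "\<dots> = ennreal (1/2 * (1 / (1 - r/2)))"
    using s r by (subst suminf_ennreal2) (auto simp: sums_iff)
  finally have "r = 1/2 * (1 / (1 - r/2))" using r by (simp add: r)
  \<comment> \<open>Criticality: r = 1 / (2 - r) has 1 as a double root and no other
    solution.\<close>
  then have "(r - 1)^2 = 0" using r by (simp add: field_simps power2_eq_square)
  then show ?thesis using r w by simp
qed

lemma sets_rho [measurable_cong, simp]: "sets (rho l) = sets (count_space UNIV)"
  by (simp add: rho_def)

lemma space_rho [simp]: "space (rho l) = UNIV"
  by (simp add: rho_def)

lemma prob_space_rho: "prob_space (rho l)"
  by (rule prob_spaceI) (use rho_mass_eq_1[of l] in \<open>simp add: rho_def emeasure_density rho_mass_def\<close>)

section \<open>Random walk on the quadrangulation of a corner map\<close>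

type_synonym 'v corner_map = "int \<Rightarrow> 'v \<times> int"

text \<open>The offset is a natural number, so that \<open>LEAST\<close> is well founded and
  measurable. On good corner maps this is the integer \<open>LEAST\<close> used by
  \<open>succ_corner\<close>, see \<open>next_corner_eq_Least\<close>.\<close>

definition next_corner :: "'v corner_map \<Rightarrow> int \<Rightarrow> int" where
  "next_corner c i = i + 1 + int (LEAST n. snd (c (i + 1 + int n)) = snd (c i) - 1)"

definition origin :: "'v corner_map \<Rightarrow> oedge \<Rightarrow> int" where
  "origin c e = (if snd e then next_corner c (fst e) else fst e)"

definition target :: "'v corner_map \<Rightarrow> oedge \<Rightarrow> int" where
  "target c e = (if snd e then fst e else next_corner c (fst e))"

definition edges_from :: "'v corner_map \<Rightarrow> int \<Rightarrow> oedge set" where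
  "edges_from c i = {e. fst (c (origin c e)) = fst (c i)}"

text \<open>The probability that the walk started at the vertex of corner \<open>i\<close> lies in
  the half-space \<sigma> * label \<le> m at all times 0, ..., n. The sign lets upward and downward
  escape be treated together.\<close>

primrec stay :: "'v corner_map \<Rightarrow> int \<Rightarrow> int \<Rightarrow> nat \<Rightarrow> int \<Rightarrow> real" where
  "stay c \<sigma> m 0 i = of_bool (\<sigma> * snd (c i) \<le> m)"
| "stay c \<sigma> m (Suc n) i = of_bool (\<sigma> * snd (c i) \<le> m) *
     ((\<Sum>e\<in>edges_from c i. stay c \<sigma> m n (target c e)) / real (card (edges_from c i)))"

definition stay_forever :: "'v corner_map \<Rightarrow> int \<Rightarrow> int \<Rightarrow> int \<Rightarrow> real" where
  "stay_forever c \<sigma> m i = lim (\<lambda>n. stay c \<sigma> m n i)"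

text \<open>The deterministic facts about the tree on which the walk argument rests. Low labels to
  the right give successors; low labels to the left, with finitely many corners per vertex, make the
  quadrangulation locally finite; labels unbounded both ways put vertices outside every
  half-space.\<close>

definition good_corner_map :: "'v corner_map \<Rightarrow> bool" where
  "good_corner_map c \<longleftrightarrow>
     (\<forall>i. \<bar>snd (c (i + 1)) - snd (c i)\<bar> \<le> 1) \<and>
     (\<forall>i j. fst (c i) = fst (c j) \<longrightarrow> snd (c i) = snd (c j)) \<and>
     (\<forall>i. finite {j. fst (c j) = fst (c i)}) \<and>
     (\<forall>i m. \<exists>j>i. snd (c j) \<le> m) \<and>
     (\<forall>i m. \<exists>j<i. snd (c j) \<le> m) \<and>
     (\<forall>m. \<exists>j. m \<le> snd (c j))"

text \<open>Corner \<open>i\<close> of \<open>c'\<close> is corner \<open>i + k\<close> of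
  \<open>c\<close>. Vertex names encode a position relative to the spine and the root label is
  normalised to 0, so names and labels both change when the root moves; only the identity of
  vertices and label differences are kept.\<close>

definition shifted :: "nat \<Rightarrow> 'v corner_map \<Rightarrow> 'v corner_map \<Rightarrow> bool" where
  "shifted k c' c \<longleftrightarrow>
     (\<forall>i j. fst (c' i) = fst (c' j) \<longleftrightarrow> fst (c (i + int k)) = fst (c (j + int k))) \<and>
     (\<exists>d. \<forall>i. snd (c' i) = snd (c (i + int k)) - d)"

lemma int_intermediate_value:
  fixes f :: "int \<Rightarrow> int"
  assumes "\<And>i. \<bar>f (i + 1) - f i\<bar> \<le> 1" "a \<le> b" "f b \<le> v" "v \<le> f a"
  shows "\<exists>k. a \<le> k \<and> k \<le> b \<and> f k = v"
proof -
  have "\<exists>i\<le>nat (b - a). - f (a + int i) = - v"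
  proof (rule nat0_intermed_int_val)
    show "\<forall>i<nat (b - a). \<bar>- f (a + int (i + 1)) - - f (a + int i)\<bar> \<le> 1"
    proof (intro allI impI)
      fix i show "\<bar>- f (a + int (i + 1)) - - f (a + int i)\<bar> \<le> 1"
        using assms(1)[of "a + int i"] by (simp add: ac_simps abs_minus_commute)
    qed
  qed (use assms in auto)
  then obtain i where "i \<le> nat (b - a)" "f (a + int i) = v" by auto
  with assms(2) show ?thesis by (intro exI[of _ "a + int i"]) auto
qed

locale corner_map =
  fixes c :: "'v corner_map"
  assumes good: "good_corner_map c"
begin

lemma label_step: "\<bar>snd (c (i + 1)) - snd (c i)\<bar> \<le> 1"
  and label_cong: "fst (c i) = fst (c j) \<Longrightarrow> snd (c i) = snd (c j)"
  and finite_corners: "finite {j. fst (c j) = fst (c i)}"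
  and label_low_right: "\<exists>j>i. snd (c j) \<le> m"
  and label_low_left: "\<exists>j<i. snd (c j) \<le> m"
  and label_high: "\<exists>j. m \<le> snd (c j)"
  using good unfolding good_corner_map_def by blast+

lemma next_corner_eqI:
  assumes "i < j" "snd (c j) = snd (c i) - 1" "\<And>k. i < k \<Longrightarrow> k < j \<Longrightarrow> snd (c k) \<noteq> snd (c i) - 1"
  shows "next_corner c i = j"
proof -
  have "(LEAST n. snd (c (i + 1 + int n)) = snd (c i) - 1) = nat (j - i - 1)"
  proof (rule Least_equality)
    show "snd (c (i + 1 + int (nat (j - i - 1)))) = snd (c i) - 1" using assms(1,2) by simp
    fix n assume n: "snd (c (i + 1 + int n)) = snd (c i) - 1"
    show "nat (j - i - 1) \<le> n"
      using assms(3)[of "i + 1 + int n"] n by linarith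
  qed
  then show ?thesis using assms(1) by (simp add: next_corner_def)
qed

lemma ex_next_corner: "\<exists>n. snd (c (i + 1 + int n)) = snd (c i) - 1"
proof -
  obtain j where j: "i < j" "snd (c j) \<le> snd (c i) - 1" using label_low_right by blast
  obtain k where k: "i \<le> k" "k \<le> j" "snd (c k) = snd (c i) - 1"
    using int_intermediate_value[of "\<lambda>i. snd (c i)" i j "snd (c i) - 1"] label_step j by auto
  then have "i < k" by (cases "i = k") auto
  then show ?thesis using k by (intro exI[of _ "nat (k - i - 1)"]) auto
qed

lemma next_corner_gt: "i < next_corner c i"
  by (simp add: next_corner_def)

lemma label_next_corner: "snd (c (next_corner c i)) = snd (c i) - 1"
  unfolding next_corner_def by (rule LeastI_ex[OF ex_next_corner])

lemma next_corner_le: "i < j \<Longrightarrow> snd (c j) = snd (c i) - 1 \<Longrightarrow> next_corner c i \<le> j"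
  using Least_le[of "\<lambda>n. snd (c (i + 1 + int n)) = snd (c i) - 1" "nat (j - i - 1)"]
  by (simp add: next_corner_def)

lemma next_corner_eq_Least:
  "next_corner c i = (LEAST j. i < j \<and> snd (c j) = snd (c i) - 1)"
  by (rule Least_equality[symmetric]) (auto simp: next_corner_gt label_next_corner next_corner_le)

text \<open>Left of \<open>s\<close> there is a corner \<open>k\<close> with label at most that of
  \<open>s\<close>. A corner to the left of \<open>k\<close> with successor \<open>s\<close> has a
  larger label, so it would meet the label of \<open>s\<close> no later than \<open>k\<close> and
  have its successor there.\<close>

lemma finite_predecessors: "finite {j. next_corner c j = s}"
proof -
  obtain k where k: "k < s" "snd (c k) \<le> snd (c s)" using label_low_left by blast
  have "j \<in> {k..s}" if "next_corner c j = s" for j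
  proof -
    have "k \<le> j"
    proof (rule ccontr)
      assume "\<not> k \<le> j"
      moreover have "snd (c s) \<le> snd (c j)" using label_next_corner[of j, unfolded that] by simp
      ultimately obtain l where l: "j \<le> l" "l \<le> k" "snd (c l) = snd (c s)"
        using int_intermediate_value[of "\<lambda>i. snd (c i)" j k "snd (c s)"] label_step k by auto
      then have "j \<noteq> l" using label_next_corner[of j, unfolded that] by auto
      then show False using next_corner_le[of j l, unfolded that] l k label_next_corner[of j, unfolded that] by auto
    qed
    then show ?thesis using next_corner_gt[of j, unfolded that] by auto
  qed
  then have "{j. next_corner c j = s} \<subseteq> {k..s}" by blast
  then show ?thesis by (rule finite_subset) simp
qed

lemma finite_edges_from: "finite (edges_from c i)"
proof -
  let ?S = "{j. fst (c j) = fst (c i)}"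
  have "edges_from c i \<subseteq> (\<lambda>j. (j, False)) ` ?S \<union> (\<lambda>j. (j, True)) ` (\<Union>s\<in>?S. {j. next_corner c j = s})"
    by (auto simp: edges_from_def origin_def split: if_splits)
  then show ?thesis
    by (rule finite_subset) (auto intro!: finite_corners finite_predecessors)
qed

lemma edges_from_nonempty: "edges_from c i \<noteq> {}"
proof -
  have "(i, False) \<in> edges_from c i" by (simp add: edges_from_def origin_def)
  then show ?thesis by blast
qed

lemma card_edges_from_pos: "0 < card (edges_from c i)"
  using finite_edges_from edges_from_nonempty by (simp add: card_gt_0_iff)

lemma edges_from_cong: "fst (c i) = fst (c j) \<Longrightarrow> edges_from c i = edges_from c j"
  by (simp add: edges_from_def)

text \<open>It is enough to compare \<open>i\<close> with \<open>i + 1\<close>. If the label drops,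
  \<open>i + 1\<close> is the successor of \<open>i\<close>; if it stays, both have the same
  successor; if it rises, the second iterated successor of \<open>i + 1\<close> is the successor of
  \<open>i\<close>.\<close>

lemma next_corner_chains_merge:
  assumes "\<And>i. f (next_corner c i) = f i"
  shows "f i = f j"
proof -
  have step: "f (i + 1) = f i" for i
  proof -
    consider "snd (c (i + 1)) = snd (c i) - 1" | "snd (c (i + 1)) = snd (c i)" | "snd (c (i + 1)) = snd (c i) + 1"
      using label_step[of i] by linarith
    then show ?thesis
    proof cases
      case 1
      then have "next_corner c i = i + 1" by (intro next_corner_eqI) auto
      then show ?thesis using assms[of i] by simp
    next
      case 2
      have "next_corner c i = next_corner c (i + 1)"
      proof (rule next_corner_eqI)
        fix k assume k: "i < k" "k < next_corner c (i + 1)"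
        show "snd (c k) \<noteq> snd (c i) - 1"
        proof (cases "k = i + 1")
          case False
          then show ?thesis using next_corner_le[of "i+1" k] k 2 by force
        qed (use 2 in auto)
      qed (use next_corner_gt[of "i+1"] label_next_corner[of "i+1"] 2 in auto)
      then show ?thesis using assms[of i] assms[of "i + 1"] by simp
    next
      case 3
      let ?j = "next_corner c (i + 1)"
      have j: "snd (c ?j) = snd (c i)" using label_next_corner[of "i+1"] 3 by simp
      \<comment> \<open>The labels start at \<open>i + 1\<close> above the label of
        \<open>i\<close>, so they pass that label before going below it.\<close>
      have *: "?j < k" if k: "i < k" "snd (c k) = snd (c i) - 1" for k
      proof -
        have "i + 1 \<noteq> k" using k 3 by auto
        then obtain l where l: "i + 1 \<le> l" "l \<le> k" "snd (c l) = snd (c i)"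
          using int_intermediate_value[of "\<lambda>i. snd (c i)" "i+1" k "snd (c i)"] label_step k 3 by auto
        then have "i + 1 \<noteq> l" using 3 by auto
        then have "?j \<le> l" using l 3 by (intro next_corner_le) auto
        moreover have "l \<noteq> k" using k l by auto
        ultimately show ?thesis using l by simp
      qed
      have "next_corner c i = next_corner c ?j"
      proof (rule next_corner_eqI)
        show "i < next_corner c ?j" using next_corner_gt[of "i+1"] next_corner_gt[of ?j] by simp
        show "snd (c (next_corner c ?j)) = snd (c i) - 1" using label_next_corner[of ?j] j by simp
        fix k assume k: "i < k" "k < next_corner c ?j"
        show "snd (c k) \<noteq> snd (c i) - 1"
          using *[OF k(1)] next_corner_le[of ?j k] k(2) j by force
      qed
      then show ?thesis using assms[of i] assms[of "i + 1"] assms[of ?j] by simp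
    qed
  qed
  have "f (i + int n) = f i" for i n
  proof (induction n)
    case (Suc n)
    then show ?case using step[of "i + int n"] by (simp add: ac_simps)
  qed simp
  from this[of i "nat (j - i)"] this[of j "nat (i - j)"] show ?thesis by (cases "i \<le> j") auto
qed

section \<open>Probabilities of staying in a half-space of labels\<close>

lemma stay_bounds: "0 \<le> stay c \<sigma> m n i" "stay c \<sigma> m n i \<le> 1"
proof (induction n arbitrary: i)
  case (Suc n)
  { case 1 show ?case using Suc by (auto intro!: divide_nonneg_nonneg sum_nonneg) }
  { case 2
    have "(\<Sum>e\<in>edges_from c i. stay c \<sigma> m n (target c e)) \<le> (\<Sum>e\<in>edges_from c i. 1)"
      by (rule sum_mono) (rule Suc)
    then show ?case using card_edges_from_pos[of i] by (auto simp: divide_simps) }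
qed auto

lemma stay_Suc_le: "stay c \<sigma> m (Suc n) i \<le> stay c \<sigma> m n i"
proof (induction n arbitrary: i)
  case 0
  then show ?case using stay_bounds(2)[of \<sigma> m "Suc 0" i] by auto
next
  case (Suc n)
  have "(\<Sum>e\<in>edges_from c i. stay c \<sigma> m (Suc n) (target c e)) \<le> (\<Sum>e\<in>edges_from c i. stay c \<sigma> m n (target c e))"
    by (rule sum_mono) (rule Suc)
  then show ?case
    by (subst (1 2) stay.simps(2)) (auto intro!: divide_right_mono simp del: stay.simps)
qed

lemma stay_LIMSEQ: "(\<lambda>n. stay c \<sigma> m n i) \<longlonglongrightarrow> stay_forever c \<sigma> m i"
proof -
  have "decseq (\<lambda>n. stay c \<sigma> m n i)" using stay_Suc_le by (rule decseq_SucI)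
  then have "convergent (\<lambda>n. stay c \<sigma> m n i)"
    using decseq_convergent[of _ 0] stay_bounds(1) by (metis convergentI)
  then show ?thesis by (simp add: stay_forever_def convergent_LIMSEQ_iff)
qed

lemma stay_forever_bounds: "0 \<le> stay_forever c \<sigma> m i" "stay_forever c \<sigma> m i \<le> 1"
  using LIMSEQ_le_const[OF stay_LIMSEQ, of 0] LIMSEQ_le_const2[OF stay_LIMSEQ, of _ _ _ 1] stay_bounds
  by auto

lemma stay_cong: "fst (c i) = fst (c j) \<Longrightarrow> stay c \<sigma> m n i = stay c \<sigma> m n j"
  by (cases n) (auto simp: label_cong[of i j] edges_from_cong[of i j])

lemma stay_forever_cong: "fst (c i) = fst (c j) \<Longrightarrow> stay_forever c \<sigma> m i = stay_forever c \<sigma> m j"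
  by (simp add: stay_forever_def stay_cong[of i j])

lemma stay_forever_eq_0: "m < \<sigma> * snd (c i) \<Longrightarrow> stay_forever c \<sigma> m i = 0"
proof -
  assume "m < \<sigma> * snd (c i)"
  then have "stay c \<sigma> m n i = 0" for n by (cases n) auto
  then show ?thesis by (simp add: stay_forever_def)
qed

lemma stay_forever_harmonic:
  assumes "\<sigma> * snd (c i) \<le> m"
  shows "(\<Sum>e\<in>edges_from c i. stay_forever c \<sigma> m (target c e))
       = real (card (edges_from c i)) * stay_forever c \<sigma> m i"
proof -
  have "(\<lambda>n. stay c \<sigma> m (Suc n) i) \<longlonglongrightarrow>
     (\<Sum>e\<in>edges_from c i. stay_forever c \<sigma> m (target c e)) / real (card (edges_from c i))"
    using assms by (auto intro!: tendsto_intros stay_LIMSEQ card_edges_from_pos simp: finite_edges_from edges_from_nonempty)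
  then have "stay_forever c \<sigma> m i =
     (\<Sum>e\<in>edges_from c i. stay_forever c \<sigma> m (target c e)) / real (card (edges_from c i))"
    using LIMSEQ_Suc[OF stay_LIMSEQ] LIMSEQ_unique by blast
  then show ?thesis using card_edges_from_pos[of i] by (simp add: field_simps)
qed

end

section \<open>Flux and jumps along arcs\<close>

definition flux :: "'v corner_map \<Rightarrow> int \<Rightarrow> nat \<Rightarrow> oedge \<Rightarrow> real" where
  "flux c \<sigma> K e = (\<Sum>k\<le>K. 
     stay_forever c \<sigma> (\<sigma> * snd (c (origin c e)) + int k) (origin c e) *
     (stay_forever c \<sigma> (\<sigma> * snd (c (origin c e)) + int k) (origin c e)
      - stay_forever c \<sigma> (\<sigma> * snd (c (origin c e)) + int k) (target c e)))"

text \<open>The levels are counted from the lower end of the arc, so that this is invariant under relabelling.\<close>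
definition arc_jump :: "'v corner_map \<Rightarrow> int \<Rightarrow> int \<Rightarrow> nat \<Rightarrow> real" where
  "arc_jump c \<sigma> i k =
     (let m = min (\<sigma> * snd (c i)) (\<sigma> * snd (c (next_corner c i))) + int k
      in stay_forever c \<sigma> m i - stay_forever c \<sigma> m (next_corner c i))"

context corner_map
begin

text \<open>All edges leaving a vertex use the same levels \<sigma> * label + k with k \<ge> 0. At
  these levels the vertex lies inside the half-space, where \<open>stay_forever\<close> is harmonic,
  so the differences sum to zero.\<close>

lemma sum_flux_edges_from: "(\<Sum>e\<in>edges_from c i. flux c \<sigma> K e) = 0"
proof -
  let ?u = "\<lambda>k. stay_forever c \<sigma> (\<sigma> * snd (c i) + int k)"
  have "(\<Sum>e\<in>edges_from c i. flux c \<sigma> K e)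
      = (\<Sum>e\<in>edges_from c i. \<Sum>k\<le>K. ?u k i * (?u k i - ?u k (target c e)))"
  proof (intro sum.cong refl)
    fix e assume "e \<in> edges_from c i"
    then have e: "fst (c (origin c e)) = fst (c i)" by (simp add: edges_from_def)
    show "flux c \<sigma> K e = (\<Sum>k\<le>K. ?u k i * (?u k i - ?u k (target c e)))"
      by (simp add: flux_def label_cong[OF e] stay_forever_cong[OF e])
  qed
  also have "\<dots> = (\<Sum>k\<le>K. \<Sum>e\<in>edges_from c i. ?u k i * (?u k i - ?u k (target c e)))"
    by (rule sum.swap)
  also have "\<dots> = (\<Sum>k\<le>K. ?u k i * (real (card (edges_from c i)) * ?u k i - (\<Sum>e\<in>edges_from c i. ?u k (target c e))))"
    by (simp add: sum_distrib_left[symmetric] sum_subtractf)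
  also have "\<dots> = 0" by (subst stay_forever_harmonic) auto
  finally show ?thesis .
qed

lemma abs_flux_le: "\<bar>flux c \<sigma> K e\<bar> \<le> real K + 1"
proof -
  have *: "\<bar>a * (a - b)\<bar> \<le> 1" if "0 \<le> a" "a \<le> 1" "0 \<le> b" "b \<le> 1" for a b :: real
    using mult_mono[of "\<bar>a\<bar>" 1 "\<bar>a - b\<bar>" 1] that by (auto simp: abs_mult)
  have "\<bar>flux c \<sigma> K e\<bar> \<le> (\<Sum>k\<le>K. 1)"
    unfolding flux_def by (rule order.trans[OF sum_abs sum_mono]) (intro * stay_forever_bounds)
  then show ?thesis by simp
qed

lemma abs_arc_jump_le: "\<bar>arc_jump c \<sigma> i k\<bar> \<le> 1"
proof -
  have "\<bar>a - b\<bar> \<le> 1" if "0 \<le> a" "a \<le> 1" "0 \<le> b" "b \<le> 1" for a b :: real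
    using that by linarith
  then show ?thesis by (simp add: arc_jump_def Let_def stay_forever_bounds)
qed

text \<open>Let x be the end with the smaller value p of \<sigma> * label, and y the other end, at p
  + 1. The flux from x runs over the levels p, ..., p + K and the flux from y over p + 1, ..., p + K
  + 1. Since y is outside the half-space of level p, its term there is 0 and may be added. The
  matched levels give squares, and the remaining term of y at level p + K + 1 is at least minus the
  absolute jump.\<close>

lemma flux_arc:
  assumes "\<sigma> = 1 \<or> \<sigma> = -1"
  shows "(\<Sum>k\<le>K. (arc_jump c \<sigma> i k)\<^sup>2) \<le> flux c \<sigma> K (i, False) + flux c \<sigma> K (i, True) + \<bar>arc_jump c \<sigma> i (Suc K)\<bar>"
proof -
  have main: "(\<Sum>k\<le>K. (u (p + int k) x - u (p + int k) y)\<^sup>2)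
      \<le> (\<Sum>k\<le>K. u (p + int k) x * (u (p + int k) x - u (p + int k) y))
      + (\<Sum>k\<le>K. u (p + 1 + int k) y * (u (p + 1 + int k) y - u (p + 1 + int k) x))
      + \<bar>u (p + int (Suc K)) x - u (p + int (Suc K)) y\<bar>"
    if u: "\<And>m z. 0 \<le> u m z" "\<And>m z. u m z \<le> 1" "u p y = 0" for u :: "int \<Rightarrow> int \<Rightarrow> real" and p x y
  proof -
    have "(\<Sum>k\<le>Suc K. u (p + int k) y * (u (p + int k) y - u (p + int k) x))
       = (\<Sum>k\<le>K. u (p + 1 + int k) y * (u (p + 1 + int k) y - u (p + 1 + int k) x))"
      by (subst sum.atMost_Suc_shift) (simp add: u add.assoc)
    moreover have "(\<Sum>k\<le>Suc K. u (p + int k) y * (u (p + int k) y - u (p + int k) x))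
       = (\<Sum>k\<le>K. u (p + int k) y * (u (p + int k) y - u (p + int k) x))
        + u (p + int (Suc K)) y * (u (p + int (Suc K)) y - u (p + int (Suc K)) x)" by simp
    moreover have "- (b * (b - a)) \<le> \<bar>a - b\<bar>" if "0 \<le> b" "b \<le> 1" for a b :: real
    proof -
      have "- (b * (b - a)) = b * (a - b)" by (simp add: algebra_simps)
      also have "\<dots> \<le> b * \<bar>a - b\<bar>" using that by (intro mult_left_mono) auto
      also have "\<dots> \<le> 1 * \<bar>a - b\<bar>" using that by (intro mult_right_mono) auto
      finally show ?thesis by simp
    qed
    from this[OF u(1) u(2), of "p + int (Suc K)" y "u (p + int (Suc K)) x"]
    have "- (u (p + int (Suc K)) y * (u (p + int (Suc K)) y - u (p + int (Suc K)) x))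
        \<le> \<bar>u (p + int (Suc K)) x - u (p + int (Suc K)) y\<bar>" .
    moreover have "(\<Sum>k\<le>K. (u (p + int k) x - u (p + int k) y)\<^sup>2)
      = (\<Sum>k\<le>K. u (p + int k) x * (u (p + int k) x - u (p + int k) y))
      + (\<Sum>k\<le>K. u (p + int k) y * (u (p + int k) y - u (p + int k) x))"
      by (simp add: sum.distrib[symmetric] power2_eq_square algebra_simps)
    ultimately show ?thesis by linarith
  qed
  let ?u = "stay_forever c \<sigma>"
  let ?j = "next_corner c i"
  have l: "snd (c ?j) = snd (c i) - 1" by (rule label_next_corner)
  from assms show ?thesis
  proof
    \<comment> \<open>The lower end x is the successor in this case and corner \<open>i\<close> in
      the other one.\<close>
    assume [simp]: "\<sigma> = 1"
    have "?u (snd (c ?j)) i = 0" by (rule stay_forever_eq_0) (simp add: l)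
    then show ?thesis
      using main[of ?u "snd (c ?j)" i ?j] stay_forever_bounds
      by (simp add: flux_def arc_jump_def origin_def target_def Let_def l add.commute add.left_commute power2_commute min_def abs_minus_commute)
  next
    assume [simp]: "\<sigma> = -1"
    have "?u (- snd (c i)) ?j = 0" by (rule stay_forever_eq_0) (simp add: l)
    then show ?thesis
      using main[of ?u "- snd (c i)" ?j i] stay_forever_bounds
      by (simp add: flux_def arc_jump_def origin_def target_def Let_def l add.commute add.left_commute power2_commute min_def abs_minus_commute)
  qed
qed

lemma stay_forever_eq_0_of_no_jumps:
  assumes "\<sigma> = 1 \<or> \<sigma> = -1" "\<And>i k. arc_jump c \<sigma> i k = 0"
  shows "stay_forever c \<sigma> m i = 0"
proof -
  \<comment> \<open>From the lower end of the arc upwards, \<open>m\<close> is one of the levels in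
    \<open>arc_jump\<close>; below it both ends are outside the half-space.\<close>
  have "stay_forever c \<sigma> m (next_corner c j) = stay_forever c \<sigma> m j" for j
  proof (cases "min (\<sigma> * snd (c j)) (\<sigma> * snd (c (next_corner c j))) \<le> m")
    case True
    then show ?thesis
      using assms(2)[of j "nat (m - min (\<sigma> * snd (c j)) (\<sigma> * snd (c (next_corner c j))))"]
      by (simp add: arc_jump_def)
  next
    case False
    then show ?thesis by (auto simp: stay_forever_eq_0)
  qed
  then have *: "stay_forever c \<sigma> m i = stay_forever c \<sigma> m j" for j by (rule next_corner_chains_merge)
  obtain j where "m < \<sigma> * snd (c j)"
  proof -
    obtain j k where "m + 1 \<le> snd (c j)" "snd (c k) \<le> - m - 1"
      using label_high[of "m + 1"] label_low_left[of 0 "- m - 1"] by blast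
    then have "m < 1 * snd (c j)" "m < - 1 * snd (c k)" by auto
    then show ?thesis using assms(1) that by metis
  qed
  then show ?thesis using *[of j] stay_forever_eq_0 by auto
qed

end

section \<open>Invariance under a shift of the corner indices\<close>

lemma shifted_next_corner: "shifted k c' c \<Longrightarrow> next_corner c' i = next_corner c (i + int k) - int k"
proof -
  assume "shifted k c' c"
  then obtain d where d: "\<And>i. snd (c' i) = snd (c (i + int k)) - d" by (auto simp: shifted_def)
  have "(snd (c' (i + 1 + int n)) = snd (c' i) - 1)
      = (snd (c (i + int k + 1 + int n)) = snd (c (i + int k)) - 1)" for n
    by (simp add: d ac_simps)
  then show ?thesis by (simp add: next_corner_def)
qed

lemma shifted_origin: "shifted k c' c \<Longrightarrow> origin c' (i, b) = origin c (i + int k, b) - int k"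
  by (auto simp: origin_def shifted_next_corner)

lemma shifted_target: "shifted k c' c \<Longrightarrow> target c' (i, b) = target c (i + int k, b) - int k"
  by (auto simp: target_def shifted_next_corner)

lemma shifted_edges_from:
  assumes "shifted k c' c"
  shows "edges_from c (i + int k) = (\<lambda>(j, b). (j + int k, b)) ` edges_from c' i"
proof -
  have *: "(j, b) \<in> edges_from c' i \<longleftrightarrow> (j + int k, b) \<in> edges_from c (i + int k)" for j b
    using assms by (simp add: edges_from_def shifted_origin[OF assms]) (simp add: shifted_def)
  have "(j, b) \<in> (\<lambda>(j, b). (j + int k, b)) ` edges_from c' i" if "(j, b) \<in> edges_from c (i + int k)" for j b
    using *[of "j - int k" b] that by (force simp: image_iff)
  then show ?thesis using * by auto
qed

lemma inj_shift_edge: "inj_on (\<lambda>(j, b). (j + int k, b :: bool)) A"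
  by (auto simp: inj_on_def)

text \<open>Subtracting \<open>d\<close> from all labels turns the half-space of level m + \<sigma>
  * d into that of level \<open>m\<close>. An absolute level is therefore not invariant, while a
  level counted from a label is.\<close>

lemma shifted_stay:
  assumes s: "shifted k c' c" and d: "\<And>i. snd (c' i) = snd (c (i + int k)) - d"
  shows "stay c' \<sigma> m n i = stay c \<sigma> (m + \<sigma> * d) n (i + int k)"
proof (induction n arbitrary: i)
  case 0
  then show ?case by (auto simp: d algebra_simps)
next
  case (Suc n)
  have "target c (j + int k, b) = target c' (j, b) + int k" for j b
    by (simp add: shifted_target[OF s])
  then have "(\<Sum>e\<in>edges_from c (i + int k). stay c \<sigma> (m + \<sigma> * d) n (target c e))
      = (\<Sum>e\<in>edges_from c' i. stay c' \<sigma> m n (target c' e))"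
    unfolding shifted_edges_from[OF s]
    by (subst sum.reindex) (auto intro!: inj_shift_edge sum.cong simp: Suc)
  moreover have "card (edges_from c (i + int k)) = card (edges_from c' i)"
    unfolding shifted_edges_from[OF s] by (intro card_image inj_shift_edge)
  moreover have "(\<sigma> * snd (c' i) \<le> m) = (\<sigma> * snd (c (i + int k)) \<le> m + \<sigma> * d)"
    by (simp add: d algebra_simps)
  ultimately show ?case by simp
qed

lemma shifted_stay_forever:
  assumes "shifted k c' c" "\<And>i. snd (c' i) = snd (c (i + int k)) - d"
  shows "stay_forever c' \<sigma> m i = stay_forever c \<sigma> (m + \<sigma> * d) (i + int k)"
  by (simp add: stay_forever_def shifted_stay[OF assms])

lemma shifted_flux:
  assumes s: "shifted k c' c"
  shows "flux c' \<sigma> K (i, b) = flux c \<sigma> K (i + int k, b)"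
proof -
  obtain d where d: "\<And>i. snd (c' i) = snd (c (i + int k)) - d" using s by (auto simp: shifted_def)
  show ?thesis
    by (simp add: flux_def shifted_origin[OF s] shifted_target[OF s] shifted_stay_forever[OF s d] d algebra_simps)
qed

lemma shifted_arc_jump:
  assumes s: "shifted k c' c"
  shows "arc_jump c' \<sigma> i j = arc_jump c \<sigma> (i + int k) j"
proof -
  obtain d where d: "\<And>i. snd (c' i) = snd (c (i + int k)) - d" using s by (auto simp: shifted_def)
  have *: "min (a - x) (b - x) + y + x = min a b + y" for a b x y :: int by (auto simp: min_def)
  show ?thesis
    by (simp add: arc_jump_def Let_def shifted_next_corner[OF s] shifted_stay_forever[OF s d] d right_diff_distrib)
      (simp only: *)
qed

lemma shifted_0: "shifted 0 c c"
  by (auto simp: shifted_def intro: exI[of _ 0])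

lemma shifted_trans:
  assumes "shifted k a b" "shifted l b c"
  shows "shifted (k + l) a c"
proof -
  obtain d d' where "\<And>i. snd (a i) = snd (b (i + int k)) - d" "\<And>i. snd (b i) = snd (c (i + int l)) - d'"
    using assms by (auto simp: shifted_def)
  then have "\<forall>i. snd (a i) = snd (c (i + int (k + l))) - (d + d')" by (auto simp: algebra_simps)
  then show ?thesis using assms unfolding shifted_def by (auto simp: add.assoc intro: exI[of _ "d + d'"])
qed

section \<open>Moving the root corner\<close>

type_synonym environment = "nat \<Rightarrow> int \<times> ltree \<times> ltree"

text \<open>Lets \<open>corner\<close> be reused for the tree alone; the sign and the uniform
  variables receive default values.\<close>

definition sample_of :: "environment \<Rightarrow> sample" where
  "sample_of e = (False, \<lambda>n. (fst (e n), fst (snd (e n)), snd (snd (e n)), 0))"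

definition environment_of :: "sample \<Rightarrow> environment" where
  "environment_of \<omega> n = (step \<omega> n, Ltree \<omega> n, Rtree \<omega> n)"

definition env_corner :: "environment \<Rightarrow> int \<Rightarrow> vertex \<times> int" where
  "env_corner e = corner (sample_of e)"

definition env_spine :: "environment \<Rightarrow> nat \<Rightarrow> int" where
  "env_spine e n = (\<Sum>k<n. fst (e k))"

definition env_left :: "environment \<Rightarrow> nat \<Rightarrow> (vertex \<times> int) list" where
  "env_left e n = map (\<lambda>(p, x). (vtx n False p, env_spine e n + x)) (contour (fst (snd (e n))))"

definition env_right :: "environment \<Rightarrow> nat \<Rightarrow> (vertex \<times> int) list" where
  "env_right e n = map (\<lambda>(p, x). (vtx n True p, env_spine e n + x)) (rcontour (snd (snd (e n))))"

lemma env_corner_eq: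
  "env_corner e i = (if 0 \<le> i then pick (env_left e) 0 (nat i) else pick (env_right e) 0 (nat (- i)))"
proof -
  have "left_corners (sample_of e) = env_left e" "right_corners (sample_of e) = env_right e"
    by (rule ext, simp add: left_corners_def right_corners_def env_left_def env_right_def sample_of_def
      spineX_def env_spine_def step_def Ltree_def Rtree_def)+
  then show ?thesis by (simp add: env_corner_def corner_def)
qed

lemma corner_eq_env_corner: "corner \<omega> = env_corner (environment_of \<omega>)"
proof -
  have "left_corners \<omega> = left_corners (sample_of (environment_of \<omega>))"
       "right_corners \<omega> = right_corners (sample_of (environment_of \<omega>))"
    by (rule ext, simp add: left_corners_def right_corners_def sample_of_def environment_of_def
      spineX_def step_def Ltree_def Rtree_def)+
  then show ?thesis by (intro ext) (simp add: env_corner_def corner_def)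
qed

text \<open>Grafted trees are stored with root label 0, so a tree that changes its place, or a
  subtree that becomes a grafted tree, has to be relabelled.\<close>

fun shift_tree :: "int \<Rightarrow> ltree \<Rightarrow> ltree" where
  "shift_tree d (Node l cs) = Node (l + d) (map (shift_tree d) cs)"

lemma root_label_shift_tree [simp]: "root_label (shift_tree d t) = root_label t + d"
  by (cases t) auto

lemma shift_tree_shift_tree [simp]: "shift_tree a (shift_tree b t) = shift_tree (a + b) t"
  by (induction t) (auto simp: algebra_simps)

lemma shift_tree_0 [simp]: "shift_tree 0 t = t"
  by (induction t) (auto intro: map_idI)

lemma gw_weight_shift_tree [simp]: "gw_weight (shift_tree d t) = gw_weight t"
proof (induction t)
  case (Node l cs)
  then show ?case by (auto intro!: arg_cong[where f = prod_list] simp: comp_def)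
qed

lemma contour_shift_tree: "contour (shift_tree d t) = map (\<lambda>(p, x). (p, x + d)) (contour t)"
  and contours_shift_tree: "contours (l + d) i (map (shift_tree d) cs) = map (\<lambda>(p, x). (p, x + d)) (contours l i cs)"
  by (induction t and l i cs rule: contour_contours.induct) auto

lemma rcontour_shift_tree: "rcontour (shift_tree d t) = map (\<lambda>(p, x). (p, x + d)) (rcontour t)"
  and rcontours_shift_tree: "rcontours (l + d) i (map (shift_tree d) cs) = map (\<lambda>(p, x). (p, x + d)) (rcontours l i cs)"
  by (induction t and l i cs rule: rcontour_rcontours.induct) auto

text \<open>Undoes the renumbering of siblings that takes place when the first child is cut
  off.\<close>

fun incr_hd :: "nat list \<Rightarrow> nat list" where
  "incr_hd [] = []"
| "incr_hd (n # ns) = Suc n # ns"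

lemma contours_Suc: "contours l (Suc i) cs = map (\<lambda>(p, x). (incr_hd p, x)) (contours l i cs)"
  by (induction cs arbitrary: i) auto

text \<open>Counterclockwise the last child is explored before its siblings, so an appended child
  adds a block in front. This is the effect of \<open>merge_grafts\<close> on the right
  side.\<close>

lemma rcontours_append:
  "rcontours l i (cs @ [d]) = map (\<lambda>(p, x). ((i + length cs) # p, x)) (rcontour d) @ [([], l)] @ rcontours l i cs"
  by (induction cs arbitrary: i) auto

lemma contour_nonempty [simp]: "contour t \<noteq> []"
  by (cases t) auto

lemma rcontour_nonempty [simp]: "rcontour t \<noteq> []"
  by (cases t) auto

lemma contour_hd: "contour t ! 0 = ([], root_label t)"
  by (cases t) auto

lemma rcontour_hd: "rcontour t ! 0 = ([], root_label t)"
  by (cases t) auto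

lemma contour_root: "([], x) \<in> set (contour t) \<Longrightarrow> x = root_label t"
proof -
  have "([], x) \<in> set (contours l i cs) \<Longrightarrow> x = l" for l i cs
    by (induction cs arbitrary: i) auto
  then show "([], x) \<in> set (contour t) \<Longrightarrow> x = root_label t" by (cases t) auto
qed

lemma rcontour_root: "([], x) \<in> set (rcontour t) \<Longrightarrow> x = root_label t"
proof -
  have "([], x) \<in> set (rcontours l i cs) \<Longrightarrow> x = l" for l i cs
    by (induction cs arbitrary: i) auto
  then show "([], x) \<in> set (rcontour t) \<Longrightarrow> x = root_label t" by (cases t) auto
qed

lemma rcontour_hd_less: "(j # p, x) \<in> set (rcontour t) \<Longrightarrow> j < length (children t)"
proof -
  have "(j # p, x) \<in> set (rcontours l i cs) \<Longrightarrow> j < i + length cs" for l i cs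
    by (induction cs arbitrary: i) force+
  from this[of "root_label t" 0 "children t"] show "(j # p, x) \<in> set (rcontour t) \<Longrightarrow> j < length (children t)"
    by (cases t) auto
qed

declare pick.simps [simp del]

lemma pick_Suc: "pick f (Suc n) k = pick (\<lambda>n. f (Suc n)) n k"
proof (induction "\<lambda>n. f (Suc n)" n k rule: pick.induct)
  case (1 n k)
  then show ?case by (subst (1 2) pick.simps) auto
qed

lemma pick_0: "f 0 \<noteq> [] \<Longrightarrow> pick f 0 k =
    (if k < length (f 0) then f 0 ! k else pick (\<lambda>n. f (Suc n)) 0 (k - length (f 0)))"
  by (subst pick.simps) (simp add: pick_Suc)

lemma pick_map: "(\<And>n. f n \<noteq> []) \<Longrightarrow> pick (\<lambda>n. map h (f n)) n k = h (pick f n k)"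
proof (induction f n k rule: pick.induct)
  case (1 f n k)
  then show ?case by (subst (1 2) pick.simps) auto
qed

lemma pick_in_set: "(\<And>n. f n \<noteq> []) \<Longrightarrow> \<exists>m\<ge>n. pick f n k \<in> set (f m)"
proof (induction f n k rule: pick.induct)
  case (1 f n k)
  show ?case
  proof (cases "k < length (f n)")
    case True
    then show ?thesis by (subst pick.simps) auto
  next
    case False
    then obtain m where "m \<ge> Suc n" "pick f (Suc n) (k - length (f n)) \<in> set (f m)"
      using 1 by blast
    then show ?thesis using False 1(2)[of n] by (subst pick.simps) (auto intro!: exI[of _ m])
  qed
qed

text \<open>Each block contributes at least one entry, so the head of block \<open>n\<close> stands
  at position \<open>n\<close> or later. In this way spine vertices are found arbitrarily far out in
  the corner sequence.\<close>

lemma ex_pick: "(\<And>n. f n \<noteq> []) \<Longrightarrow> \<exists>k\<ge>n. pick f 0 k = f n ! 0"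
proof (induction n arbitrary: f)
  case 0
  then have "pick f 0 0 = f 0 ! 0" by (simp add: pick_0)
  then show ?case by blast
next
  case (Suc n)
  then obtain k where "k \<ge> n" "pick (\<lambda>n. f (Suc n)) 0 k = f (Suc n) ! 0"
    using Suc.IH[of "\<lambda>n. f (Suc n)"] by auto
  moreover have "length (f 0) \<ge> 1" using Suc.prems[of 0] by (cases "f 0") auto
  ultimately show ?case using Suc.prems[of 0]
    by (intro exI[of _ "k + length (f 0)"]) (auto simp: pick_0)
qed

lemma env_left_nonempty [simp]: "env_left e n \<noteq> []"
  and env_right_nonempty [simp]: "env_right e n \<noteq> []"
  by (auto simp: env_left_def env_right_def)

text \<open>Here \<open>a\<close> sits at S(0) and \<open>b\<close> at S(1). Seen from S(1), the
  label of S(0) is \<open>- fst a\<close>; S(0) comes first counterclockwise, so it is the last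
  child of the new right tree.\<close>

definition merge_grafts :: "int \<times> ltree \<times> ltree \<Rightarrow> int \<times> ltree \<times> ltree \<Rightarrow> int \<times> ltree \<times> ltree" where
  "merge_grafts a b = (fst b, fst (snd b), Node 0 (children (snd (snd b)) @ [shift_tree (- fst a) (snd (snd a))]))"

text \<open>The first component describes the first child as the new S(0): its step leads back to
  its parent and there is nothing to its right. The second is the old S(0) with its remaining
  children.\<close>

definition split_grafts :: "int \<times> ltree \<times> ltree \<Rightarrow> (int \<times> ltree \<times> ltree) \<times> (int \<times> ltree \<times> ltree)" where
  "split_grafts a = (let c = hd (children (fst (snd a))) in
     ((- root_label c, shift_tree (- root_label c) c, Node 0 []),
      (fst a, Node 0 (tl (children (fst (snd a)))), snd (snd a))))"

text \<open>Moves the root corner from \<open>c_0\<close> to \<open>c_1\<close>. If the left tree at \<open>S(0)\<close> is a single vertex then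
  \<open>c_1\<close> is a corner of \<open>S(1)\<close>, and the old \<open>S(0)\<close> with its right tree becomes the last child of the new
  right tree; otherwise the first child of \<open>S(0)\<close> is put in front of the spine.\<close>
definition reroot :: "environment \<Rightarrow> environment" where
  "reroot e = (if children (fst (snd (e 0))) = []
     then case_nat (merge_grafts (e 0) (e 1)) (\<lambda>n. e (Suc (Suc n)))
     else case_nat (fst (split_grafts (e 0))) (case_nat (snd (split_grafts (e 0))) (\<lambda>n. e (Suc n))))"

definition valid_env :: "environment \<Rightarrow> bool" where
  "valid_env e \<longleftrightarrow> (\<forall>n. root_label (fst (snd (e n))) = 0 \<and> root_label (snd (snd (e n))) = 0)"

lemma env_spine_case_nat:
  "env_spine (case_nat a e) 0 = 0" "env_spine (case_nat a e) (Suc n) = fst a + env_spine e n"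
  by (simp_all add: env_spine_def sum.lessThan_Suc_shift del: sum.lessThan_Suc)

lemma env_spine_Suc: "env_spine (\<lambda>n. e (Suc n)) n = env_spine e (Suc n) - fst (e 0)"
  by (simp add: env_spine_def sum.lessThan_Suc_shift del: sum.lessThan_Suc)

lemma env_spine_0 [simp]: "env_spine e 0 = 0"
  by (simp add: env_spine_def)

lemma env_corner_0:
  assumes "valid_env e"
  shows "env_corner e 0 = (vtx 0 False [], 0)" "pick (env_right e) 0 0 = (vtx 0 False [], 0)"
  using assms by (simp_all add: env_corner_eq pick_0 env_left_def env_right_def contour_hd rcontour_hd valid_env_def vtx_def)

lemma env_corner_vertex:
  "(\<exists>n p x. env_corner e i = (vtx n False p, x) \<and> (p, x - env_spine e n) \<in> set (contour (fst (snd (e n))))) \<or>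
   (\<exists>n p x. env_corner e i = (vtx n True p, x) \<and> (p, x - env_spine e n) \<in> set (rcontour (snd (snd (e n)))))"
proof (cases "0 \<le> i")
  case True
  then obtain n where "env_corner e i \<in> set (env_left e n)"
    using pick_in_set[of "env_left e" 0 "nat i"] by (auto simp: env_corner_eq)
  then obtain p x where "env_corner e i = (vtx n False p, env_spine e n + x)" "(p, x) \<in> set (contour (fst (snd (e n))))"
    by (auto simp: env_left_def)
  then show ?thesis by (intro disjI1 exI[of _ n] exI[of _ p] exI[of _ "env_spine e n + x"]) auto
next
  case False
  then obtain n where "env_corner e i \<in> set (env_right e n)"
    using pick_in_set[of "env_right e" 0 "nat (-i)"] by (auto simp: env_corner_eq)
  then obtain p x where "env_corner e i = (vtx n True p, env_spine e n + x)" "(p, x) \<in> set (rcontour (snd (snd (e n))))"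
    by (auto simp: env_right_def)
  then show ?thesis by (intro disjI2 exI[of _ n] exI[of _ p] exI[of _ "env_spine e n + x"]) auto
qed

lemma shiftedI:
  assumes "\<And>i. c' i = (\<phi> (fst (c (i + 1))), snd (c (i + 1)) - d)" "inj_on \<phi> (range (\<lambda>i. fst (c i)))"
  shows "shifted 1 c' c"
  using assms by (auto simp: shifted_def inj_on_eq_iff[OF assms(2)])

lemma pick_relabel:
  assumes "\<And>n. g n = map h (f n)" "\<And>n. f n \<noteq> []"
  shows "pick g n k = h (pick f n k)"
proof -
  have "g = (\<lambda>n. map h (f n))" using assms(1) by auto
  then show ?thesis using pick_map[of f] assms(2) by simp
qed

text \<open>The left blocks from S(1) on are kept, and the right blocks at S(0) and S(1) merge into
  one. \<open>\<phi>\<close> renames accordingly: the old S(0) and its right tree become the subtree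
  at child \<open>K\<close> of the new root.\<close>

lemma shifted_reroot_leaf:
  assumes v: "valid_env e" and leaf: "children (fst (snd (e 0))) = []"
  shows "shifted 1 (env_corner (reroot e)) (env_corner e)"
proof -
  let ?e = "reroot e"
  define s where "s = fst (e 0)"
  define K where "K = length (children (snd (snd (e 1))))"
  define \<phi> :: "vertex \<Rightarrow> vertex" where
    "\<phi> v = (case v of (n, b, p) \<Rightarrow> if n = 0 then (0, True, K # p) else (n - 1, b, p))" for v
  define h where "h a = (\<phi> (fst a), snd a - s)" for a :: "vertex \<times> int"
  have r: "root_label (fst (snd (e 0))) = 0" "root_label (snd (snd (e 1))) = 0"
    using v by (simp_all add: valid_env_def)
  have L0: "fst (snd (e 0)) = Node 0 []"
    using r(1) leaf by (cases "fst (snd (e 0))") simp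
  obtain cs where R1: "snd (snd (e 1)) = Node 0 cs"
    using r(2) by (cases "snd (snd (e 1))") simp
  have e: "?e = case_nat (fst (e 1), fst (snd (e 1)), Node 0 (cs @ [shift_tree (- s) (snd (snd (e 0)))])) (\<lambda>n. e (Suc (Suc n)))"
    by (simp add: reroot_def leaf merge_grafts_def R1[simplified] s_def)
  have spine: "env_spine ?e n = env_spine e (Suc n) - s" for n
  proof (cases n)
    case 0
    then show ?thesis by (simp add: env_spine_def s_def)
  next
    case (Suc m)
    then show ?thesis
      using env_spine_Suc[of "\<lambda>n. e (Suc n)" m] env_spine_Suc[of e "Suc m"] by (simp add: e env_spine_case_nat s_def)
  qed
  have left: "env_left ?e n = map h (env_left e (Suc n))" for n
    by (cases n) (auto simp: env_left_def spine h_def \<phi>_def vtx_def, auto simp: e h_def \<phi>_def s_def env_spine_def)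
  have "env_corner ?e i = h (env_corner e (i + 1))" if "0 \<le> i" for i
  proof -
    have "env_corner ?e i = h (pick (\<lambda>n. env_left e (Suc n)) 0 (nat i))"
      using that by (simp add: env_corner_eq pick_relabel[OF left])
    also have "pick (\<lambda>n. env_left e (Suc n)) 0 (nat i) = pick (env_left e) 0 (Suc (nat i))"
      by (subst (2) pick_0) (auto simp: env_left_def L0)
    also have "\<dots> = env_corner e (i + 1)"
      using that by (simp add: env_corner_eq Suc_nat_eq_nat_zadd1 add.commute)
    finally show ?thesis .
  qed
  moreover have "env_corner ?e i = h (env_corner e (i + 1))" if "i < 0" for i
  proof -
    \<comment> \<open>The right block at the root starts with a copy of the root corner: for
      negative \<open>i\<close>, reading begins at index 1. The merged block needs such a copy for
      the new root.\<close>
    let ?root = "(vtx 1 False [], s)"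
    define F where "F = case_nat (?root # env_right e 0 @ env_right e 1) (\<lambda>n. env_right e (Suc (Suc n)))"
    have right: "env_right ?e n = map h (F n)" for n
    proof (cases n)
      case 0
      then show ?thesis
        by (auto simp: env_right_def F_def spine h_def)
          (auto simp: e rcontours_append rcontour_shift_tree R1[simplified] h_def K_def \<phi>_def vtx_def env_spine_def s_def)
    next
      case (Suc m)
      then show ?thesis
        by (auto simp: env_right_def F_def spine h_def \<phi>_def vtx_def, auto simp: e h_def \<phi>_def)
    qed
    have F: "F n \<noteq> []" for n by (cases n) (auto simp: F_def)
    define j where "j = nat (- i - 1)"
    have j: "nat (- i) = Suc j" using that by (simp add: j_def)
    have "env_corner ?e i = h (pick F 0 (Suc j))"
      using that by (simp add: env_corner_eq pick_relabel[OF right F] j)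
    also have "pick F 0 (Suc j) = pick (env_right e) 0 j"
      by (subst pick_0[OF F], subst pick_0, simp, subst pick_0, simp) (auto simp: F_def nth_append)
    \<comment> \<open>For i = -1 the index is 0, which holds the copy of c_0 on the right side and
      so agrees with \<open>env_corner e 0\<close>.\<close>
    also have "\<dots> = env_corner e (i + 1)"
    proof (cases "i = -1")
      case True
      then show ?thesis using env_corner_0[OF v] by (simp add: j_def)
    next
      case False
      then have "nat (- (i + 1)) = j" using that by (simp add: j_def)
      then show ?thesis using that False by (simp add: env_corner_eq)
    qed
    finally show ?thesis .
  qed
  ultimately have main: "env_corner ?e i = h (env_corner e (i + 1))" for i by (cases "0 \<le> i") auto
  \<comment> \<open>\<open>\<phi>\<close> is injective only on vertices that can occur: the left
    tree at S(0) is a single vertex, and the children in the right tree at S(1) have indices below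
    \<open>K\<close>, so that \<open>K # p\<close> is new.\<close>
  define V :: "vertex set" where "V = {(0, False, [])} \<union> {(0, True, p) |p. p \<noteq> []} \<union> {(1, False, p) |p. True}
     \<union> {(1, True, j # p) |j p. j < K} \<union> {(n, b, p) |n b p. 1 < n}"
  have "vtx n True p \<in> V" if "(p, x) \<in> set (rcontour (snd (snd (e n))))" for n p x
  proof (cases n)
    case 0
    then show ?thesis by (auto simp: V_def vtx_def)
  next
    case (Suc m)
    then show ?thesis using that rcontour_hd_less[of "hd p" "tl p" x "snd (snd (e 1))"]
      by (cases m; cases p) (auto simp: V_def vtx_def K_def)
  qed
  moreover have "vtx n False p \<in> V" if "(p, x) \<in> set (contour (fst (snd (e n))))" for n p x
    using that by (cases n; cases "n = 1") (auto simp: V_def vtx_def L0)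
  ultimately have "range (\<lambda>i. fst (env_corner e i)) \<subseteq> V"
    using env_corner_vertex[of e] by (metis (no_types, lifting) fst_conv image_subsetI)
  moreover have "inj_on \<phi> V"
    by (auto simp: inj_on_def V_def \<phi>_def split: if_splits)
  ultimately show ?thesis
    using main by (intro shiftedI[of _ \<phi> _ s]) (auto simp: h_def intro: inj_on_subset)
qed

text \<open>Without its first corner, the left block at S(0) splits into the contour of the first
  child and the block of S(0) with the remaining children, whose indices drop by one. The right
  blocks move one place along the spine.\<close>

lemma shifted_reroot_node:
  assumes v: "valid_env e" and node: "children (fst (snd (e 0))) \<noteq> []"
  shows "shifted 1 (env_corner (reroot e)) (env_corner e)"
proof -
  let ?e = "reroot e"
  obtain c cs where L0: "fst (snd (e 0)) = Node 0 (c # cs)"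
  proof -
    have "root_label (fst (snd (e 0))) = 0" using v by (simp add: valid_env_def)
    then show ?thesis
      using node that by (cases "fst (snd (e 0))"; cases "children (fst (snd (e 0)))") auto
  qed
  define s where "s = root_label c"
  define \<phi> :: "vertex \<Rightarrow> vertex" where
    "\<phi> v = (case v of (n, b, p) \<Rightarrow> if n = 0 \<and> \<not> b then 
       (case p of [] \<Rightarrow> (1, False, []) | j # q \<Rightarrow> (case j of 0 \<Rightarrow> (0, False, q) | Suc j \<Rightarrow> (1, False, j # q)))
      else (Suc n, b, p))" for v
  define h where "h a = (\<phi> (fst a), snd a - s)" for a :: "vertex \<times> int"
  have e: "?e = case_nat (- s, shift_tree (- s) c, Node 0 [])
     (case_nat (fst (e 0), Node 0 cs, snd (snd (e 0))) (\<lambda>n. e (Suc n)))"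
    by (simp add: reroot_def split_grafts_def L0 s_def)
  have spine: "env_spine ?e (Suc n) = env_spine e n - s" for n
    using env_spine_Suc[of e] by (cases n) (simp_all add: e env_spine_case_nat)
  have "env_corner ?e i = h (env_corner e (i + 1))" if "0 \<le> i" for i
  proof -
    let ?l = "map (\<lambda>(p, x). (vtx 0 False p, x)) :: (nat list \<times> int) list \<Rightarrow> (vertex \<times> int) list"
    let ?A = "?l (map (\<lambda>(p, x). (0 # p, x)) (contour c))"
    let ?B = "?l (([], 0) # contours 0 (Suc 0) cs)"
    define F where "F = case_nat ?A (case_nat ?B (\<lambda>n. env_left e (Suc n)))"
    have left: "env_left ?e n = map h (F n)" for n
    proof (cases n)
      case 0
      then show ?thesis
        by (auto simp: env_left_def F_def h_def e contour_shift_tree \<phi>_def vtx_def)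
    next
      case (Suc m)
      show ?thesis
      proof (cases m)
        case 0
        have "h (vtx 0 False (incr_hd p), x) = (vtx (Suc 0) False p, x - s)" for p x
          by (cases p) (auto simp: h_def \<phi>_def vtx_def)
        moreover have "h (vtx 0 False [], 0) = (vtx (Suc 0) False [], - s)"
          by (auto simp: h_def \<phi>_def vtx_def)
        ultimately show ?thesis using Suc 0
          by (simp add: env_left_def F_def spine contours_Suc split_beta comp_def) (simp add: e split_beta comp_def)
      next
        case (Suc l)
        then show ?thesis using \<open>n = Suc m\<close>
          by (auto simp: env_left_def F_def spine h_def \<phi>_def vtx_def, auto simp: e h_def \<phi>_def)
      qed
    qed
    have F: "F n \<noteq> []" for n by (cases n; cases "n - 1") (auto simp: F_def)
    have f0: "env_left e 0 = (vtx 0 False [], 0) # ?A @ ?B"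
      by (simp add: env_left_def L0)
    have "env_corner ?e i = h (pick F 0 (nat i))"
      using that by (simp add: env_corner_eq pick_relabel[OF left F])
    also have "pick F 0 (nat i) = pick (env_left e) 0 (Suc (nat i))"
      by (subst pick_0[OF F], subst pick_0, simp add: F, subst (2) pick_0, simp, simp only: f0)
        (auto simp: F_def nth_append nth_Cons')
    also have "\<dots> = env_corner e (i + 1)"
      using that by (simp add: env_corner_eq Suc_nat_eq_nat_zadd1 add.commute)
    finally show ?thesis .
  qed
  moreover have "env_corner ?e i = h (env_corner e (i + 1))" if "i < 0" for i
  proof -
    have right: "env_right ?e (Suc n) = map h (env_right e n)" for n
      by (cases n) (auto simp: env_right_def spine h_def \<phi>_def vtx_def, auto simp: e h_def \<phi>_def)
    define j where "j = nat (- i - 1)"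
    have j: "nat (- i) = Suc j" using that by (simp add: j_def)
    \<comment> \<open>The new S(0) has no subtrees on the right, so its right block is the single
      copy of the root corner at index 0.\<close>
    have "env_corner ?e i = pick (\<lambda>n. env_right ?e (Suc n)) 0 j"
      using that by (simp add: env_corner_eq j, subst pick_0) (auto simp: env_right_def e)
    also have "\<dots> = h (pick (env_right e) 0 j)"
      by (rule pick_relabel[OF right]) simp
    also have "pick (env_right e) 0 j = env_corner e (i + 1)"
    proof (cases "i = -1")
      case True
      then show ?thesis using env_corner_0[OF v] by (simp add: j_def)
    next
      case False
      then have "nat (- (i + 1)) = j" using that by (simp add: j_def)
      then show ?thesis using that False by (simp add: env_corner_eq)
    qed
    finally show ?thesis .
  qed
  ultimately have main: "env_corner ?e i = h (env_corner e (i + 1))" for i by (cases "0 \<le> i") auto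
  have "inj \<phi>"
    by (auto simp: inj_on_def \<phi>_def split: if_splits list.splits nat.splits)
  then show ?thesis
    using main by (intro shiftedI[of _ \<phi> _ s]) (auto simp: h_def intro: inj_on_subset)
qed

lemma shifted_reroot: "valid_env e \<Longrightarrow> shifted 1 (env_corner (reroot e)) (env_corner e)"
  using shifted_reroot_leaf shifted_reroot_node by blast

section \<open>Invariance of the environment law\<close>

definition graft_measure :: "(int \<times> ltree \<times> ltree) measure" where
  "graft_measure = measure_pmf (pmf_of_set {-1, 0, 1 :: int}) \<Otimes>\<^sub>M (rho 0 \<Otimes>\<^sub>M rho 0)"

definition env_space :: "environment measure" where
  "env_space = (\<Pi>\<^sub>M n\<in>UNIV. graft_measure)"

lemma prob_space_graft_measure: "prob_space graft_measure"
proof -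
  interpret r: prob_space "rho 0" by (rule prob_space_rho)
  interpret p: prob_space "measure_pmf (pmf_of_set {-1, 0, 1 :: int})" by (rule measure_pmf.prob_space_axioms)
  interpret rr: pair_prob_space "rho 0" "rho 0" ..
  interpret prr: pair_prob_space "measure_pmf (pmf_of_set {-1, 0, 1 :: int})" "rho 0 \<Otimes>\<^sub>M rho 0" ..
  show ?thesis unfolding graft_measure_def by (rule prr.prob_space_axioms)
qed

interpretation graft: prob_space graft_measure
  by (rule prob_space_graft_measure)

interpretation env: sequence_space graft_measure
  rewrites "env.S = env_space"
  by (simp_all add: sequence_space_def product_prob_space_def product_prob_space_axioms_def
     product_sigma_finite_def prob_space_graft_measure graft.sigma_finite_measure_axioms env_space_def)

lemma sets_pair_discrete:
  assumes "sets M = UNIV" "sets N = UNIV" "space M = UNIV" "space N = UNIV"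
  shows "sets ((M :: 'a :: countable measure) \<Otimes>\<^sub>M (N :: 'b :: countable measure)) = UNIV"
proof -
  have "sets (M \<Otimes>\<^sub>M N) = sets (count_space (UNIV :: 'a set) \<Otimes>\<^sub>M count_space (UNIV :: 'b set))"
    using assms by (intro sets_pair_measure_cong) auto
  also have "\<dots> = UNIV" by (subst pair_measure_countable) auto
  finally show ?thesis .
qed

lemma sets_graft_measure [simp]: "sets graft_measure = UNIV"
  unfolding graft_measure_def
  by (intro sets_pair_discrete) (simp_all add: space_pair_measure)

lemma sets_graft_measure_count [measurable_cong]: "sets graft_measure = sets (count_space UNIV)"
  by simp

lemma space_graft_measure [simp]: "space graft_measure = UNIV"
  by (simp add: graft_measure_def space_pair_measure)

lemma space_env_space [simp]: "space env_space = UNIV"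
  by (simp add: env_space_def space_PiM)

text \<open>Point masses of \<open>graft_measure\<close>. There are countably many triples, so
  invariance reduces to weight-preserving bijections.\<close>

definition graft_weight :: "int \<times> ltree \<times> ltree \<Rightarrow> ennreal" where
  "graft_weight a = ennreal ((if fst a \<in> {-1, 0, 1} then 1/3 else 0) * rho_w 0 (fst (snd a)) * rho_w 0 (snd (snd a)))"

lemma rho_w_nonneg [simp]: "0 \<le> rho_w l t"
  by (simp add: rho_w_def gw_weight_nonneg)

lemma graft_measure_eq_density: "graft_measure = density (count_space UNIV) graft_weight"
proof (rule measure_eqI_countable[of _ UNIV])
  interpret r: prob_space "rho 0" by (rule prob_space_rho)
  interpret rr: pair_prob_space "rho 0" "rho 0" ..
  fix a :: "int \<times> ltree \<times> ltree"
  obtain s L R where a: "a = (s, L, R)" by (cases a)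
  have rho: "emeasure (rho 0) {t} = ennreal (rho_w 0 t)" for t
    by (simp add: rho_def emeasure_density nn_integral_indicator_singleton)
  have *: "{a} = {s} \<times> ({L} \<times> {R})" by (auto simp: a)
  have sets: "{s} \<in> sets (measure_pmf (pmf_of_set {-1, 0, 1 :: int}))" "{L} \<in> sets (rho 0)" "{R} \<in> sets (rho 0)"
    by auto
  have "emeasure graft_measure {a} = emeasure (measure_pmf (pmf_of_set {-1, 0, 1 :: int})) {s} * emeasure (rho 0 \<Otimes>\<^sub>M rho 0) ({L} \<times> {R})"
    unfolding graft_measure_def *
    by (rule sigma_finite_measure.emeasure_pair_measure_Times)
      (intro sets pair_measureI prob_space_imp_sigma_finite rr.prob_space_axioms)+
  also have "emeasure (rho 0 \<Otimes>\<^sub>M rho 0) ({L} \<times> {R}) = emeasure (rho 0) {L} * emeasure (rho 0) {R}"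
    by (rule sigma_finite_measure.emeasure_pair_measure_Times)
      (intro sets prob_space_imp_sigma_finite prob_space_rho)+
  also have "emeasure (measure_pmf (pmf_of_set {-1, 0, 1 :: int})) {s} * (emeasure (rho 0) {L} * emeasure (rho 0) {R}) = graft_weight a"
    by (simp add: rho a graft_weight_def emeasure_pmf_single pmf_of_set ennreal_mult mult.assoc indicator_def)
  also have "\<dots> = emeasure (density (count_space UNIV) graft_weight) {a}"
    by (simp add: emeasure_density nn_integral_indicator_singleton)
  finally show "emeasure graft_measure {a} = emeasure (density (count_space UNIV) graft_weight) {a}" .
qed auto

lemma nn_integral_graft: "(\<integral>\<^sup>+ a. f a \<partial>graft_measure) = (\<integral>\<^sup>+ a. graft_weight a * f a \<partial>count_space UNIV)"
  unfolding graft_measure_eq_density by (subst nn_integral_density) auto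

lemma nn_integral_graft2: "(\<integral>\<^sup>+ a. \<integral>\<^sup>+ b. f a b \<partial>graft_measure \<partial>graft_measure)
    = (\<integral>\<^sup>+ p. graft_weight (fst p) * graft_weight (snd p) * f (fst p) (snd p) \<partial>count_space UNIV)"
proof -
  have "(\<integral>\<^sup>+ a. \<integral>\<^sup>+ b. f a b \<partial>graft_measure \<partial>graft_measure)
     = (\<integral>\<^sup>+ a. \<integral>\<^sup>+ b. graft_weight a * graft_weight b * f a b \<partial>count_space UNIV \<partial>count_space UNIV)"
    by (simp add: nn_integral_graft nn_integral_cmult[symmetric] mult.assoc)
  also have "\<dots> = (\<integral>\<^sup>+ p. graft_weight (fst p) * graft_weight (snd p) * f (fst p) (snd p) \<partial>count_space UNIV)"
    by (subst nn_integral_fst_count_space[symmetric]) simp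
  finally show ?thesis .
qed

lemma nn_integral_count_space_bij_support:
  assumes "bij_betw g A B" "\<And>x. x \<notin> A \<Longrightarrow> f x = 0" "\<And>y. y \<notin> B \<Longrightarrow> h y = 0" "\<And>x. x \<in> A \<Longrightarrow> f x = h (g x)"
  shows "(\<integral>\<^sup>+ x. f x \<partial>count_space UNIV) = (\<integral>\<^sup>+ y. h y \<partial>count_space UNIV)"
proof -
  have "(\<integral>\<^sup>+ x. f x \<partial>count_space UNIV) = (\<integral>\<^sup>+ x. f x \<partial>count_space A)"
    by (rule nn_integral_count_space_eq) (use assms in auto)
  also have "\<dots> = (\<integral>\<^sup>+ x. h (g x) \<partial>count_space A)"
    by (rule nn_integral_cong) (use assms in auto)
  also have "\<dots> = (\<integral>\<^sup>+ y. h y \<partial>count_space B)"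
    by (rule nn_integral_bij_count_space) fact
  also have "\<dots> = (\<integral>\<^sup>+ y. h y \<partial>count_space UNIV)"
    by (rule nn_integral_count_space_eq) (use assms in auto)
  finally show ?thesis .
qed

lemma gw_weight_append:
  "gw_weight (Node 0 (cs @ [d])) = 1/2 * gw_weight (Node 0 cs) * ((if root_label d \<in> {-1,0,1} then 1/3 else 0) * gw_weight d)"
  by simp

text \<open>\<open>merge_grafts\<close> is a bijection onto the triples whose right tree has a
  child, and the weights agree: the factor 1/2 of the trivial left tree pays for the additional
  child, and the step probability 1/3 pays for the label difference of that child, by symmetry of
  the step law.\<close>

lemma nn_integral_merge_grafts:
  "(\<integral>\<^sup>+ a. \<integral>\<^sup>+ b. of_bool (children (fst (snd a)) = []) * G (merge_grafts a b) \<partial>graft_measure \<partial>graft_measure)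
   = (\<integral>\<^sup>+ x. of_bool (children (snd (snd x)) \<noteq> []) * G x \<partial>graft_measure)"
  unfolding nn_integral_graft2 unfolding nn_integral_graft
proof (rule nn_integral_count_space_bij_support)
  let ?A = "{(a, b). fst (snd a) = Node 0 [] \<and> root_label (snd (snd a)) = 0 \<and> root_label (snd (snd b)) = 0}
     :: ((int \<times> ltree \<times> ltree) \<times> (int \<times> ltree \<times> ltree)) set"
  let ?B = "{x. root_label (snd (snd x)) = 0 \<and> children (snd (snd x)) \<noteq> []} :: (int \<times> ltree \<times> ltree) set"
  let ?g = "\<lambda>p. merge_grafts (fst p) (snd p)"
  let ?h = "\<lambda>(s, L, R). ((- root_label (last (children R)), Node 0 [], shift_tree (- root_label (last (children R))) (last (children R))),
     (s, L, Node 0 (butlast (children R))))"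
  show "bij_betw ?g ?A ?B"
  proof (rule bij_betw_byWitness[where f' = ?h])
    show "\<forall>a\<in>?A. ?h (?g a) = a"
    proof
      fix p assume "p \<in> ?A"
      moreover obtain s L R s' L' R' where p: "p = ((s, L, R), (s', L', R'))" by (metis prod.collapse)
      ultimately show "?h (?g p) = p" by (cases R') (auto simp: merge_grafts_def)
    qed
    show "\<forall>x\<in>?B. ?g (?h x) = x"
    proof
      fix x assume "x \<in> ?B"
      moreover obtain s L R where x: "x = (s, L, R)" by (cases x)
      ultimately show "?g (?h x) = x" by (cases R) (auto simp: merge_grafts_def)
    qed
  qed (auto simp: merge_grafts_def)
next
  fix p :: "(int \<times> ltree \<times> ltree) \<times> (int \<times> ltree \<times> ltree)"
  assume "p \<notin> {(a, b). fst (snd a) = Node 0 [] \<and> root_label (snd (snd a)) = 0 \<and> root_label (snd (snd b)) = 0}"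
  then show "graft_weight (fst p) * graft_weight (snd p) *
      (of_bool (children (fst (snd (fst p))) = []) * G (merge_grafts (fst p) (snd p))) = 0"
    by (cases "fst (snd (fst p))") (auto simp: graft_weight_def rho_w_def split_beta)
next
  fix p :: "(int \<times> ltree \<times> ltree) \<times> (int \<times> ltree \<times> ltree)"
  assume *: "p \<in> {(a, b). fst (snd a) = Node 0 [] \<and> root_label (snd (snd a)) = 0 \<and> root_label (snd (snd b)) = 0}"
  obtain s R s' L' R' where p: "p = ((s, Node 0 [], R), (s', L', R'))" "root_label R = 0" "root_label R' = 0"
    using * by (auto simp: split_beta) (metis prod.collapse)
  obtain cs where R': "R' = Node 0 cs" using p(3) by (cases R') auto
  have "graft_weight (fst p) * graft_weight (snd p) = graft_weight (merge_grafts (fst p) (snd p))"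
    unfolding graft_weight_def by (subst ennreal_mult[symmetric])
      (auto simp: p R' merge_grafts_def rho_w_def gw_weight_append simp del: gw_weight.simps simp: gw_weight_nonneg, simp_all)
  then show "graft_weight (fst p) * graft_weight (snd p) *
      (of_bool (children (fst (snd (fst p))) = []) * G (merge_grafts (fst p) (snd p)))
     = graft_weight (merge_grafts (fst p) (snd p)) *
      (of_bool (children (snd (snd (merge_grafts (fst p) (snd p)))) \<noteq> []) * G (merge_grafts (fst p) (snd p)))"
    by (simp add: p merge_grafts_def)
qed (auto simp: graft_weight_def rho_w_def)

text \<open>The same exchange backwards: detaching the first child frees a factor 1/2 and a factor
  1/3, which become the weight of the trivial right tree and the probability of the new spine
  step.\<close>

lemma nn_integral_split_grafts:
  "(\<integral>\<^sup>+ a. of_bool (children (fst (snd a)) \<noteq> []) * G (split_grafts a) \<partial>graft_measure)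
   = (\<integral>\<^sup>+ x. \<integral>\<^sup>+ y. of_bool (children (snd (snd x)) = []) * G (x, y) \<partial>graft_measure \<partial>graft_measure)"
  unfolding nn_integral_graft2 unfolding nn_integral_graft
proof (rule nn_integral_count_space_bij_support)
  let ?A = "{a. root_label (fst (snd a)) = 0 \<and> children (fst (snd a)) \<noteq> []} :: (int \<times> ltree \<times> ltree) set"
  let ?B = "{(x, y). snd (snd x) = Node 0 [] \<and> root_label (fst (snd x)) = 0 \<and> root_label (fst (snd y)) = 0}
     :: ((int \<times> ltree \<times> ltree) \<times> (int \<times> ltree \<times> ltree)) set"
  let ?h = "\<lambda>((s, L, R), (s', L', R')). (s', Node 0 (shift_tree (- s) L # children L'), R')"
  show "bij_betw split_grafts ?A ?B"
  proof (rule bij_betw_byWitness[where f' = ?h])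
    show "\<forall>a\<in>?A. ?h (split_grafts a) = a"
    proof
      fix a assume "a \<in> ?A"
      moreover obtain s L R where a: "a = (s, L, R)" by (cases a)
      ultimately show "?h (split_grafts a) = a" by (cases L) (auto simp: split_grafts_def Let_def)
    qed
    show "\<forall>p\<in>?B. split_grafts (?h p) = p"
    proof
      fix p assume "p \<in> ?B"
      moreover obtain s L R s' L' R' where p: "p = ((s, L, R), (s', L', R'))" by (metis prod.collapse)
      ultimately show "split_grafts (?h p) = p" by (cases L') (auto simp: split_grafts_def Let_def)
    qed
  qed (auto simp: split_grafts_def Let_def)
next
  fix a :: "int \<times> ltree \<times> ltree"
  assume *: "a \<in> {a. root_label (fst (snd a)) = 0 \<and> children (fst (snd a)) \<noteq> []}"
  obtain s c cs R where a: "a = (s, Node 0 (c # cs), R)"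
    using * by (cases a; cases "fst (snd a)"; cases "children (fst (snd a))") auto
  have "graft_weight a = graft_weight (fst (split_grafts a)) * graft_weight (snd (split_grafts a))"
    unfolding graft_weight_def by (subst ennreal_mult[symmetric])
      (auto simp: a split_grafts_def rho_w_def gw_weight_nonneg simp del: gw_weight.simps, simp_all)
  moreover have "(children (fst (snd a)) \<noteq> []) = True" "(children (snd (snd (fst (split_grafts a)))) = []) = True"
    by (simp_all add: a split_grafts_def)
  ultimately show "graft_weight a * (of_bool (children (fst (snd a)) \<noteq> []) * G (split_grafts a))
    = graft_weight (fst (split_grafts a)) * graft_weight (snd (split_grafts a)) *
      (of_bool (children (snd (snd (fst (split_grafts a)))) = []) * G (fst (split_grafts a), snd (split_grafts a)))"
    by (simp only: prod.collapse)
next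
  fix p :: "(int \<times> ltree \<times> ltree) \<times> (int \<times> ltree \<times> ltree)"
  assume *: "p \<notin> {(x, y). snd (snd x) = Node 0 [] \<and> root_label (fst (snd x)) = 0 \<and> root_label (fst (snd y)) = 0}"
  obtain s L R s' L' R' where p: "p = ((s, L, R), (s', L', R'))" by (metis prod.collapse)
  have "R = Node 0 []" if "children R = []" "root_label R = 0" using that by (cases R) auto
  then have "children R \<noteq> [] \<or> root_label R \<noteq> 0 \<or> root_label L \<noteq> 0 \<or> root_label L' \<noteq> 0"
    using * by (auto simp: p)
  then show "graft_weight (fst p) * graft_weight (snd p) *
      (of_bool (children (snd (snd (fst p))) = []) * G (fst p, snd p)) = 0"
    by (elim disjE) (simp_all add: p graft_weight_def rho_w_def)
qed (auto simp: graft_weight_def rho_w_def)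

lemma measurable_component_count [measurable]: "(\<lambda>e. e n) \<in> env_space \<rightarrow>\<^sub>M count_space UNIV"
  unfolding env_space_def by measurable

lemma measurable_case_nat_env:
  assumes "f \<in> M \<rightarrow>\<^sub>M graft_measure" "g \<in> M \<rightarrow>\<^sub>M env_space"
  shows "(\<lambda>x. case_nat (f x) (g x)) \<in> M \<rightarrow>\<^sub>M env_space"
  using assms unfolding env_space_def by measurable

lemma nn_integral_env_iter:
  assumes [measurable]: "f \<in> borel_measurable env_space"
  shows "(\<integral>\<^sup>+ e. f e \<partial>env_space) = (\<integral>\<^sup>+ a. \<integral>\<^sup>+ e. f (case_nat a e) \<partial>env_space \<partial>graft_measure)"
proof -
  have cn: "(\<lambda>p. case_nat (fst p) (snd p)) \<in> graft_measure \<Otimes>\<^sub>M env_space \<rightarrow>\<^sub>M env_space"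
    by (intro measurable_case_nat_env measurable_fst measurable_snd)
  have "sigma_finite_measure env_space"
    by (rule prob_space_imp_sigma_finite) (rule env.P.prob_space_axioms)
  note fst = sigma_finite_measure.nn_integral_fst[OF this]
  have "(\<integral>\<^sup>+ e. f e \<partial>env_space) = (\<integral>\<^sup>+ e. f e \<partial>distr (graft_measure \<Otimes>\<^sub>M env_space) env_space (\<lambda>(s, \<omega>). case_nat s \<omega>))"
    by (simp add: env.PiM_iter)
  also have "\<dots> = (\<integral>\<^sup>+ p. f (case_nat (fst p) (snd p)) \<partial>(graft_measure \<Otimes>\<^sub>M env_space))"
    by (subst nn_integral_distr) (use cn in \<open>auto simp: split_beta'\<close>)
  also have "\<dots> = (\<integral>\<^sup>+ a. \<integral>\<^sup>+ e. f (case_nat a e) \<partial>env_space \<partial>graft_measure)"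
    by (subst fst[symmetric]) (use measurable_compose[OF cn assms] in auto)
  finally show ?thesis .
qed

lemma measurable_env_Suc: "(\<lambda>e n. e (Suc n)) \<in> env_space \<rightarrow>\<^sub>M env_space"
  unfolding env_space_def by (rule measurable_PiM_single') (auto simp: space_PiM)

lemma measurable_count_space_fun:
  assumes "f \<in> M \<rightarrow>\<^sub>M count_space UNIV"
  shows "(\<lambda>x. h (f x)) \<in> M \<rightarrow>\<^sub>M count_space UNIV"
  using measurable_compose[OF assms, of h] by simp

lemma measurable_count_space_fun2:
  fixes f :: "'a \<Rightarrow> 'b :: countable"
  assumes "f \<in> M \<rightarrow>\<^sub>M count_space UNIV" "g \<in> M \<rightarrow>\<^sub>M count_space UNIV"
  shows "(\<lambda>x. h (f x) (g x)) \<in> M \<rightarrow>\<^sub>M count_space UNIV"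
  by (rule measurable_compose_countable[OF _ assms(1)])
    (rule measurable_count_space_fun[OF assms(2)])

lemma measurable_graft_iff: "(f \<in> M \<rightarrow>\<^sub>M graft_measure) = (f \<in> M \<rightarrow>\<^sub>M count_space UNIV)"
  by (simp only: measurable_cong_sets[OF refl sets_graft_measure_count])

lemma borel_measurable_graft: "f \<in> graft_measure \<rightarrow>\<^sub>M borel"
  by (simp only: measurable_cong_sets[OF sets_graft_measure_count refl]) simp

lemma measurable_reroot [measurable]: "reroot \<in> env_space \<rightarrow>\<^sub>M env_space"
proof -
  note m = measurable_component_count
  have 1: "(\<lambda>e. merge_grafts (e 0) (e 1)) \<in> env_space \<rightarrow>\<^sub>M graft_measure"
    unfolding measurable_graft_iff by (rule measurable_count_space_fun2) (rule m)+
  have 2: "(\<lambda>e. fst (split_grafts (e 0))) \<in> env_space \<rightarrow>\<^sub>M graft_measure"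
      "(\<lambda>e. snd (split_grafts (e 0))) \<in> env_space \<rightarrow>\<^sub>M graft_measure"
    unfolding measurable_graft_iff
    using measurable_count_space_fun[OF m, of "\<lambda>a. fst (split_grafts a)" 0]
      measurable_count_space_fun[OF m, of "\<lambda>a. snd (split_grafts a)" 0] by auto
  have 3: "Measurable.pred env_space (\<lambda>e. children (fst (snd (e 0))) = [])"
    using measurable_count_space_fun[OF m, of "\<lambda>a. children (fst (snd a)) = []" 0] by simp
  have 4: "(\<lambda>e n. e (Suc (Suc n))) \<in> env_space \<rightarrow>\<^sub>M env_space"
    using measurable_compose[OF measurable_env_Suc measurable_env_Suc] by simp
  show ?thesis unfolding reroot_def
    by (intro measurable_If measurable_case_nat_env 1 2 4 measurable_env_Suc 3[unfolded pred_def])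
qed

text \<open>The two cases of \<open>reroot\<close> land in complementary events: the right tree at
  the new S(0) has a child or it has none. On each of them the first coordinates are exchanged by a
  weight-preserving bijection, and the later ones are only moved.\<close>

lemma distr_reroot: "distr env_space env_space reroot = env_space"
proof (rule measure_eqI)
  fix A assume "A \<in> sets (distr env_space env_space reroot)"
  then have [measurable]: "A \<in> sets env_space" by simp
  let ?I = "indicator A :: environment \<Rightarrow> ennreal"
  let ?leaf = "\<lambda>a::int \<times> ltree \<times> ltree. children (fst (snd a)) = []"
  let ?g = "\<lambda>x. \<integral>\<^sup>+ e. ?I (case_nat x e) \<partial>env_space"
  let ?g2 = "\<lambda>p. \<integral>\<^sup>+ e. ?I (case_nat (fst p) (case_nat (snd p) e)) \<partial>env_space"
  have m[measurable]: "(\<lambda>e. case_nat x e) \<in> env_space \<rightarrow>\<^sub>M env_space" for x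
    by (intro measurable_case_nat_env) simp_all
  have r: "reroot (case_nat a (case_nat b e)) =
     (if ?leaf a then case_nat (merge_grafts a b) e
      else case_nat (fst (split_grafts a)) (case_nat (snd (split_grafts a)) (case_nat b e)))" for a b e
    by (simp add: reroot_def)
  have "(\<integral>\<^sup>+ e. ?I e \<partial>distr env_space env_space reroot) = (\<integral>\<^sup>+ e. ?I (reroot e) \<partial>env_space)"
    by (rule nn_integral_distr) auto
  then have "emeasure (distr env_space env_space reroot) A = (\<integral>\<^sup>+ e. ?I (reroot e) \<partial>env_space)"
    by simp
  also have "\<dots> = (\<integral>\<^sup>+ a. \<integral>\<^sup>+ b. \<integral>\<^sup>+ e. ?I (reroot (case_nat a (case_nat b e))) \<partial>env_space \<partial>graft_measure \<partial>graft_measure)"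
    by (subst nn_integral_env_iter, measurable, subst nn_integral_env_iter, measurable)
  also have "\<dots> = (\<integral>\<^sup>+ a. \<integral>\<^sup>+ b. of_bool (?leaf a) * ?g (merge_grafts a b) +
      of_bool (\<not> ?leaf a) * (\<integral>\<^sup>+ e. ?I (case_nat (fst (split_grafts a)) (case_nat (snd (split_grafts a)) (case_nat b e))) \<partial>env_space)
      \<partial>graft_measure \<partial>graft_measure)"
    by (intro nn_integral_cong) (auto simp: r)
  also have "\<dots> = (\<integral>\<^sup>+ a. \<integral>\<^sup>+ b. of_bool (?leaf a) * ?g (merge_grafts a b) \<partial>graft_measure \<partial>graft_measure) +
      (\<integral>\<^sup>+ a. of_bool (\<not> ?leaf a) * (\<integral>\<^sup>+ b. \<integral>\<^sup>+ e. ?I (case_nat (fst (split_grafts a)) (case_nat (snd (split_grafts a)) (case_nat b e))) \<partial>env_space \<partial>graft_measure)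
      \<partial>graft_measure)"
    by (simp add: nn_integral_add nn_integral_cmult borel_measurable_graft)
  also have "(\<integral>\<^sup>+ a. \<integral>\<^sup>+ b. of_bool (?leaf a) * ?g (merge_grafts a b) \<partial>graft_measure \<partial>graft_measure)
     = (\<integral>\<^sup>+ x. of_bool (children (snd (snd x)) \<noteq> []) * ?g x \<partial>graft_measure)"
    by (rule nn_integral_merge_grafts)
  \<comment> \<open>In this case the second coordinate is left as it is, so it is absorbed into the
    tail again.\<close>
  also have "(\<integral>\<^sup>+ a. of_bool (\<not> ?leaf a) * (\<integral>\<^sup>+ b. \<integral>\<^sup>+ e. ?I (case_nat (fst (split_grafts a)) (case_nat (snd (split_grafts a)) (case_nat b e))) \<partial>env_space \<partial>graft_measure)
      \<partial>graft_measure) = (\<integral>\<^sup>+ a. of_bool (\<not> ?leaf a) * ?g2 (split_grafts a) \<partial>graft_measure)"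
  proof (intro nn_integral_cong arg_cong2[where f = times] refl)
    fix a
    show "(\<integral>\<^sup>+ b. \<integral>\<^sup>+ e. ?I (case_nat (fst (split_grafts a)) (case_nat (snd (split_grafts a)) (case_nat b e))) \<partial>env_space \<partial>graft_measure)
       = ?g2 (split_grafts a)"
      by (rule nn_integral_env_iter[symmetric]) measurable
  qed
  also have "\<dots> = (\<integral>\<^sup>+ x. \<integral>\<^sup>+ y. of_bool (children (snd (snd x)) = []) * ?g2 (x, y) \<partial>graft_measure \<partial>graft_measure)"
    by (rule nn_integral_split_grafts)
  also have "\<dots> = (\<integral>\<^sup>+ x. of_bool (children (snd (snd x)) = []) * ?g x \<partial>graft_measure)"
  proof (intro nn_integral_cong)
    fix x
    have "?g x = (\<integral>\<^sup>+ y. ?g2 (x, y) \<partial>graft_measure)"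
      by (subst nn_integral_env_iter) (use measurable_compose[OF m] in auto)
    then show "(\<integral>\<^sup>+ y. of_bool (children (snd (snd x)) = []) * ?g2 (x, y) \<partial>graft_measure)
      = of_bool (children (snd (snd x)) = []) * ?g x"
      by (simp add: nn_integral_cmult borel_measurable_graft)
  qed
  also have "(\<integral>\<^sup>+ x. of_bool (children (snd (snd x)) \<noteq> []) * ?g x \<partial>graft_measure) +
     (\<integral>\<^sup>+ x. of_bool (children (snd (snd x)) = []) * ?g x \<partial>graft_measure) = (\<integral>\<^sup>+ x. ?g x \<partial>graft_measure)"
    by (subst nn_integral_add[symmetric]) (auto intro!: nn_integral_cong borel_measurable_graft)
  also have "\<dots> = emeasure env_space A"
    by (subst nn_integral_env_iter[symmetric]) auto
  finally show "emeasure (distr env_space env_space reroot) A = emeasure env_space A" .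
qed simp

lemma AE_env_weight: "AE e in env_space. \<forall>n. graft_weight (e n) \<noteq> 0"
proof -
  have "AE a in graft_measure. graft_weight a \<noteq> 0"
    unfolding graft_measure_eq_density by (subst AE_density) (auto simp: zero_less_iff_neq_zero)
  then have "AE e in env_space. graft_weight (e n) \<noteq> 0" for n
    unfolding env_space_def by (intro AE_PiM_component) (auto intro: prob_space_graft_measure)
  then show ?thesis by (simp add: AE_all_countable)
qed

lemma graft_weight_nonzeroD:
  assumes "graft_weight (s, L, R) \<noteq> 0"
  shows "s \<in> {-1, 0, 1}" "root_label L = 0" "root_label R = 0"
    "c \<in> set (children L) \<Longrightarrow> root_label c \<in> {-1, 0, 1}"
proof -
  have *: "s \<in> {-1, 0, 1}" "root_label L = 0" "root_label R = 0" "gw_weight L \<noteq> 0"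
    using assms by (auto simp: graft_weight_def rho_w_def split: if_splits)
  then show "s \<in> {-1, 0, 1}" "root_label L = 0" "root_label R = 0" by auto
  assume c: "c \<in> set (children L)"
  obtain cs where L: "L = Node 0 cs" using * by (cases L) auto
  let ?f = "\<lambda>c. (if root_label c - 0 \<in> {-1,0,1} then 1/3 else 0) * gw_weight c"
  have "0 \<notin> set (map ?f cs)"
    using *(4) unfolding L gw_weight.simps prod_list_zero_iff[symmetric] by auto
  then have nz: "y \<noteq> 0" if "y \<in> ?f ` set cs" for y using that unfolding set_map by blast
  have "c \<in> set cs" using c unfolding L by simp
  from nz[OF imageI[OF this]] have "?f c \<noteq> 0" .
  then show "root_label c \<in> {-1, 0, 1}" by (auto split: if_splits)
qed

section \<open>The spine walk and measurability of the corner map\<close>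

lemma fst_env_bounds:
  assumes "\<And>n. graft_weight (e n) \<noteq> 0"
  shows "\<bar>fst (e n)\<bar> \<le> 1"
  using graft_weight_nonzeroD(1)[of "fst (e n)" "fst (snd (e n))" "snd (snd (e n))"] assms[of n] by auto

lemma valid_env_of_weight: "(\<And>n. graft_weight (e n) \<noteq> 0) \<Longrightarrow> valid_env e"
  unfolding valid_env_def
  by (metis graft_weight_nonzeroD(2,3) prod.collapse)

lemma abs_env_spine_le:
  assumes "\<And>n. graft_weight (e n) \<noteq> 0"
  shows "\<bar>env_spine e n\<bar> \<le> int n"
proof (induction n)
  case (Suc n)
  then show ?case using fst_env_bounds[of e n, OF assms] by (simp add: env_spine_def)
qed simp

lemma measurable_env_spine [measurable]: "(\<lambda>e. env_spine e n) \<in> env_space \<rightarrow>\<^sub>M count_space UNIV"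
proof (induction n)
  case (Suc n)
  have "(\<lambda>e. env_spine e n + fst (e n)) \<in> env_space \<rightarrow>\<^sub>M count_space UNIV"
    by (rule measurable_count_space_fun2[OF Suc measurable_count_space_fun[OF measurable_component_count]])
  then show ?case by (simp add: env_spine_def)
qed simp

lemma nn_integral_graft_fst:
  "(\<integral>\<^sup>+ a. f (fst a) \<partial>graft_measure) = (f (-1) + f 0 + f 1) / 3"
proof -
  interpret r: prob_space "rho 0" by (rule prob_space_rho)
  interpret rr: pair_prob_space "rho 0" "rho 0" ..
  have "(\<integral>\<^sup>+ a. f (fst a) \<partial>graft_measure) =
     (\<integral>\<^sup>+ s. \<integral>\<^sup>+ p. f s \<partial>(rho 0 \<Otimes>\<^sub>M rho 0) \<partial>measure_pmf (pmf_of_set {-1, 0, 1 :: int}))"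
    unfolding graft_measure_def
    by (subst sigma_finite_measure.nn_integral_fst[OF prob_space_imp_sigma_finite[OF rr.prob_space_axioms], symmetric]) auto
  also have "\<dots> = (\<integral>\<^sup>+ s. f s \<partial>measure_pmf (pmf_of_set {-1, 0, 1 :: int}))"
    using rr.emeasure_space_1 by simp
  also have "\<dots> = (f (-1) + f 0 + f 1) / 3"
    by (subst nn_integral_pmf_of_set) (auto simp: add.assoc)
  finally show ?thesis .
qed

text \<open>First-step analysis: the probability of ever reaching level \<open>a\<close> is an affine function of
  \<open>a \<ge> 0\<close>, and it is bounded, hence constant.\<close>
lemma AE_env_spine_unbounded:
  assumes \<sigma>: "\<sigma> = 1 \<or> \<sigma> = -1"
  shows "AE e in env_space. \<forall>a. \<exists>n. a \<le> \<sigma> * env_spine e n"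
proof -
  let ?R = "\<lambda>a. {e. \<exists>n. a \<le> \<sigma> * env_spine e n}"
  define h where "h a = measure env_space (?R a)" for a
  have R: "?R a \<in> sets env_space" for a
  proof -
    have "(\<lambda>e. a \<le> \<sigma> * env_spine e n) \<in> env_space \<rightarrow>\<^sub>M count_space UNIV" for n
      by (rule measurable_count_space_fun[OF measurable_env_spine])
    then have "{e \<in> space env_space. \<exists>n. a \<le> \<sigma> * env_spine e n} \<in> sets env_space" by measurable
    then show ?thesis by simp
  qed
  have h0: "h 0 = 1"
  proof -
    have "?R 0 = space env_space" by (auto intro: exI[of _ 0])
    then show ?thesis unfolding h_def using env.P.prob_space by simp
  qed
  have rec: "3 * h a = h (a - 1) + h a + h (a + 1)" if a: "0 < a" for a
  proof -
    have "case_nat c e \<in> ?R a \<longleftrightarrow> e \<in> ?R (a - \<sigma> * fst c)" for c e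
    proof -
      \<comment> \<open>Since \<open>a\<close> is positive, the level is not reached at time 0, and
        the event can be read off after the first step.\<close>
      have "(\<exists>n. a \<le> \<sigma> * env_spine (case_nat c e) n) \<longleftrightarrow> (\<exists>n. a \<le> \<sigma> * env_spine (case_nat c e) (Suc n))"
        using a by (metis env_spine_0 mult_zero_right not0_implies_Suc not_le)
      then show ?thesis by (simp add: env_spine_case_nat algebra_simps)
    qed
    then have ind: "indicator (?R a) (case_nat c e) = (indicator (?R (a - \<sigma> * fst c)) e :: ennreal)" for c e
      by (simp add: indicator_def)
    have "emeasure env_space (?R a) = (\<integral>\<^sup>+ c. \<integral>\<^sup>+ e. indicator (?R a) (case_nat c e) \<partial>env_space \<partial>graft_measure)"
      using R[of a] by (simp add: nn_integral_env_iter[symmetric])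
    also have "\<dots> = (\<integral>\<^sup>+ c. emeasure env_space (?R (a - \<sigma> * fst c)) \<partial>graft_measure)"
      unfolding ind using R by (intro nn_integral_cong nn_integral_indicator)
    also have "\<dots> = (emeasure env_space (?R (a + \<sigma>)) + emeasure env_space (?R a) + emeasure env_space (?R (a - \<sigma>))) / 3"
      by (subst nn_integral_graft_fst[where f = "\<lambda>s. emeasure env_space (?R (a - \<sigma> * s))"]) simp
    finally have "ennreal (h a) = (ennreal (h (a + \<sigma>)) + ennreal (h a) + ennreal (h (a - \<sigma>))) / 3"
      by (simp add: env.P.emeasure_eq_measure h_def)
    also have "\<dots> = ennreal ((h (a + \<sigma>) + h a + h (a - \<sigma>)) / 3)"
      by (simp add: h_def divide_ennreal[symmetric] ennreal_plus[symmetric] del: ennreal_plus)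
    finally have "h a = (h (a + \<sigma>) + h a + h (a - \<sigma>)) / 3"
      by (subst (asm) ennreal_inj) (auto simp: h_def)
    then show ?thesis using \<sigma> by auto
  qed
  define d where "d = h 1 - 1"
  have aff: "h (int n) = 1 + real n * d \<and> h (int (Suc n)) = 1 + real (Suc n) * d" for n
  proof (induction n)
    case 0
    then show ?case by (simp add: h0 d_def)
  next
    case (Suc n)
    have "h (int (Suc (Suc n))) = 2 * h (int (Suc n)) - h (int n)"
      using rec[of "int (Suc n)"] by (simp add: algebra_simps)
    then show ?case using Suc by (simp add: algebra_simps)
  qed
  have "d = 0"
  proof (rule ccontr)
    assume "d \<noteq> 0"
    moreover have "d \<le> 0" unfolding d_def h_def by simp
    ultimately have "d < 0" by simp
    then obtain n where "real n * (- d) > 1" using reals_Archimedean3[of "- d"] by (metis neg_0_less_iff_less)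
    then have "h (int n) < 0" using aff[of n] by simp
    then show False unfolding h_def by (simp add: measure_nonneg not_less[symmetric] del: not_less)
  qed
  then have "h (int n) = 1" for n using aff[of n] by simp
  then have "AE e in env_space. e \<in> ?R (int n)" for n
    using R unfolding h_def by (simp add: env.P.prob_eq_1)
  then have "AE e in env_space. \<forall>n. e \<in> ?R (int n)" by (simp add: AE_all_countable)
  then show ?thesis
  proof (rule AE_mp, intro AE_I2 impI allI)
    fix e a assume "\<forall>n. e \<in> ?R (int n)"
    then obtain n where "int (nat a) \<le> \<sigma> * env_spine e n" by blast
    then show "\<exists>n. a \<le> \<sigma> * env_spine e n" by (intro exI[of _ n]) linarith
  qed
qed

section \<open>Measurability of the corner map and of its derived quantities\<close>

lemma measurable_env_left: "(\<lambda>e. env_left e n) \<in> env_space \<rightarrow>\<^sub>M count_space UNIV"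
  unfolding env_left_def
  by (rule measurable_count_space_fun2[OF measurable_env_spine measurable_component_count])

lemma measurable_env_right: "(\<lambda>e. env_right e n) \<in> env_space \<rightarrow>\<^sub>M count_space UNIV"
  unfolding env_right_def
  by (rule measurable_count_space_fun2[OF measurable_env_spine measurable_component_count])

text \<open>A block has countably many possible values, and each nonempty block that is passed
  lowers the index. Strong induction on the index thus deals with one block at a time.\<close>

lemma measurable_pick:
  fixes f :: "'b \<Rightarrow> nat \<Rightarrow> 'a::countable list"
  assumes "\<And>n. (\<lambda>x. f x n) \<in> M \<rightarrow>\<^sub>M count_space UNIV" "\<And>x n. f x n \<noteq> []"
  shows "(\<lambda>x. pick (f x) n k) \<in> M \<rightarrow>\<^sub>M count_space UNIV"
proof (induction k arbitrary: n rule: less_induct)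
  case (less k)
  have "(\<lambda>x. if k < length l \<or> l = [] then l ! k else pick (f x) (Suc n) (k - length l)) \<in> M \<rightarrow>\<^sub>M count_space UNIV" for l
  proof (cases "k < length l \<or> l = []")
    case False
    then have "k - length l < k" by (cases l) auto
    from less[OF this] False show ?thesis by simp
  qed simp
  from measurable_compose_countable[OF this assms(1)[of n]] show ?case
    by (subst pick.simps)
qed

lemma measurable_env_corner: "(\<lambda>e. env_corner e i) \<in> env_space \<rightarrow>\<^sub>M count_space UNIV"
  unfolding env_corner_eq
  by (cases "0 \<le> i") (auto intro!: measurable_pick measurable_env_left measurable_env_right)

lemma measurable_env_label [measurable]: "(\<lambda>e. snd (env_corner e i)) \<in> env_space \<rightarrow>\<^sub>M count_space UNIV"
  by (rule measurable_count_space_fun[OF measurable_env_corner])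

lemma measurable_env_vertex [measurable]: "(\<lambda>e. fst (env_corner e i)) \<in> env_space \<rightarrow>\<^sub>M count_space UNIV"
  by (rule measurable_count_space_fun[OF measurable_env_corner])

lemma pred_same_vertex [measurable]: "Measurable.pred env_space (\<lambda>e. fst (env_corner e i) = fst (env_corner e j))"
  by (rule measurable_count_space_fun2[OF measurable_env_vertex measurable_env_vertex])

lemma measurable_next_corner [measurable]: "(\<lambda>e. next_corner (env_corner e) i) \<in> env_space \<rightarrow>\<^sub>M count_space UNIV"
proof -
  have "Measurable.pred env_space (\<lambda>e. snd (env_corner e (i + 1 + int n)) = snd (env_corner e i) - 1)" for n
    by (rule measurable_count_space_fun2[OF measurable_env_label measurable_env_label])
  then have "(\<lambda>e. LEAST n. snd (env_corner e (i + 1 + int n)) = snd (env_corner e i) - 1) \<in> env_space \<rightarrow>\<^sub>M count_space UNIV"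
    by (rule measurable_Least)
  then show ?thesis unfolding next_corner_def by (rule measurable_count_space_fun)
qed

lemma measurable_env_origin [measurable]: "(\<lambda>e. origin (env_corner e) o') \<in> env_space \<rightarrow>\<^sub>M count_space UNIV"
  unfolding origin_def by (cases "snd o'") simp_all

lemma measurable_env_target [measurable]: "(\<lambda>e. target (env_corner e) o') \<in> env_space \<rightarrow>\<^sub>M count_space UNIV"
  unfolding target_def by (cases "snd o'") simp_all

lemma pred_edges_from [measurable]: "Measurable.pred env_space (\<lambda>e. o' \<in> edges_from (env_corner e) i)"
  unfolding edges_from_def mem_Collect_eq
  by (rule measurable_compose_countable[OF pred_same_vertex measurable_env_origin])

text \<open>Finiteness means that the codes are bounded, a condition with countable quantifiers
  only.\<close>

lemma pred_finite:
  fixes A :: "'a \<Rightarrow> 'b::countable set"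
  assumes [measurable]: "\<And>y. Measurable.pred M (\<lambda>x. y \<in> A x)"
  shows "Measurable.pred M (\<lambda>x. finite (A x))"
proof -
  have "finite (A x) \<longleftrightarrow> (\<exists>N. \<forall>y. y \<in> A x \<longrightarrow> to_nat y \<le> N)" for x
  proof
    assume "finite (A x)"
    then show "\<exists>N. \<forall>y. y \<in> A x \<longrightarrow> to_nat y \<le> N"
      by (intro exI[of _ "Max (to_nat ` A x)"]) auto
  next
    assume "\<exists>N. \<forall>y. y \<in> A x \<longrightarrow> to_nat y \<le> N"
    then obtain N where "to_nat ` A x \<subseteq> {..N}" by auto
    then have "finite (to_nat ` A x)" by (rule finite_subset) simp
    then show "finite (A x)" by (rule finite_imageD) (auto intro: inj_on_subset[OF inj_to_nat])
  qed
  moreover have "Measurable.pred M (\<lambda>x. \<exists>N::nat. \<forall>y. y \<in> A x \<longrightarrow> to_nat y \<le> N)" by measurable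
  ultimately show ?thesis by (simp cong: measurable_cong)
qed

text \<open>An infinite set is sent to the empty set, as \<open>sum\<close> and \<open>card\<close> do, so that there are only countably many values.\<close>
lemma measurable_finite_set:
  fixes A :: "'a \<Rightarrow> 'b::countable set"
  assumes [measurable]: "\<And>y. Measurable.pred M (\<lambda>x. y \<in> A x)"
  shows "(\<lambda>x. if finite (A x) then A x else {}) \<in> M \<rightarrow>\<^sub>M count_space {S. finite S}"
proof (rule measurable_count_space_eq_countable[THEN iffD2, rule_format])
  show "countable {S :: 'b set. finite S}" by (simp add: countable_Collect_finite)
  note [measurable] = pred_finite[OF assms]
  show "(\<lambda>x. if finite (A x) then A x else {}) \<in> space M \<rightarrow> {S. finite S} \<and>
    (\<forall>S\<in>{S. finite S}. (\<lambda>x. if finite (A x) then A x else {}) -` {S} \<inter> space M \<in> sets M)"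
  proof (intro conjI ballI)
    fix S :: "'b set" assume "S \<in> {S. finite S}"
    have "(\<lambda>x. if finite (A x) then A x else {}) -` {S} \<inter> space M =
      {x \<in> space M. (finite (A x) \<and> (\<forall>y. y \<in> A x \<longleftrightarrow> y \<in> S)) \<or> (\<not> finite (A x) \<and> S = {})}"
      by (auto split: if_splits)
    also have "\<dots> \<in> sets M" by measurable
    finally show "(\<lambda>x. if finite (A x) then A x else {}) -` {S} \<inter> space M \<in> sets M" .
  qed auto
qed

lemma measurable_finite_set_compose:
  fixes A :: "'a \<Rightarrow> 'b::countable set"
  assumes A: "\<And>y. Measurable.pred M (\<lambda>x. y \<in> A x)"
    and f: "\<And>S. finite S \<Longrightarrow> (\<lambda>x. f S x) \<in> M \<rightarrow>\<^sub>M N" and inf: "\<And>S x. infinite S \<Longrightarrow> f S x = f {} x"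
  shows "(\<lambda>x. f (A x) x) \<in> M \<rightarrow>\<^sub>M N"
proof -
  have "(\<lambda>x. f (if finite (A x) then A x else {}) x) \<in> M \<rightarrow>\<^sub>M N"
    by (rule measurable_compose_countable'[OF _ measurable_finite_set[OF A]])
      (auto intro: f simp: countable_Collect_finite)
  moreover have "f (if finite (A x) then A x else {}) x = f (A x) x" for x using inf by auto
  ultimately show ?thesis by simp
qed

lemma measurable_env_stay [measurable]: "(\<lambda>e. stay (env_corner e) \<sigma> m n i) \<in> borel_measurable env_space"
proof (induction n arbitrary: i)
  case 0
  have "Measurable.pred env_space (\<lambda>e. \<sigma> * snd (env_corner e i) \<le> m)"
    by (rule measurable_count_space_fun[OF measurable_env_label])
  then show ?case by simp
next
  case (Suc n)
  have 1: "Measurable.pred env_space (\<lambda>e. \<sigma> * snd (env_corner e i) \<le> m)"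
    by (rule measurable_count_space_fun[OF measurable_env_label])
  have t: "(\<lambda>e. stay (env_corner e) \<sigma> m n (target (env_corner e) o')) \<in> borel_measurable env_space" for o'
    by (rule measurable_compose_countable[OF Suc measurable_env_target])
  have "(\<lambda>e. (\<Sum>o'\<in>edges_from (env_corner e) i. stay (env_corner e) \<sigma> m n (target (env_corner e) o')) /
      real (card (edges_from (env_corner e) i))) \<in> borel_measurable env_space"
    by (rule measurable_finite_set_compose[where A = "\<lambda>e. edges_from (env_corner e) i" and
      f = "\<lambda>S e. (\<Sum>o'\<in>S. stay (env_corner e) \<sigma> m n (target (env_corner e) o')) / real (card S)"])
      (auto intro!: borel_measurable_divide borel_measurable_sum t pred_edges_from)
  moreover have "(\<lambda>e. of_bool (\<sigma> * snd (env_corner e i) \<le> m) :: real) \<in> borel_measurable env_space"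
    using 1 by simp
  ultimately show ?case unfolding stay.simps by (intro borel_measurable_times)
qed

lemma measurable_env_stay_forever [measurable]:
  "(\<lambda>e. stay_forever (env_corner e) \<sigma> m i) \<in> borel_measurable env_space"
  unfolding stay_forever_def by measurable

lemma measurable_env_arc_jump [measurable]:
  "(\<lambda>e. arc_jump (env_corner e) \<sigma> i k) \<in> borel_measurable env_space"
proof -
  have "(\<lambda>e. stay_forever (env_corner e) \<sigma> m i - stay_forever (env_corner e) \<sigma> m j) \<in> borel_measurable env_space" for m j
    by measurable
  from measurable_compose_countable[OF this measurable_next_corner]
  have 1: "(\<lambda>e. stay_forever (env_corner e) \<sigma> m i - stay_forever (env_corner e) \<sigma> m (next_corner (env_corner e) i)) \<in> borel_measurable env_space" for m .
  have "(\<lambda>e. snd (env_corner e (next_corner (env_corner e) i))) \<in> env_space \<rightarrow>\<^sub>M count_space UNIV"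
    by (rule measurable_compose_countable[OF measurable_env_label measurable_next_corner])
  then have "(\<lambda>e. min (\<sigma> * snd (env_corner e i)) (\<sigma> * snd (env_corner e (next_corner (env_corner e) i))) + int k) \<in> env_space \<rightarrow>\<^sub>M count_space UNIV"
    by (rule measurable_count_space_fun2[OF measurable_env_label])
  from measurable_compose_countable[OF 1 this] show ?thesis unfolding arc_jump_def Let_def .
qed

lemma measurable_env_flux [measurable]:
  "(\<lambda>e. flux (env_corner e) \<sigma> K o') \<in> borel_measurable env_space"
proof -
  let ?u = "\<lambda>e. stay_forever (env_corner e) \<sigma>"
  have "(\<lambda>e. ?u e (\<sigma> * l + int k) i * (?u e (\<sigma> * l + int k) i - ?u e (\<sigma> * l + int k) j)) \<in> borel_measurable env_space" for l k i j
    by measurable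
  from measurable_compose_countable[OF this measurable_env_label]
  have "(\<lambda>e. ?u e (\<sigma> * snd (env_corner e i) + int k) i * (?u e (\<sigma> * snd (env_corner e i) + int k) i -
      ?u e (\<sigma> * snd (env_corner e i) + int k) j)) \<in> borel_measurable env_space" for k i j .
  from measurable_compose_countable[OF this measurable_env_target]
  have "(\<lambda>e. ?u e (\<sigma> * snd (env_corner e i) + int k) i * (?u e (\<sigma> * snd (env_corner e i) + int k) i -
      ?u e (\<sigma> * snd (env_corner e i) + int k) (target (env_corner e) o'))) \<in> borel_measurable env_space" for k i .
  from measurable_compose_countable[OF this measurable_env_origin]
  show ?thesis unfolding flux_def by (intro borel_measurable_sum)
qed

section \<open>Stationarity and almost sure properties\<close>

lemma measurable_reroot_funpow [measurable]: "(reroot ^^ k) \<in> env_space \<rightarrow>\<^sub>M env_space"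
  by (induction k) (auto intro: measurable_comp measurable_reroot simp: id_def)

lemma distr_reroot_funpow: "distr env_space env_space (reroot ^^ k) = env_space"
proof (induction k)
  case (Suc k)
  have "distr env_space env_space (reroot ^^ Suc k) = distr (distr env_space env_space (reroot ^^ k)) env_space reroot"
    by (subst distr_distr) simp_all
  then show ?case unfolding Suc distr_reroot .
qed (simp add: id_def distr_id2)

lemma AE_reroot_funpow:
  assumes "AE e in env_space. P e"
  shows "AE e in env_space. P ((reroot ^^ k) e)"
proof (rule AE_distrD[OF measurable_reroot_funpow])
  show "AE e in distr env_space env_space (reroot ^^ k). P e"
    by (subst distr_reroot_funpow) (rule assms)
qed

lemma AE_shifted_reroot: "AE e in env_space. \<forall>k. shifted k (env_corner ((reroot ^^ k) e)) (env_corner e)"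
proof -
  have "AE e in env_space. valid_env e"
    using AE_env_weight by (rule AE_mp) (auto intro!: AE_I2 valid_env_of_weight)
  then have "AE e in env_space. \<forall>k. valid_env ((reroot ^^ k) e)"
    by (simp add: AE_all_countable AE_reroot_funpow)
  then show ?thesis
  proof (rule AE_mp, intro AE_I2 impI allI)
    fix e k assume v: "\<forall>k. valid_env ((reroot ^^ k) e)"
    show "shifted k (env_corner ((reroot ^^ k) e)) (env_corner e)"
    proof (induction k)
      case (Suc k)
      then show ?case using shifted_trans[OF shifted_reroot] v by fastforce
    qed (simp add: shifted_0)
  qed
qed

text \<open>For i \<ge> 0, rerooting \<open>i\<close> times brings corner \<open>i\<close> to the
  root. Rerooting only moves forward, so for negative \<open>i\<close> the property at corner 0 is
  read as the property at corner \<open>i\<close> of the environment rerooted \<open>- i\<close>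
  times, which has the same law.\<close>

lemma AE_stationary:
  fixes P :: "vertex corner_map \<Rightarrow> int \<Rightarrow> bool"
  assumes P: "AE e in env_space. P (env_corner e) 0"
    and m: "\<And>i. Measurable.pred env_space (\<lambda>e. P (env_corner e) i)"
    and inv: "\<And>k c' c i. shifted k c' c \<Longrightarrow> P c' i = P c (i + int k)"
  shows "AE e in env_space. \<forall>i. P (env_corner e) i"
proof -
  have "AE e in env_space. P (env_corner e) i" for i
  proof (cases "0 \<le> i")
    case True
    from AE_reroot_funpow[OF P, of "nat i"] AE_shifted_reroot show ?thesis
    proof eventually_elim
      case (elim e)
      then show ?case using inv[of "nat i" "env_corner ((reroot ^^ nat i) e)" "env_corner e" 0] True by simp
    qed
  next
    case False
    define k where "k = nat (- i)"
    have "AE e in env_space. P (env_corner ((reroot ^^ k) e)) i"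
      using P AE_shifted_reroot
    proof eventually_elim
      case (elim e)
      then show ?case using inv[of k "env_corner ((reroot ^^ k) e)" "env_corner e" i] False by (simp add: k_def)
    qed
    then have "AE e in distr env_space env_space (reroot ^^ k). P (env_corner e) i"
      by (subst AE_distr_iff) (use m[of i] in \<open>auto simp: pred_def\<close>)
    then show ?thesis by (subst (asm) distr_reroot_funpow)
  qed
  then show ?thesis by (simp add: AE_all_countable)
qed

lemma nn_integral_stationary:
  fixes G :: "vertex corner_map \<Rightarrow> int \<Rightarrow> ennreal"
  assumes m: "\<And>i. (\<lambda>e. G (env_corner e) i) \<in> borel_measurable env_space"
    and inv: "\<And>k c' c i. shifted k c' c \<Longrightarrow> G c' i = G c (i + int k)"
  shows "(\<integral>\<^sup>+ e. G (env_corner e) i \<partial>env_space) = (\<integral>\<^sup>+ e. G (env_corner e) 0 \<partial>env_space)"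
proof -
  have shift: "(\<integral>\<^sup>+ e. G (env_corner e) j \<partial>env_space) = (\<integral>\<^sup>+ e. G (env_corner e) (j + int k) \<partial>env_space)" for j k
  proof -
    have "(\<integral>\<^sup>+ e. G (env_corner e) j \<partial>env_space) = (\<integral>\<^sup>+ e. G (env_corner e) j \<partial>distr env_space env_space (reroot ^^ k))"
      by (simp add: distr_reroot_funpow)
    also have "\<dots> = (\<integral>\<^sup>+ e. G (env_corner ((reroot ^^ k) e)) j \<partial>env_space)"
      by (rule nn_integral_distr) (simp_all add: m)
    also have "\<dots> = (\<integral>\<^sup>+ e. G (env_corner e) (j + int k) \<partial>env_space)"
      by (rule nn_integral_cong_AE) (use AE_shifted_reroot in \<open>eventually_elim, auto intro: inv\<close>)
    finally show ?thesis .
  qed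
  show ?thesis
  proof (cases "0 \<le> i")
    case True
    then show ?thesis using shift[of 0 "nat i"] by simp
  next
    case False
    then show ?thesis using shift[of i "nat (- i)"] by simp
  qed
qed

section \<open>Almost sure regularity of the corner map\<close>

lemma AE_label_step: "AE e in env_space. \<bar>snd (env_corner e 1) - snd (env_corner e 0)\<bar> \<le> 1"
  using AE_env_weight
proof eventually_elim
  case (elim e)
  then have w: "\<And>n. graft_weight (e n) \<noteq> 0" by blast
  have v: "valid_env e" by (rule valid_env_of_weight[OF w])
  obtain s L R where e0: "e 0 = (s, L, R)" by (cases "e 0")
  note D = graft_weight_nonzeroD[of s L R, folded e0, OF w]
  obtain cs where L: "L = Node 0 cs" using D(2) by (cases L) auto
  \<comment> \<open>The corner after the root corner belongs to S(1) if the left tree at S(0) is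
    trivial, and otherwise to the first child of S(0).\<close>
  show ?case
  proof (cases cs)
    case Nil
    have r1: "root_label (fst (snd (e 1))) = 0" using v unfolding valid_env_def by blast
    have "env_corner e 1 = pick (env_left e) 0 1" by (simp add: env_corner_eq)
    also have "\<dots> = pick (\<lambda>n. env_left e (Suc n)) 0 0"
      by (subst pick_0) (simp_all add: env_left_def e0 L Nil)
    also have "\<dots> = env_left e 1 ! 0"
      by (subst pick_0) simp_all
    also have "\<dots> = (vtx 1 False [], s)"
      using r1 by (simp add: env_left_def contour_hd env_spine_def e0)
    finally show ?thesis using D(1) env_corner_0(1)[OF v] by auto
  next
    case (Cons c ds)
    have "env_corner e 1 = pick (env_left e) 0 1" by (simp add: env_corner_eq)
    also have "\<dots> = env_left e 0 ! 1"
      by (cases c, subst pick_0) (simp_all add: env_left_def e0 L Cons)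
    also have "\<dots> = (vtx 0 False [0], root_label c)"
      by (cases c) (simp add: env_left_def e0 L Cons)
    finally show ?thesis using D(4)[of c] env_corner_0(1)[OF v] by (auto simp: L Cons)
  qed
qed

lemma root_vertex_cases:
  assumes "fst (env_corner e i) = (0, False, [])" "valid_env e"
  shows "snd (env_corner e i) = 0"
  using env_corner_vertex[of e i] assms contour_root rcontour_root
  by (fastforce simp: vtx_def valid_env_def split: if_splits)

lemma pick_beyond_first:
  assumes "\<And>n. f n \<noteq> []" "length (f 0) \<le> k"
  shows "\<exists>m. pick f 0 k \<in> set (f (Suc m))"
proof -
  have "pick f 0 k = pick (\<lambda>n. f (Suc n)) 0 (k - length (f 0))"
    using assms by (simp add: pick_0)
  then show ?thesis using pick_in_set[of "\<lambda>n. f (Suc n)" 0 "k - length (f 0)"] assms by auto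
qed

text \<open>Beyond the first left block and the first right block every vertex name carries a
  positive spine index.\<close>

lemma finite_root_corners: "finite {i. fst (env_corner e i) = (0, False, [])}"
proof -
  have "i \<in> {- int (length (env_right e 0)) .. int (length (env_left e 0))}"
    if "fst (env_corner e i) = (0, False, [])" for i
  proof (rule ccontr)
    assume out: "i \<notin> {- int (length (env_right e 0)) .. int (length (env_left e 0))}"
    have "\<exists>m. env_corner e i \<in> set (env_left e (Suc m)) \<union> set (env_right e (Suc m))"
    proof (cases "0 \<le> i")
      case True
      then have "length (env_left e 0) \<le> nat i" using out by auto
      then show ?thesis
        using pick_beyond_first[of "env_left e" "nat i"] True by (auto simp: env_corner_eq)
    next
      case False
      then have "length (env_right e 0) \<le> nat (- i)" using out by auto
      then show ?thesis
        using pick_beyond_first[of "env_right e" "nat (- i)"] False by (auto simp: env_corner_eq)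
    qed
    then show False using that by (auto simp: env_left_def env_right_def vtx_def)
  qed
  then have "{i. fst (env_corner e i) = (0, False, [])} \<subseteq> {- int (length (env_right e 0)) .. int (length (env_left e 0))}"
    by blast
  then show ?thesis by (rule finite_subset) simp
qed

lemma ex_env_corner_spine:
  assumes "valid_env e"
  shows "\<exists>j\<ge>int n. snd (env_corner e j) = env_spine e n" "\<exists>j\<le>- int n. snd (env_corner e j) = env_spine e n"
proof -
  obtain k where k: "k \<ge> n" "pick (env_left e) 0 k = env_left e n ! 0"
    using ex_pick[of "env_left e" n] by auto
  then have "snd (env_corner e (int k)) = env_spine e n"
    using assms by (simp add: env_corner_eq env_left_def contour_hd valid_env_def)
  then show "\<exists>j\<ge>int n. snd (env_corner e j) = env_spine e n" using k by (intro exI[of _ "int k"]) auto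
  obtain k where k: "k \<ge> n" "pick (env_right e) 0 k = env_right e n ! 0"
    using ex_pick[of "env_right e" n] by auto
  \<comment> \<open>Position 0 on the right corresponds to corner 0, which \<open>corner\<close>
    takes from the left side.\<close>
  have "snd (env_corner e (- int k)) = env_spine e n"
  proof (cases "k = 0")
    case True
    then show ?thesis using k(1) env_corner_0(1)[OF assms] by simp
  next
    case False
    then show ?thesis using k(2) assms
      by (simp add: env_corner_eq env_right_def rcontour_hd valid_env_def)
  qed
  then show "\<exists>j\<le>- int n. snd (env_corner e j) = env_spine e n" using k by (intro exI[of _ "- int k"]) auto
qed

text \<open>Local properties are checked at the root corner, where names and labels are explicit,
  and carried to all corners by stationarity. Unboundedness comes from the spine, whose vertices
  occur arbitrarily far out on both sides.\<close>

lemma AE_good: "AE e in env_space. good_corner_map (env_corner e)"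
proof -
  have 1: "AE e in env_space. \<forall>i. \<bar>snd (env_corner e (i + 1)) - snd (env_corner e i)\<bar> \<le> 1"
  proof (rule AE_stationary[where P = "\<lambda>c i. \<bar>snd (c (i + 1)) - snd (c i)\<bar> \<le> 1"])
    show "AE e in env_space. \<bar>snd (env_corner e (0 + 1)) - snd (env_corner e 0)\<bar> \<le> 1"
      using AE_label_step by simp
    show "Measurable.pred env_space (\<lambda>e. \<bar>snd (env_corner e (i + 1)) - snd (env_corner e i)\<bar> \<le> 1)" for i
      by (rule measurable_count_space_fun2[OF measurable_env_label measurable_env_label])
    show "(\<bar>snd (c' (i + 1)) - snd (c' i)\<bar> \<le> 1) = (\<bar>snd (c (i + int k + 1)) - snd (c (i + int k))\<bar> \<le> 1)"
      if "shifted k c' c" for k c i and c' :: "vertex corner_map"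
      using that by (auto simp: shifted_def ac_simps)
  qed
  have root: "AE e in env_space. fst (env_corner e 0) = (0, False, []) \<and> valid_env e"
    using AE_env_weight
  proof eventually_elim
    case (elim e)
    then have v: "valid_env e" by (intro valid_env_of_weight) auto
    then show ?case using env_corner_0(1)[OF v] by (simp add: vtx_def)
  qed
  have 2: "AE e in env_space. \<forall>i. \<forall>j. fst (env_corner e i) = fst (env_corner e j) \<longrightarrow> snd (env_corner e i) = snd (env_corner e j)"
  proof (rule AE_stationary[where P = "\<lambda>c i. \<forall>j. fst (c i) = fst (c j) \<longrightarrow> snd (c i) = snd (c j)"])
    show "AE e in env_space. \<forall>j. fst (env_corner e 0) = fst (env_corner e j) \<longrightarrow> snd (env_corner e 0) = snd (env_corner e j)"
      using root by eventually_elim (metis root_vertex_cases)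
    have "Measurable.pred env_space (\<lambda>e. fst (env_corner e i) = fst (env_corner e j) \<longrightarrow> snd (env_corner e i) = snd (env_corner e j))" for i j
      by (rule measurable_count_space_fun2[OF measurable_env_corner measurable_env_corner])
    then show "Measurable.pred env_space (\<lambda>e. \<forall>j. fst (env_corner e i) = fst (env_corner e j) \<longrightarrow> snd (env_corner e i) = snd (env_corner e j))" for i
      by measurable
    show "(\<forall>j. fst (c' i) = fst (c' j) \<longrightarrow> snd (c' i) = snd (c' j)) =
        (\<forall>j. fst (c (i + int k)) = fst (c j) \<longrightarrow> snd (c (i + int k)) = snd (c j))"
      if s: "shifted k c' c" for k c i and c' :: "vertex corner_map"
    proof -
      have "(fst (c' i) = fst (c' j) \<longrightarrow> snd (c' i) = snd (c' j)) =
         (fst (c (i + int k)) = fst (c (j + int k)) \<longrightarrow> snd (c (i + int k)) = snd (c (j + int k)))" for j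
        using s by (auto simp: shifted_def)
      then show ?thesis by (metis diff_add_cancel)
    qed
  qed
  have 3: "AE e in env_space. \<forall>i. finite {j. fst (env_corner e j) = fst (env_corner e i)}"
  proof (rule AE_stationary[where P = "\<lambda>c i. finite {j. fst (c j) = fst (c i)}"])
    show "AE e in env_space. finite {j. fst (env_corner e j) = fst (env_corner e 0)}"
      using root by eventually_elim (simp add: finite_root_corners)
    show "Measurable.pred env_space (\<lambda>e. finite {j. fst (env_corner e j) = fst (env_corner e i)})" for i
      by (rule pred_finite) (simp add: pred_same_vertex)
    show "finite {j. fst (c' j) = fst (c' i)} = finite {j. fst (c j) = fst (c (i + int k))}"
      if s: "shifted k c' c" for k c i and c' :: "vertex corner_map"
    proof -
      have "{j. fst (c j) = fst (c (i + int k))} = (\<lambda>j. j + int k) ` {j. fst (c' j) = fst (c' i)}"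
      proof (intro set_eqI iffI)
        fix j assume "j \<in> {j. fst (c j) = fst (c (i + int k))}"
        then have "fst (c' (j - int k)) = fst (c' i)" using s by (simp add: shifted_def)
        then show "j \<in> (\<lambda>j. j + int k) ` {j. fst (c' j) = fst (c' i)}"
          by (intro image_eqI[of _ _ "j - int k"]) auto
      qed (use s in \<open>auto simp: shifted_def\<close>)
      then show ?thesis by (simp add: finite_image_iff inj_on_def)
    qed
  qed
  from 1 2 3 AE_env_spine_unbounded[of 1, simplified] AE_env_spine_unbounded[of "-1", simplified] AE_env_weight
  show ?thesis
  proof eventually_elim
    case (elim e)
    then have w: "\<And>n. graft_weight (e n) \<noteq> 0" by blast
    have v: "valid_env e" by (rule valid_env_of_weight[OF w])
    have low: "\<exists>n\<ge>N. env_spine e n \<le> m" for N m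
    proof -
      \<comment> \<open>The spine label at \<open>n\<close> is at least \<open>- n\<close>, so a
        label of at most \<open>- N\<close> forces n \<ge> N. Hence low labels occur arbitrarily far
        along the spine.\<close>
      obtain n where n: "max (- m) (int N) \<le> - env_spine e n" using elim(5) by blast
      then have "int N \<le> int n" using abs_env_spine_le[of e n, OF w] by linarith
      then show ?thesis using n by (intro exI[of _ n]) auto
    qed
    show ?case unfolding good_corner_map_def
    proof (intro conjI allI)
      fix i m :: int
      obtain n where n: "n \<ge> Suc (nat \<bar>i\<bar>)" "env_spine e n \<le> m" using low by blast
      obtain j where "j \<ge> int n" "snd (env_corner e j) = env_spine e n" using ex_env_corner_spine(1)[OF v] by blast
      then show "\<exists>j>i. snd (env_corner e j) \<le> m" using n by (intro exI[of _ j]) auto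
      obtain j where "j \<le> - int n" "snd (env_corner e j) = env_spine e n" using ex_env_corner_spine(2)[OF v] by blast
      then show "\<exists>j<i. snd (env_corner e j) \<le> m" using n by (intro exI[of _ j]) auto
    next
      fix m :: int
      obtain n where "m \<le> env_spine e n" using elim(4) by blast
      then show "\<exists>j. m \<le> snd (env_corner e j)" using ex_env_corner_spine(1)[OF v, of n] by metis
    qed ((use elim(1-3) in blast)+)
  qed
qed

section \<open>Mass transport and the energy identity\<close>

lemma nn_integral_edges:
  fixes f :: "oedge \<Rightarrow> ennreal"
  assumes "finite S"
  shows "(\<integral>\<^sup>+ j. (\<Sum>b\<in>UNIV. of_bool ((j, b) \<in> S) * f (j, b)) \<partial>count_space UNIV) = (\<Sum>e\<in>S. f e)"
proof -
  have "(\<Sum>e\<in>S. f e) = (\<integral>\<^sup>+ e. f e \<partial>count_space S)"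
    using assms by (simp add: nn_integral_count_space_finite)
  also have "\<dots> = (\<integral>\<^sup>+ e. of_bool (e \<in> S) * f e \<partial>count_space UNIV)"
    by (subst nn_integral_count_space_indicator) (auto intro!: nn_integral_cong simp: indicator_def)
  also have "\<dots> = (\<integral>\<^sup>+ j. \<integral>\<^sup>+ b. of_bool ((j, b) \<in> S) * f (j, b) \<partial>count_space UNIV \<partial>count_space UNIV)"
    by (rule nn_integral_fst_count_space[symmetric])
  also have "\<dots> = (\<integral>\<^sup>+ j. (\<Sum>b\<in>UNIV. of_bool ((j, b) \<in> S) * f (j, b)) \<partial>count_space UNIV)"
    by (simp add: nn_integral_count_space_finite)
  finally show ?thesis by simp
qed

definition edge_average :: "'v corner_map \<Rightarrow> (oedge \<Rightarrow> ennreal) \<Rightarrow> oedge \<Rightarrow> ennreal" where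
  "edge_average c f e = (\<Sum>e'\<in>edges_from c (origin c e). f e') / of_nat (card (edges_from c (origin c e)))"

text \<open>Mass transport: every edge sends its mass in equal parts to the edges with the same origin.\<close>
theorem edge_mass_transport:
  fixes G :: "vertex corner_map \<Rightarrow> oedge \<Rightarrow> ennreal"
  assumes m: "\<And>o'. (\<lambda>e. G (env_corner e) o') \<in> borel_measurable env_space"
    and inv: "\<And>k c' c i b. shifted k c' c \<Longrightarrow> G c' (i, b) = G c (i + int k, b)"
  shows "(\<integral>\<^sup>+ e. (\<Sum>b\<in>UNIV. edge_average (env_corner e) (G (env_corner e)) (0, b)) \<partial>env_space)
       = (\<integral>\<^sup>+ e. (\<Sum>b\<in>UNIV. G (env_corner e) (0, b)) \<partial>env_space)"
proof -
  \<comment> \<open>The mass that the two orientations of arc \<open>i\<close> send to the two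
    orientations of arc \<open>j\<close>.\<close>
  define H where "H c i j = (\<Sum>b\<in>UNIV. \<Sum>b'\<in>UNIV. of_bool ((j, b') \<in> edges_from c (origin c (i, b))) *
      (G c (i, b) / of_nat (card (edges_from c (origin c (i, b))))))" for c :: "vertex corner_map" and i j
  have card: "(\<lambda>e. card (edges_from (env_corner e) i)) \<in> env_space \<rightarrow>\<^sub>M count_space UNIV" for i
    by (rule measurable_finite_set_compose[where A = "\<lambda>e. edges_from (env_corner e) i" and f = "\<lambda>S e. card S"])
      (auto intro: pred_edges_from)
  have mH: "(\<lambda>e. H (env_corner e) i j) \<in> borel_measurable env_space" for i j
  proof -
    have "(\<lambda>e. of_bool ((j, b') \<in> edges_from (env_corner e) l) *
      (G (env_corner e) (i, b) / of_nat (card (edges_from (env_corner e) l)))) \<in> borel_measurable env_space" for b b' l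
    proof (intro borel_measurable_times_ennreal borel_measurable_divide_ennreal m)
      show "(\<lambda>e. of_bool ((j, b') \<in> edges_from (env_corner e) l) :: ennreal) \<in> borel_measurable env_space"
        using pred_edges_from[of "(j, b')" l] by measurable
      show "(\<lambda>e. of_nat (card (edges_from (env_corner e) l)) :: ennreal) \<in> borel_measurable env_space"
        by (rule measurable_compose[OF card]) simp
    qed
    from measurable_compose_countable[OF this measurable_env_origin]
    show ?thesis unfolding H_def by (intro borel_measurable_sum)
  qed
  have invH: "H c' i j = H c (i + int k) (j + int k)" if s: "shifted k c' c" for k c' c i j
  proof -
    have "edges_from c (origin c (i + int k, b)) = (\<lambda>(j, b). (j + int k, b)) ` edges_from c' (origin c' (i, b))" for b
      using shifted_edges_from[OF s, of "origin c' (i, b)"] shifted_origin[OF s, of i b] by simp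
    then have "((j + int k, b') \<in> edges_from c (origin c (i + int k, b))) = ((j, b') \<in> edges_from c' (origin c' (i, b)))"
       "card (edges_from c (origin c (i + int k, b))) = card (edges_from c' (origin c' (i, b)))" for b b'
      by (auto simp: card_image inj_shift_edge)
    then show ?thesis by (simp add: H_def inv[OF s])
  qed
  have sym: "(j, b') \<in> edges_from c (origin c (i, b)) \<longleftrightarrow> (i, b) \<in> edges_from c (origin c (j, b'))" for c :: "vertex corner_map" and i j b b'
    by (auto simp: edges_from_def)
  have cong: "edges_from c (origin c (i, b)) = edges_from c (origin c (j, b'))"
    if "(i, b) \<in> edges_from c (origin c (j, b'))" for c :: "vertex corner_map" and i j b b'
    using that by (auto simp: edges_from_def)
  have out: "(\<integral>\<^sup>+ j. H c 0 j \<partial>count_space UNIV) = (\<Sum>b\<in>UNIV. G c (0, b))"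
    if "good_corner_map c" for c
  proof -
    interpret corner_map c by standard fact
    have "(\<integral>\<^sup>+ j. H c 0 j \<partial>count_space UNIV) = (\<Sum>b\<in>UNIV. \<Sum>e\<in>edges_from c (origin c (0, b)).
        G c (0, b) / of_nat (card (edges_from c (origin c (0, b)))))"
      unfolding H_def
      by (subst nn_integral_sum) (simp, intro sum.cong refl nn_integral_edges finite_edges_from)
    also have "\<dots> = (\<Sum>b\<in>UNIV. G c (0, b))"
      using card_edges_from_pos by (intro sum.cong refl) (simp add: ennreal_times_divide mult.commute[of "of_nat _"] ennreal_mult_divide_eq)
    finally show ?thesis .
  qed
  \<comment> \<open>Edges with a common origin share one set of edges, hence one denominator, so the
    mass received by an edge is an average over that set.\<close>
  have into: "(\<integral>\<^sup>+ j. H c j 0 \<partial>count_space UNIV) = (\<Sum>b\<in>UNIV. edge_average c (G c) (0, b))"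
    if "good_corner_map c" for c
  proof -
    interpret corner_map c by standard fact
    have "H c j 0 = (\<Sum>b'\<in>UNIV. \<Sum>b\<in>UNIV. of_bool ((j, b) \<in> edges_from c (origin c (0, b'))) *
        (G c (j, b) / of_nat (card (edges_from c (origin c (0, b'))))))" for j
      unfolding H_def by (subst sum.swap) (auto intro!: sum.cong simp: sym[of 0] dest: cong)
    then have "(\<integral>\<^sup>+ j. H c j 0 \<partial>count_space UNIV) = (\<Sum>b'\<in>UNIV. \<integral>\<^sup>+ j. (\<Sum>b\<in>UNIV. of_bool ((j, b) \<in> edges_from c (origin c (0, b'))) *
        (G c (j, b) / of_nat (card (edges_from c (origin c (0, b')))))) \<partial>count_space UNIV)"
      by (simp add: nn_integral_sum)
    also have "\<dots> = (\<Sum>b\<in>UNIV. edge_average c (G c) (0, b))"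
      unfolding edge_average_def
      by (intro sum.cong refl) (subst nn_integral_edges, simp_all add: finite_edges_from divide_ennreal_def sum_distrib_right)
    finally show ?thesis .
  qed
  have "(\<integral>\<^sup>+ e. (\<Sum>b\<in>UNIV. G (env_corner e) (0, b)) \<partial>env_space)
      = (\<integral>\<^sup>+ e. \<integral>\<^sup>+ j. H (env_corner e) 0 j \<partial>count_space UNIV \<partial>env_space)"
    by (rule nn_integral_cong_AE) (use AE_good in \<open>eventually_elim, simp add: out\<close>)
  also have "\<dots> = (\<integral>\<^sup>+ j. \<integral>\<^sup>+ e. H (env_corner e) 0 j \<partial>env_space \<partial>count_space UNIV)"
    by (rule nn_integral_count_space_nn_integral) (auto simp: mH)
  \<comment> \<open>By stationarity the mass sent from arc 0 to arc \<open>j\<close> has the same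
    mean as the mass received by arc 0 from arc \<open>- j\<close>.\<close>
  also have "\<dots> = (\<integral>\<^sup>+ j. \<integral>\<^sup>+ e. H (env_corner e) (- j) 0 \<partial>env_space \<partial>count_space UNIV)"
  proof (rule nn_integral_cong)
    fix j :: int
    show "(\<integral>\<^sup>+ e. H (env_corner e) 0 j \<partial>env_space) = (\<integral>\<^sup>+ e. H (env_corner e) (- j) 0 \<partial>env_space)"
      using nn_integral_stationary[of "\<lambda>c i. H c i (i + j)" "- j"] mH invH by (simp add: ac_simps)
  qed
  also have "\<dots> = (\<integral>\<^sup>+ j. \<integral>\<^sup>+ e. H (env_corner e) j 0 \<partial>env_space \<partial>count_space UNIV)"
    by (rule nn_integral_bij_count_space[where g = uminus]) (auto intro!: bij_betwI[of _ _ _ uminus])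
  also have "\<dots> = (\<integral>\<^sup>+ e. \<integral>\<^sup>+ j. H (env_corner e) j 0 \<partial>count_space UNIV \<partial>env_space)"
    by (rule nn_integral_count_space_nn_integral[symmetric]) (auto simp: mH)
  also have "\<dots> = (\<integral>\<^sup>+ e. (\<Sum>b\<in>UNIV. edge_average (env_corner e) (G (env_corner e)) (0, b)) \<partial>env_space)"
    by (rule nn_integral_cong_AE) (use AE_good in \<open>eventually_elim, simp add: into\<close>)
  finally show ?thesis by simp
qed

section \<open>Zero mean flux and vanishing of the jumps\<close>

lemma integrable_env_bounded:
  fixes f :: "environment \<Rightarrow> real"
  assumes "f \<in> borel_measurable env_space" "AE e in env_space. \<bar>f e\<bar> \<le> B"
  shows "integrable env_space f"
  using assms by (intro env.P.integrable_const_bound[of _ B]) auto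

lemma AE_flux_bound: "AE e in env_space. \<bar>flux (env_corner e) \<sigma> K o'\<bar> \<le> real K + 1"
  using AE_good by eventually_elim (simp add: corner_map.abs_flux_le corner_map_def)

lemma AE_arc_jump_bound: "AE e in env_space. \<bar>arc_jump (env_corner e) \<sigma> i k\<bar> \<le> 1"
  using AE_good by eventually_elim (simp add: corner_map.abs_arc_jump_le corner_map_def)

lemma integrable_env_flux: "integrable env_space (\<lambda>e. flux (env_corner e) \<sigma> K o')"
  by (rule integrable_env_bounded[OF _ AE_flux_bound]) simp

lemma integrable_env_arc_jump: "integrable env_space (\<lambda>e. arc_jump (env_corner e) \<sigma> i k)"
  by (rule integrable_env_bounded[OF _ AE_arc_jump_bound]) simp

lemma integrable_env_arc_jump_sq: "integrable env_space (\<lambda>e. (arc_jump (env_corner e) \<sigma> i k)\<^sup>2)"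
proof (rule integrable_env_bounded)
  show "AE e in env_space. \<bar>(arc_jump (env_corner e) \<sigma> i k)\<^sup>2\<bar> \<le> 1"
    using AE_arc_jump_bound[of \<sigma> i k] by eventually_elim (simp add: abs_square_le_1)
qed simp

text \<open>The constant \<open>B\<close> makes the flux nonnegative, so that mass transport
  applies. The flux averages to 0 over the edges leaving a vertex, so each orientation of the root
  arc receives exactly \<open>B\<close>, and subtracting 2 * B leaves 0.\<close>

lemma integral_flux: "(\<integral>e. flux (env_corner e) \<sigma> K (0, False) + flux (env_corner e) \<sigma> K (0, True) \<partial>env_space) = 0"
proof -
  define B where "B = real K + 1"
  define G where "G c o' = ennreal (flux c \<sigma> K o' + B)" for c :: "vertex corner_map" and o'
  have avg: "edge_average c (G c) o' = ennreal B" if "good_corner_map c" for c o'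
  proof -
    interpret corner_map c by standard fact
    let ?S = "edges_from c (origin c o')"
    have nn: "0 \<le> flux c \<sigma> K e + B" for e using abs_flux_le[of \<sigma> K e] by (simp add: B_def)
    have "(\<Sum>e\<in>?S. G c e) = ennreal (\<Sum>e\<in>?S. flux c \<sigma> K e + B)"
      unfolding G_def using nn by (intro sum_ennreal) auto
    also have "(\<Sum>e\<in>?S. flux c \<sigma> K e + B) = real (card ?S) * B"
      by (simp add: sum.distrib sum_flux_edges_from)
    finally show ?thesis
      using card_edges_from_pos[of "origin c o'"]
      by (simp add: edge_average_def ennreal_of_nat_eq_real_of_nat B_def divide_ennreal)
  qed
  have "(\<integral>\<^sup>+ e. (\<Sum>b\<in>UNIV. G (env_corner e) (0, b)) \<partial>env_space)
      = (\<integral>\<^sup>+ e. (\<Sum>b\<in>UNIV. edge_average (env_corner e) (G (env_corner e)) (0, b)) \<partial>env_space)"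
    by (rule edge_mass_transport[symmetric]) (simp_all add: G_def shifted_flux)
  also have "\<dots> = (\<integral>\<^sup>+ e. ennreal (2 * B) \<partial>env_space)"
  proof (rule nn_integral_cong_AE, use AE_good in eventually_elim)
    case (elim e)
    have "2 * ennreal B = ennreal (2 * B)"
      by (subst ennreal_mult) (auto simp: B_def)
    then show ?case by (simp add: avg[OF elim] UNIV_bool)
  qed
  also have "\<dots> = ennreal (2 * B)" by (simp add: env.P.emeasure_space_1[simplified])
  finally have 1: "(\<integral>\<^sup>+ e. (\<Sum>b\<in>UNIV. G (env_corner e) (0, b)) \<partial>env_space) = ennreal (2 * B)" .
  let ?f = "\<lambda>e. flux (env_corner e) \<sigma> K (0, False) + flux (env_corner e) \<sigma> K (0, True)"
  have int: "integrable env_space ?f" by (intro Bochner_Integration.integrable_add integrable_env_flux)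
  have nn: "AE e in env_space. 0 \<le> ?f e + 2 * B"
    using AE_flux_bound[of \<sigma> K "(0, False)"] AE_flux_bound[of \<sigma> K "(0, True)"]
    by eventually_elim (simp add: B_def)
  have "(\<integral>\<^sup>+ e. (\<Sum>b\<in>UNIV. G (env_corner e) (0, b)) \<partial>env_space) = (\<integral>\<^sup>+ e. ennreal (?f e + 2 * B) \<partial>env_space)"
    using AE_flux_bound[of \<sigma> K "(0, False)"] AE_flux_bound[of \<sigma> K "(0, True)"]
    by (intro nn_integral_cong_AE, eventually_elim)
      (simp add: G_def UNIV_bool B_def ennreal_plus[symmetric] del: ennreal_plus)
  also have "\<dots> = ennreal (\<integral>e. ?f e + 2 * B \<partial>env_space)"
    using nn int by (intro nn_integral_eq_integral) auto
  also have "(\<integral>e. ?f e + 2 * B \<partial>env_space) = (\<integral>e. ?f e \<partial>env_space) + 2 * B"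
    using int by (subst Bochner_Integration.integral_add) (auto simp: env.P.prob_space[simplified])
  finally have "ennreal ((\<integral>e. ?f e \<partial>env_space) + 2 * B) = ennreal (2 * B)" using 1 by simp
  moreover have "0 \<le> (\<integral>e. ?f e \<partial>env_space) + 2 * B"
  proof -
    have "0 \<le> (\<integral>e. ?f e + 2 * B \<partial>env_space)" using nn by (rule integral_nonneg_AE)
    also have "\<dots> = (\<integral>e. ?f e \<partial>env_space) + 2 * B"
      using int by (subst Bochner_Integration.integral_add) (auto simp: env.P.prob_space[simplified])
    finally show ?thesis .
  qed
  ultimately show ?thesis by (subst (asm) ennreal_inj) (auto simp: B_def)
qed

text \<open>As the terms are at most 1, the partial sums are bounded and the series converges. Hence
  the right-hand side tends to 0, although it eventually dominates \<open>a j\<close>.\<close>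

lemma zero_if_partial_sums_le_sqrt:
  fixes a :: "nat \<Rightarrow> real"
  assumes nn: "\<And>k. 0 \<le> a k" and le1: "\<And>k. a k \<le> 1"
    and rec: "\<And>K. (\<Sum>k\<le>K. a k) \<le> sqrt (a (Suc K))"
  shows "a j = 0"
proof -
  have "summable a"
  proof (rule summableI_nonneg_bounded)
    show "(\<Sum>k<n. a k) \<le> 1" for n
    proof -
      have "(\<Sum>k<n. a k) \<le> (\<Sum>k\<le>n. a k)" by (rule sum_mono2) (auto simp: nn)
      also have "\<dots> \<le> sqrt (a (Suc n))" by (rule rec)
      also have "\<dots> \<le> 1" using le1[of "Suc n"] by simp
      finally show ?thesis .
    qed
  qed (rule nn)
  then have "(\<lambda>K. sqrt (a (Suc K))) \<longlonglongrightarrow> sqrt 0"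
    by (intro tendsto_real_sqrt LIMSEQ_Suc summable_LIMSEQ_zero)
  moreover have "eventually (\<lambda>K. a j \<le> sqrt (a (Suc K))) sequentially"
  proof (rule eventually_sequentiallyI[of j])
    fix K assume "j \<le> K"
    then have "a j \<le> (\<Sum>k\<le>K. a k)" by (intro member_le_sum) (auto simp: nn)
    then show "a j \<le> sqrt (a (Suc K))" using rec[of K] by simp
  qed
  ultimately have "a j \<le> sqrt 0" by (intro tendsto_lowerbound[OF _ _ sequentially_bot])
  then show ?thesis using nn[of j] by simp
qed

theorem AE_stay_forever_eq_0:
  assumes \<sigma>: "\<sigma> = 1 \<or> \<sigma> = -1"
  shows "AE e in env_space. \<forall>m i. stay_forever (env_corner e) \<sigma> m i = 0"
proof -
  let ?J = "\<lambda>k e. arc_jump (env_corner e) \<sigma> 0 k"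
  define a where "a k = (\<integral>e. (?J k e)\<^sup>2 \<partial>env_space)" for k
  have a0: "0 \<le> a k" for k unfolding a_def by simp
  have a1: "a k \<le> 1" for k
  proof -
    have "a k \<le> (\<integral>e. 1 \<partial>env_space)" unfolding a_def
    proof (rule integral_mono_AE)
      show "AE e in env_space. (?J k e)\<^sup>2 \<le> 1"
        using AE_arc_jump_bound[of \<sigma> 0 k] by eventually_elim (simp add: abs_square_le_1)
    qed (simp_all add: integrable_env_arc_jump_sq)
    then show ?thesis by (simp add: env.P.prob_space[simplified])
  qed
  have rec: "(\<Sum>k\<le>K. a k) \<le> sqrt (a (Suc K))" for K
  proof -
    let ?f = "\<lambda>e. flux (env_corner e) \<sigma> K (0, False) + flux (env_corner e) \<sigma> K (0, True)"
    have int: "integrable env_space ?f" "integrable env_space (\<lambda>e. \<bar>?J (Suc K) e\<bar>)"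
      by (auto intro!: Bochner_Integration.integrable_add integrable_env_flux integrable_abs integrable_env_arc_jump)
    have "(\<Sum>k\<le>K. a k) = (\<integral>e. (\<Sum>k\<le>K. (?J k e)\<^sup>2) \<partial>env_space)"
      unfolding a_def by (simp add: integrable_env_arc_jump_sq)
    also have "\<dots> \<le> (\<integral>e. ?f e + \<bar>?J (Suc K) e\<bar> \<partial>env_space)"
    proof (rule integral_mono_AE)
      show "AE e in env_space. (\<Sum>k\<le>K. (?J k e)\<^sup>2) \<le> ?f e + \<bar>?J (Suc K) e\<bar>"
        using AE_good by eventually_elim (rule corner_map.flux_arc, simp add: corner_map_def, rule \<sigma>)
    qed (use int in \<open>auto simp: integrable_env_arc_jump_sq\<close>)
    also have "\<dots> = (\<integral>e. \<bar>?J (Suc K) e\<bar> \<partial>env_space)"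
      using integral_flux[of \<sigma> K] int by (subst Bochner_Integration.integral_add) auto
    \<comment> \<open>Cauchy--Schwarz, in the form that a variance is nonnegative.\<close>
    also have "\<dots> \<le> sqrt (a (Suc K))"
    proof (rule real_le_rsqrt)
      have "0 \<le> env.P.variance (\<lambda>e. \<bar>?J (Suc K) e\<bar>)" by (rule env.P.variance_positive)
      also have "\<dots> = (\<integral>e. \<bar>?J (Suc K) e\<bar>\<^sup>2 \<partial>env_space) - (\<integral>e. \<bar>?J (Suc K) e\<bar> \<partial>env_space)\<^sup>2"
        using int(2) integrable_env_arc_jump_sq[of \<sigma> 0 "Suc K"] by (intro env.P.variance_eq) auto
      finally show "(\<integral>e. \<bar>?J (Suc K) e\<bar> \<partial>env_space)\<^sup>2 \<le> a (Suc K)" by (simp add: a_def)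
    qed
    finally show ?thesis .
  qed
  have "a k = 0" for k by (rule zero_if_partial_sums_le_sqrt[OF a0 a1 rec])
  then have "AE e in env_space. (?J k e)\<^sup>2 = 0" for k
    unfolding a_def by (subst (asm) integral_nonneg_eq_0_iff_AE) (auto simp: integrable_env_arc_jump_sq)
  then have "AE e in env_space. \<forall>k. arc_jump (env_corner e) \<sigma> 0 k = 0" by (simp add: AE_all_countable)
  \<comment> \<open>By stationarity the statement passes from the root arc to every arc.\<close>
  then have "AE e in env_space. \<forall>i. \<forall>k. arc_jump (env_corner e) \<sigma> i k = 0"
    by (rule AE_stationary[where P = "\<lambda>c i. \<forall>k. arc_jump c \<sigma> i k = 0"]) (measurable, simp add: shifted_arc_jump)
  with AE_good show ?thesis
    by eventually_elim
      (intro allI corner_map.stay_forever_eq_0_of_no_jumps \<sigma>, unfold corner_map_def, assumption, blast)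
qed

section \<open>Resampling one step of the walk\<close>

definition choose_edge :: "oedge set \<Rightarrow> real \<Rightarrow> oedge" where
  "choose_edge S u = (let L = map oe_decode (sorted_list_of_set (oe_code ` S))
     in L ! nat \<lfloor>u * real (length L)\<rfloor>)"

fun edge_walk :: "'v corner_map \<Rightarrow> bool \<Rightarrow> (nat \<Rightarrow> real) \<Rightarrow> nat \<Rightarrow> oedge" where
  "edge_walk c \<eta> U 0 = (0, \<eta>)"
| "edge_walk c \<eta> U (Suc k) = choose_edge (edges_from c (target c (edge_walk c \<eta> U k))) (U k)"

lemma oe_decode_code [simp]: "oe_decode (oe_code e) = e"
  by (cases e) (auto simp: oe_decode_def oe_code_def)

lemma inj_oe_code: "inj_on oe_code A"
  by (rule inj_on_inverseI[of _ oe_decode]) simp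

lemma edge_list:
  assumes "finite S"
  defines "L \<equiv> map oe_decode (sorted_list_of_set (oe_code ` S))"
  shows "length L = card S" "distinct L" "set L = S"
proof -
  show "length L = card S" using assms by (simp add: card_image inj_oe_code)
  show "set L = S" using assms by (simp add: image_image)
  have "inj_on oe_decode (oe_code ` S)" by (rule inj_on_inverseI[of _ oe_code]) auto
  then show "distinct L" using assms by (simp add: distinct_map)
qed

lemma choose_edge_in:
  assumes "finite S" "S \<noteq> {}" "0 \<le> u" "u < 1"
  shows "choose_edge S u \<in> S"
proof -
  have n: "0 < card S" using assms by (simp add: card_gt_0_iff)
  have "u * real (card S) < real (card S)" using n assms by simp
  then have "nat \<lfloor>u * real (card S)\<rfloor> < card S"
    using assms by (simp add: floor_less_iff nat_less_iff)
  then show ?thesis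
    using edge_list[OF assms(1)] unfolding choose_edge_def Let_def by (metis nth_mem)
qed

text \<open>\<open>sorted_list_of_set\<close> is empty for infinite sets; this is the convention
  that \<open>measurable_finite_set_compose\<close> asks for.\<close>

lemma choose_edge_infinite: "infinite S \<Longrightarrow> choose_edge S u = choose_edge {} u"
  by (simp add: choose_edge_def sorted_list_of_set.fold_insort_key.infinite finite_image_iff inj_oe_code)

lemma measurable_choose_edge [measurable]: "choose_edge S \<in> borel \<rightarrow>\<^sub>M count_space UNIV"
proof -
  have "(\<lambda>u. nat \<lfloor>u * real n\<rfloor>) \<in> borel \<rightarrow>\<^sub>M count_space UNIV" for n by measurable
  then show ?thesis unfolding choose_edge_def Let_def by (rule measurable_count_space_fun)
qed

text \<open>With n edges, entry \<open>j\<close> of the list is selected exactly for u in [j/n, (j +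
  1)/n), and these n intervals of length 1/n partition [0, 1).\<close>

lemma nn_integral_choose_edge:
  fixes h :: "oedge \<Rightarrow> ennreal"
  assumes S: "finite S" "S \<noteq> {}"
  shows "(\<integral>\<^sup>+ u. h (choose_edge S u) \<partial>uniform_measure lborel {0..<1 :: real}) = (\<Sum>e\<in>S. h e) / of_nat (card S)"
proof -
  define L where "L = map oe_decode (sorted_list_of_set (oe_code ` S))"
  define n where "n = card S"
  have n: "0 < n" using S by (simp add: n_def card_gt_0_iff)
  note L = edge_list[OF S(1), folded L_def n_def]
  let ?I = "\<lambda>j. {real j / real n ..< real (Suc j) / real n}"
  have pt: "h (choose_edge S u) * indicator {0..<1} u = (\<Sum>j<n. h (L ! j) * indicator (?I j) u)" for u :: real
  proof (cases "0 \<le> u \<and> u < 1")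
    case True
    define i where "i = nat \<lfloor>u * real n\<rfloor>"
    have i: "real i \<le> u * real n" "u * real n < real i + 1"
      using True by (auto simp: i_def of_nat_nat floor_less_iff)
    have "u * real n < real n" using True n by simp
    then have "i < n" using i by simp
    have iff: "u \<in> ?I j \<longleftrightarrow> j = i" for j
    proof -
      have "u \<in> ?I j \<longleftrightarrow> real j \<le> u * real n \<and> u * real n < real j + 1"
        using n by (auto simp: field_simps)
      also have "\<dots> \<longleftrightarrow> j = i" using i by auto
      finally show ?thesis .
    qed
    have "(\<Sum>j<n. h (L ! j) * indicator (?I j) u) = (\<Sum>j<n. if j = i then h (L ! i) else 0)"
    proof (intro sum.cong refl)
      fix j
      have "indicator (?I j) u = (if j = i then 1 else 0 :: ennreal)" unfolding indicator_def iff by simp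
      then show "h (L ! j) * indicator (?I j) u = (if j = i then h (L ! i) else 0)" by simp
    qed
    also have "\<dots> = h (L ! i)" using \<open>i < n\<close> by simp
    finally show ?thesis using True L(1)
      by (simp add: choose_edge_def L_def[symmetric] i_def)
  next
    case False
    have "u \<notin> ?I j" if "j < n" for j
    proof
      assume "u \<in> ?I j"
      then have "real j / real n \<le> u" "u < real (Suc j) / real n" by auto
      moreover have "real (Suc j) / real n \<le> 1" "0 \<le> real j / real n" using that n by auto
      ultimately show False using False by linarith
    qed
    then show ?thesis using False by (auto simp: indicator_def)
  qed
  have len: "emeasure lborel (?I j) = 1 / of_nat n" for j
  proof -
    have "emeasure lborel (?I j) = ennreal (real (Suc j) / real n - real j / real n)"
      using n by (intro emeasure_lborel_Ico) (simp add: divide_right_mono)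
    also have "real (Suc j) / real n - real j / real n = 1 / real n" by (simp add: diff_divide_distrib[symmetric])
    also have "ennreal (1 / real n) = 1 / of_nat n"
      using n by (simp add: divide_ennreal[symmetric] ennreal_of_nat_eq_real_of_nat)
    finally show ?thesis .
  qed
  have "(\<integral>\<^sup>+ u. h (choose_edge S u) \<partial>uniform_measure lborel {0..<1 :: real})
     = (\<integral>\<^sup>+ u. h (choose_edge S u) * indicator {0..<1} u \<partial>lborel)"
  proof (subst nn_integral_uniform_measure)
    show "(\<lambda>u. h (choose_edge S u)) \<in> borel_measurable lborel"
      using measurable_compose[OF measurable_choose_edge, of h borel S] by simp
  qed (simp_all add: divide_ennreal_def)
  also have "\<dots> = (\<integral>\<^sup>+ u. (\<Sum>j<n. h (L ! j) * indicator (?I j) u) \<partial>lborel)"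
    by (simp add: pt)
  also have "\<dots> = (\<Sum>j<n. \<integral>\<^sup>+ u. h (L ! j) * indicator (?I j) u \<partial>lborel)"
    by (rule nn_integral_sum) auto
  also have "\<dots> = (\<Sum>j<n. h (L ! j) * (1 / of_nat n))"
    by (intro sum.cong refl, subst nn_integral_cmult_indicator, simp, simp only: len)
  also have "\<dots> = (\<Sum>j<n. h (L ! j)) / of_nat n"
    by (simp add: sum_distrib_right[symmetric] divide_ennreal_def)
  also have "(\<Sum>j<n. h (L ! j)) = (\<Sum>e\<in>S. h e)"
    by (rule sum.reindex_bij_betw) (use bij_betw_nth[OF L(2), of "{..<n}" S] L in auto)
  finally show ?thesis by (simp add: n_def)
qed

definition path_space :: "(nat \<Rightarrow> int \<times> ltree \<times> ltree \<times> real) measure" where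
  "path_space = (\<Pi>\<^sub>M n\<in>UNIV. coord_measure)"

definition path_env :: "(nat \<Rightarrow> int \<times> ltree \<times> ltree \<times> real) \<Rightarrow> environment" where
  "path_env X n = (fst (X n), fst (snd (X n)), fst (snd (snd (X n))))"

definition path_unif :: "(nat \<Rightarrow> int \<times> ltree \<times> ltree \<times> real) \<Rightarrow> nat \<Rightarrow> real" where
  "path_unif X n = snd (snd (snd (X n)))"

definition set_unif :: "(int \<times> ltree \<times> ltree \<times> real) \<Rightarrow> real \<Rightarrow> int \<times> ltree \<times> ltree \<times> real" where
  "set_unif x u = (fst x, fst (snd x), fst (snd (snd x)), u)"

abbreviation unif_measure :: "real measure" where
  "unif_measure \<equiv> uniform_measure lborel {0..<1}"

lemma prob_space_unif: "prob_space unif_measure"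
  by (rule prob_space_uniform_measure) auto

lemma sets_unif [measurable_cong]: "sets unif_measure = sets borel"
  by simp

lemma prob_space_pair:
  assumes "prob_space M" "prob_space N"
  shows "prob_space (M \<Otimes>\<^sub>M N)"
proof -
  interpret M: prob_space M by fact
  interpret N: prob_space N by fact
  interpret pair_prob_space M N ..
  show ?thesis by (rule prob_space_axioms)
qed

lemmas prob_spaces = prob_space_pair prob_space_unif prob_space_rho measure_pmf.prob_space_axioms

lemma prob_space_coord: "prob_space coord_measure"
  unfolding coord_measure_def by (intro prob_spaces)

lemma prob_space_path: "prob_space path_space"
  unfolding path_space_def by (intro prob_space_PiM prob_space_coord)

lemma nn_integral_coord:
  assumes [measurable]: "f \<in> borel_measurable coord_measure"
  shows "(\<integral>\<^sup>+ x. f x \<partial>coord_measure) = (\<integral>\<^sup>+ s. \<integral>\<^sup>+ L. \<integral>\<^sup>+ R. \<integral>\<^sup>+ u. f (s, L, R, u) \<partial>unif_measure \<partial>rho 0 \<partial>rho 0 \<partial>measure_pmf (pmf_of_set {-1, 0, 1}))"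
proof -
  note fst = sigma_finite_measure.nn_integral_fst[OF prob_space_imp_sigma_finite]
  have [measurable]: "f \<in> borel_measurable (measure_pmf (pmf_of_set {-1, 0, 1 :: int}) \<Otimes>\<^sub>M (rho 0 \<Otimes>\<^sub>M (rho 0 \<Otimes>\<^sub>M unif_measure)))"
    using assms by (simp add: coord_measure_def)
  have 1: "(\<lambda>p. f (s, p)) \<in> borel_measurable (rho 0 \<Otimes>\<^sub>M (rho 0 \<Otimes>\<^sub>M unif_measure))" for s
    by measurable
  have 2: "(\<lambda>p. f (s, L, p)) \<in> borel_measurable (rho 0 \<Otimes>\<^sub>M unif_measure)" for s L
    using measurable_compose[OF measurable_Pair1'[of L "rho 0" "rho 0 \<Otimes>\<^sub>M unif_measure"] 1[of s]] by simp
  show ?thesis unfolding coord_measure_def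
    by (subst fst[symmetric], intro prob_spaces, measurable, intro nn_integral_cong,
        subst fst[OF _ 1, symmetric], intro prob_spaces, intro nn_integral_cong,
        subst fst[OF _ 2, symmetric], intro prob_spaces, simp)
qed

lemma measurable_set_unif [measurable]:
  "(\<lambda>p. set_unif (fst p) (snd p)) \<in> coord_measure \<Otimes>\<^sub>M unif_measure \<rightarrow>\<^sub>M coord_measure"
  unfolding set_unif_def coord_measure_def by measurable

text \<open>After the replacement the integrand is constant in the old uniform component, which
  integrates to 1.\<close>

lemma nn_integral_coord_resample:
  assumes [measurable]: "f \<in> borel_measurable coord_measure"
  shows "(\<integral>\<^sup>+ x. \<integral>\<^sup>+ u. f (set_unif x u) \<partial>unif_measure \<partial>coord_measure) = (\<integral>\<^sup>+ x. f x \<partial>coord_measure)"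
proof -
  interpret U: prob_space unif_measure by (rule prob_space_unif)
  have "(\<lambda>x. \<integral>\<^sup>+ u. f (set_unif x u) \<partial>unif_measure) \<in> borel_measurable coord_measure"
    using measurable_compose[OF measurable_set_unif assms]
    by (intro U.borel_measurable_nn_integral) (simp add: split_beta')
  then have "(\<integral>\<^sup>+ x. \<integral>\<^sup>+ u. f (set_unif x u) \<partial>unif_measure \<partial>coord_measure) =
     (\<integral>\<^sup>+ s. \<integral>\<^sup>+ L. \<integral>\<^sup>+ R. \<integral>\<^sup>+ u. \<integral>\<^sup>+ v. f (s, L, R, v) \<partial>unif_measure \<partial>unif_measure \<partial>rho 0 \<partial>rho 0 \<partial>measure_pmf (pmf_of_set {-1, 0, 1}))"
    by (subst nn_integral_coord) (simp_all add: set_unif_def)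
  also have "\<dots> = (\<integral>\<^sup>+ x. f x \<partial>coord_measure)"
    using U.emeasure_space_1 by (simp add: nn_integral_coord)
  finally show ?thesis .
qed

lemma measurable_path_upd:
  "(\<lambda>p. (snd p)(k := fst p)) \<in> coord_measure \<Otimes>\<^sub>M path_space \<rightarrow>\<^sub>M path_space"
  unfolding path_space_def
  by (rule measurable_fun_upd[where J = UNIV]) auto

lemma nn_integral_path_split:
  assumes f: "f \<in> borel_measurable path_space"
  shows "(\<integral>\<^sup>+ X. f X \<partial>path_space) = (\<integral>\<^sup>+ x. \<integral>\<^sup>+ X. f (X(k := x)) \<partial>path_space \<partial>coord_measure)"
proof -
  have "distr (coord_measure \<Otimes>\<^sub>M path_space) path_space (\<lambda>(x, X). X(k := x)) = path_space"
    using distr_pair_PiM_eq_PiM[of UNIV "\<lambda>_. coord_measure" k] prob_space_coord by (simp add: path_space_def)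
  then have "(\<integral>\<^sup>+ X. f X \<partial>path_space) = (\<integral>\<^sup>+ X. f X \<partial>distr (coord_measure \<Otimes>\<^sub>M path_space) path_space (\<lambda>(x, X). X(k := x)))"
    by simp
  also have "\<dots> = (\<integral>\<^sup>+ p. f ((snd p)(k := fst p)) \<partial>(coord_measure \<Otimes>\<^sub>M path_space))"
    using measurable_path_upd by (subst nn_integral_distr) (auto simp: split_beta' f)
  also have "\<dots> = (\<integral>\<^sup>+ x. \<integral>\<^sup>+ X. f (X(k := x)) \<partial>path_space \<partial>coord_measure)"
    using measurable_compose[OF measurable_path_upd f]
    by (subst sigma_finite_measure.nn_integral_fst[OF prob_space_imp_sigma_finite[OF prob_space_path], symmetric]) auto
  finally show ?thesis .
qed

lemma measurable_path_component [measurable]: "(\<lambda>X. X k) \<in> path_space \<rightarrow>\<^sub>M coord_measure"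
  unfolding path_space_def by measurable

text \<open>This takes the place of the Markov property: the tree and the walk up to time
  \<open>k\<close> do not involve the \<open>k\<close>-th uniform variable, so integrating over a
  fresh copy of it averages over the next edge alone. It rests on independence of the coordinates
  and, within a coordinate, of the uniform component from the rest.\<close>

lemma nn_integral_path_resample:
  assumes f: "f \<in> borel_measurable path_space"
  shows "(\<integral>\<^sup>+ X. f X \<partial>path_space) = (\<integral>\<^sup>+ X. \<integral>\<^sup>+ u. f (X(k := set_unif (X k) u)) \<partial>unif_measure \<partial>path_space)"
proof -
  interpret U: prob_space unif_measure by (rule prob_space_unif)
  interpret P: prob_space path_space by (rule prob_space_path)
  interpret UP: pair_sigma_finite unif_measure path_space ..
  note upd = measurable_compose[OF measurable_path_upd f]
  have m1: "(\<lambda>p. f ((fst p)(k := set_unif (fst p k) (snd p)))) \<in> borel_measurable (path_space \<Otimes>\<^sub>M unif_measure)"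
  proof -
    have "(\<lambda>p. (set_unif (fst p k) (snd p), fst p)) \<in> path_space \<Otimes>\<^sub>M unif_measure \<rightarrow>\<^sub>M coord_measure \<Otimes>\<^sub>M path_space"
      using measurable_compose[OF _ measurable_set_unif, of "\<lambda>p. (fst p k, snd p)" "path_space \<Otimes>\<^sub>M unif_measure"]
      by (intro measurable_Pair) simp_all
    from measurable_compose[OF this upd] show ?thesis by simp
  qed
  then have m2: "(\<lambda>X. \<integral>\<^sup>+ u. f (X(k := set_unif (X k) u)) \<partial>unif_measure) \<in> borel_measurable path_space"
    by (intro U.borel_measurable_nn_integral) (simp add: split_beta')
  have m3: "(\<lambda>x. \<integral>\<^sup>+ X. f (X(k := x)) \<partial>path_space) \<in> borel_measurable coord_measure"
    using upd by (intro P.borel_measurable_nn_integral) (simp add: split_beta')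
  have m4: "(\<lambda>p. f ((snd p)(k := set_unif x (fst p)))) \<in> borel_measurable (unif_measure \<Otimes>\<^sub>M path_space)" if x: "x \<in> space coord_measure" for x
  proof -
    have "(\<lambda>p. (set_unif x (fst p), snd p)) \<in> unif_measure \<Otimes>\<^sub>M path_space \<rightarrow>\<^sub>M coord_measure \<Otimes>\<^sub>M path_space"
      using measurable_compose[OF _ measurable_set_unif, of "\<lambda>p. (x, fst p)" "unif_measure \<Otimes>\<^sub>M path_space"] x
      by (intro measurable_Pair) simp_all
    from measurable_compose[OF this upd] show ?thesis by simp
  qed
  have "(\<integral>\<^sup>+ X. \<integral>\<^sup>+ u. f (X(k := set_unif (X k) u)) \<partial>unif_measure \<partial>path_space)
      = (\<integral>\<^sup>+ x. \<integral>\<^sup>+ X. \<integral>\<^sup>+ u. f (X(k := set_unif x u)) \<partial>unif_measure \<partial>path_space \<partial>coord_measure)"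
    by (subst nn_integral_path_split[OF m2, of k]) simp
  also have "\<dots> = (\<integral>\<^sup>+ x. \<integral>\<^sup>+ u. \<integral>\<^sup>+ X. f (X(k := set_unif x u)) \<partial>path_space \<partial>unif_measure \<partial>coord_measure)"
  proof (rule nn_integral_cong)
    fix x assume "x \<in> space coord_measure"
    from UP.Fubini[OF m4[OF this]]
    show "(\<integral>\<^sup>+ X. \<integral>\<^sup>+ u. f (X(k := set_unif x u)) \<partial>unif_measure \<partial>path_space)
        = (\<integral>\<^sup>+ u. \<integral>\<^sup>+ X. f (X(k := set_unif x u)) \<partial>path_space \<partial>unif_measure)" by simp
  qed
  also have "\<dots> = (\<integral>\<^sup>+ x. \<integral>\<^sup>+ X. f (X(k := x)) \<partial>path_space \<partial>coord_measure)"
    by (rule nn_integral_coord_resample[OF m3])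
  also have "\<dots> = (\<integral>\<^sup>+ X. f X \<partial>path_space)" by (rule nn_integral_path_split[OF f, symmetric])
  finally show ?thesis by simp
qed

section \<open>Recurrence of the labels\<close>

lemma nn_integral_coord_env:
  "(\<integral>\<^sup>+ x. f (fst x, fst (snd x), fst (snd (snd x))) \<partial>coord_measure) = (\<integral>\<^sup>+ a. f a \<partial>graft_measure)"
proof -
  interpret U: prob_space unif_measure by (rule prob_space_unif)
  note fst = sigma_finite_measure.nn_integral_fst[OF prob_space_imp_sigma_finite]
  have f: "f \<in> borel_measurable graft_measure" by (rule borel_measurable_graft)
  have m: "(\<lambda>x. (fst x, fst (snd x), fst (snd (snd x)))) \<in> coord_measure \<rightarrow>\<^sub>M graft_measure"
    unfolding coord_measure_def graft_measure_def by measurable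
  have 1: "f \<in> borel_measurable (measure_pmf (pmf_of_set {-1, 0, 1 :: int}) \<Otimes>\<^sub>M (rho 0 \<Otimes>\<^sub>M rho 0))"
    using f by (simp add: graft_measure_def)
  have 2: "(\<lambda>p. f (s, p)) \<in> borel_measurable (rho 0 \<Otimes>\<^sub>M rho 0)" for s
    using measurable_compose[OF measurable_Pair1'[of s "measure_pmf (pmf_of_set {-1, 0, 1 :: int})" "rho 0 \<Otimes>\<^sub>M rho 0"] 1] by simp
  have "(\<integral>\<^sup>+ a. f a \<partial>graft_measure) = (\<integral>\<^sup>+ s. \<integral>\<^sup>+ L. \<integral>\<^sup>+ R. f (s, L, R) \<partial>rho 0 \<partial>rho 0 \<partial>measure_pmf (pmf_of_set {-1, 0, 1}))"
    unfolding graft_measure_def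
    by (subst fst[OF _ 1, symmetric], intro prob_spaces, intro nn_integral_cong,
        subst fst[OF _ 2, symmetric], intro prob_spaces, simp)
  moreover have "(\<integral>\<^sup>+ x. f (fst x, fst (snd x), fst (snd (snd x))) \<partial>coord_measure)
     = (\<integral>\<^sup>+ s. \<integral>\<^sup>+ L. \<integral>\<^sup>+ R. f (s, L, R) \<partial>rho 0 \<partial>rho 0 \<partial>measure_pmf (pmf_of_set {-1, 0, 1}))"
    using U.emeasure_space_1 by (subst nn_integral_coord) (use measurable_compose[OF m f] in simp_all)
  ultimately show ?thesis by simp
qed

lemma measurable_coord_env: "(\<lambda>x. (fst x, fst (snd x), fst (snd (snd x)))) \<in> coord_measure \<rightarrow>\<^sub>M graft_measure"
  unfolding coord_measure_def graft_measure_def by measurable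

lemma measurable_path_env [measurable]: "path_env \<in> path_space \<rightarrow>\<^sub>M env_space"
  unfolding env_space_def
proof (rule measurable_PiM_single')
  show "(\<lambda>X. path_env X n) \<in> path_space \<rightarrow>\<^sub>M graft_measure" for n
    unfolding path_env_def by (rule measurable_compose[OF measurable_path_component measurable_coord_env])
qed auto

text \<open>Independence reduces this to a single coordinate, where dropping the uniform component
  leaves \<open>graft_measure\<close>.\<close>

lemma distr_path_env: "distr path_space env_space path_env = env_space"
proof -
  interpret coord: product_prob_space "\<lambda>_::nat. coord_measure" UNIV
    using prob_space_coord by (simp add: product_prob_space_def product_prob_space_axioms_def
      product_sigma_finite_def prob_space_imp_sigma_finite)
  let ?\<pi> = "\<lambda>x :: int \<times> ltree \<times> ltree \<times> real. (fst x, fst (snd x), fst (snd (snd x)))"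
  show ?thesis
  proof (rule env.PiM_eq)
    show "sets (distr path_space env_space path_env) = sets env_space" by simp
    fix J :: "nat set" and F assume J: "finite J" and F: "\<And>j. j \<in> J \<Longrightarrow> F j \<in> sets graft_measure"
    let ?E = "prod_emb UNIV (\<lambda>_. graft_measure) J (\<Pi>\<^sub>E j\<in>J. F j)"
    have E: "?E \<in> sets env_space" unfolding env_space_def using J by (intro sets_PiM_I) auto
    have pre: "?\<pi> -` A \<inter> space coord_measure \<in> sets coord_measure" for A
      by (rule measurable_sets[OF measurable_coord_env]) simp
    have "emeasure (distr path_space env_space path_env) ?E = emeasure path_space (path_env -` ?E \<inter> space path_space)"
      using E by (simp add: emeasure_distr)
    also have "path_env -` ?E \<inter> space path_space = {X\<in>space path_space. \<forall>j\<in>J. X j \<in> ?\<pi> -` F j \<inter> space coord_measure}"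
      by (auto simp: prod_emb_def path_env_def path_space_def space_PiM PiE_iff)
    also have "emeasure path_space \<dots> = (\<Prod>j\<in>J. emeasure coord_measure (?\<pi> -` F j \<inter> space coord_measure))"
      unfolding path_space_def using J pre by (intro coord.emeasure_PiM_Collect) auto
    also have "\<dots> = (\<Prod>j\<in>J. emeasure graft_measure (F j))"
    proof (rule prod.cong[OF refl])
      fix j
      have "emeasure coord_measure (?\<pi> -` F j \<inter> space coord_measure) = (\<integral>\<^sup>+ x. indicator (F j) (?\<pi> x) \<partial>coord_measure)"
      proof -
        have "(\<integral>\<^sup>+ x. indicator (F j) (?\<pi> x) \<partial>coord_measure) = (\<integral>\<^sup>+ x. indicator (?\<pi> -` F j \<inter> space coord_measure) x \<partial>coord_measure)"
          by (rule nn_integral_cong) (auto simp: indicator_def)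
        then show ?thesis using nn_integral_indicator[OF pre[of "F j"]] by (simp only:)
      qed
      also have "\<dots> = emeasure graft_measure (F j)"
        by (subst nn_integral_coord_env) simp
      finally show "emeasure coord_measure (?\<pi> -` F j \<inter> space coord_measure) = emeasure graft_measure (F j)" .
    qed
    finally show "emeasure (distr path_space env_space path_env) ?E = (\<Prod>j\<in>J. emeasure graft_measure (F j))" .
  qed
qed

lemma AE_path_env: "AE e in env_space. P e \<Longrightarrow> AE X in path_space. P (path_env X)"
  by (rule AE_distrD[OF measurable_path_env]) (subst distr_path_env)

definition path_corner :: "(nat \<Rightarrow> int \<times> ltree \<times> ltree \<times> real) \<Rightarrow> int \<Rightarrow> vertex \<times> int" where
  "path_corner X = env_corner (path_env X)"

definition path_walk :: "bool \<Rightarrow> (nat \<Rightarrow> int \<times> ltree \<times> ltree \<times> real) \<Rightarrow> nat \<Rightarrow> oedge" where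
  "path_walk \<eta> X = edge_walk (path_corner X) \<eta> (path_unif X)"

definition path_label :: "bool \<Rightarrow> (nat \<Rightarrow> int \<times> ltree \<times> ltree \<times> real) \<Rightarrow> nat \<Rightarrow> int" where
  "path_label \<eta> X k = snd (path_corner X (origin (path_corner X) (path_walk \<eta> X k)))"

lemma AE_path_good: "AE X in path_space. good_corner_map (path_corner X)"
  unfolding path_corner_def by (rule AE_path_env[OF AE_good])

lemma measurable_path_unif [measurable]: "(\<lambda>X. path_unif X k) \<in> borel_measurable path_space"
proof -
  have "(\<lambda>x. snd (snd (snd x))) \<in> borel_measurable coord_measure"
    unfolding coord_measure_def by measurable
  from measurable_compose[OF measurable_path_component this] show ?thesis by (simp add: path_unif_def)
qed

lemma AE_path_unif: "AE X in path_space. \<forall>k. 0 \<le> path_unif X k \<and> path_unif X k < 1"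
proof -
  have s: "(\<lambda>x. snd (snd (snd x))) \<in> borel_measurable coord_measure"
    unfolding coord_measure_def by measurable
  have "AE X in path_space. 0 \<le> path_unif X k \<and> path_unif X k < 1" for k
  proof -
    let ?B = "{u::real. \<not> (0 \<le> u \<and> u < 1)}"
    have B: "?B \<in> sets borel" by measurable
    have u: "(\<integral>\<^sup>+ u. indicator ?B u \<partial>unif_measure) = 0"
    proof -
      have "{0..<1} \<inter> ?B = {}" by auto
      then show ?thesis using B by (simp only: nn_integral_indicator sets_unif emeasure_uniform_measure sets_lborel) simp
    qed
    have m: "(\<lambda>x. indicator ?B (snd (snd (snd x))) :: ennreal) \<in> borel_measurable coord_measure"
      by (rule measurable_compose[OF s]) (use B in simp)
    have "(\<integral>\<^sup>+ x. indicator ?B (snd (snd (snd x))) \<partial>coord_measure) = 0"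
      by (subst nn_integral_coord[OF m]) (simp only: snd_conv u, simp)
    then have "AE x in coord_measure. indicator ?B (snd (snd (snd x))) = (0::ennreal)"
      using m by (simp add: nn_integral_0_iff_AE)
    then have "AE x in coord_measure. 0 \<le> snd (snd (snd x)) \<and> snd (snd (snd x)) < 1"
      by eventually_elim (auto simp: indicator_def split: if_splits)
    then show ?thesis unfolding path_space_def path_unif_def
      by (intro AE_PiM_component) (auto intro: prob_space_coord)
  qed
  then show ?thesis by (simp add: AE_all_countable)
qed

lemma measurable_path_origin: "(\<lambda>X. origin (path_corner X) o') \<in> path_space \<rightarrow>\<^sub>M count_space UNIV"
  unfolding path_corner_def by (rule measurable_compose[OF measurable_path_env measurable_env_origin])

lemma measurable_path_target: "(\<lambda>X. target (path_corner X) o') \<in> path_space \<rightarrow>\<^sub>M count_space UNIV"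
  unfolding path_corner_def by (rule measurable_compose[OF measurable_path_env measurable_env_target])

lemma measurable_path_corner_label: "(\<lambda>X. snd (path_corner X i)) \<in> path_space \<rightarrow>\<^sub>M count_space UNIV"
  unfolding path_corner_def by (rule measurable_compose[OF measurable_path_env measurable_env_label])

lemma pred_path_edges_from: "Measurable.pred path_space (\<lambda>X. o' \<in> edges_from (path_corner X) i)"
  unfolding path_corner_def by (rule measurable_compose[OF measurable_path_env pred_edges_from])

lemma measurable_path_stay: "(\<lambda>X. stay (path_corner X) \<sigma> m n i) \<in> borel_measurable path_space"
  unfolding path_corner_def by (rule measurable_compose[OF measurable_path_env measurable_env_stay])

lemma measurable_path_walk [measurable]: "(\<lambda>X. path_walk \<eta> X k) \<in> path_space \<rightarrow>\<^sub>M count_space UNIV"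
proof (induction k)
  case 0
  then show ?case by (simp add: path_walk_def)
next
  case (Suc k)
  let ?S = "\<lambda>X. edges_from (path_corner X) (target (path_corner X) (path_walk \<eta> X k))"
  have t: "(\<lambda>X. target (path_corner X) (path_walk \<eta> X k)) \<in> path_space \<rightarrow>\<^sub>M count_space UNIV"
    by (rule measurable_compose_countable[OF measurable_path_target Suc])
  have "Measurable.pred path_space (\<lambda>X. o' \<in> ?S X)" for o'
    by (rule measurable_compose_countable[OF pred_path_edges_from t])
  then have "(\<lambda>X. choose_edge (?S X) (path_unif X k)) \<in> path_space \<rightarrow>\<^sub>M count_space UNIV"
    by (rule measurable_finite_set_compose[where f = "\<lambda>S X. choose_edge S (path_unif X k)"])
      (auto intro: measurable_compose[OF measurable_path_unif measurable_choose_edge] choose_edge_infinite)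
  then show ?case by (simp add: path_walk_def)
qed

lemma measurable_path_label [measurable]: "(\<lambda>X. path_label \<eta> X k) \<in> path_space \<rightarrow>\<^sub>M count_space UNIV"
  unfolding path_label_def
  by (rule measurable_compose_countable[OF measurable_path_corner_label
    measurable_compose_countable[OF measurable_path_origin measurable_path_walk]])

lemma path_env_upd [simp]: "path_env (X(k := set_unif (X k) u)) = path_env X"
  by (auto simp: path_env_def set_unif_def fun_eq_iff)

lemma path_corner_upd [simp]: "path_corner (X(k := set_unif (X k) u)) = path_corner X"
  by (simp add: path_corner_def)

lemma path_walk_cong:
  assumes "path_corner X' = path_corner X" "\<And>j. j < k \<Longrightarrow> path_unif X' j = path_unif X j"
  shows "path_walk \<eta> X' k = path_walk \<eta> X k"
  using assms(2) by (induction k) (simp_all add: path_walk_def assms(1))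

lemma path_walk_upd: "j \<le> k \<Longrightarrow> path_walk \<eta> (X(k := set_unif (X k) u)) j = path_walk \<eta> X j"
  by (rule path_walk_cong[OF path_corner_upd]) (simp add: path_unif_def)

lemma path_walk_upd_Suc:
  "path_walk \<eta> (X(k := set_unif (X k) u)) (Suc k) =
     choose_edge (edges_from (path_corner X) (target (path_corner X) (path_walk \<eta> X k))) u"
  using path_walk_upd[of k k \<eta> X u] by (simp add: path_walk_def) (simp add: path_unif_def set_unif_def)

text \<open>Constrains the origins of the edges 0 to \<open>k\<close>; in the integrals that follow,
  the target of edge \<open>k\<close> is handled by the factor \<open>stay\<close>.\<close>

definition below :: "bool \<Rightarrow> int \<Rightarrow> int \<Rightarrow> nat \<Rightarrow> (nat \<Rightarrow> int \<times> ltree \<times> ltree \<times> real) \<Rightarrow> ennreal" where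
  "below \<eta> \<sigma> m k X = of_bool (\<forall>j\<le>k. \<sigma> * path_label \<eta> X j \<le> m)"

lemma measurable_below [measurable]: "below \<eta> \<sigma> m k \<in> borel_measurable path_space"
proof -
  have "Measurable.pred path_space (\<lambda>X. \<sigma> * path_label \<eta> X j \<le> m)" for j
    by (rule measurable_count_space_fun[OF measurable_path_label])
  then have "Measurable.pred path_space (\<lambda>X. \<forall>j\<le>k. \<sigma> * path_label \<eta> X j \<le> m)" by measurable
  then show ?thesis unfolding below_def by measurable
qed

lemma measurable_stay_target:
  "(\<lambda>X. ennreal (stay (path_corner X) \<sigma> m n (target (path_corner X) (path_walk \<eta> X k)))) \<in> borel_measurable path_space"
proof -
  have "(\<lambda>X. stay (path_corner X) \<sigma> m n (target (path_corner X) (path_walk \<eta> X k))) \<in> borel_measurable path_space"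
    by (rule measurable_compose_countable[OF measurable_path_stay
      measurable_compose_countable[OF measurable_path_target measurable_path_walk]])
  then show ?thesis by measurable
qed

text \<open>Integrating out the \<open>k\<close>-th uniform variable averages over the edges leaving
  the target of edge \<open>k\<close>. As a vertex, the origin of the new edge is that target, so
  the constraint it adds to \<open>below\<close> is the indicator in the recursion of
  \<open>stay\<close>.\<close>

lemma nn_integral_walk_step:
  "(\<integral>\<^sup>+ X. below \<eta> \<sigma> m (Suc k) X * ennreal (stay (path_corner X) \<sigma> m n (target (path_corner X) (path_walk \<eta> X (Suc k)))) \<partial>path_space)
   = (\<integral>\<^sup>+ X. below \<eta> \<sigma> m k X * ennreal (stay (path_corner X) \<sigma> m (Suc n) (target (path_corner X) (path_walk \<eta> X k))) \<partial>path_space)"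
  (is "(\<integral>\<^sup>+ X. ?f X \<partial>path_space) = (\<integral>\<^sup>+ X. ?g X \<partial>path_space)")
proof -
  have f: "?f \<in> borel_measurable path_space"
    by (intro borel_measurable_times_ennreal measurable_below measurable_stay_target)
  have "(\<integral>\<^sup>+ X. ?f X \<partial>path_space) = (\<integral>\<^sup>+ X. \<integral>\<^sup>+ u. ?f (X(k := set_unif (X k) u)) \<partial>unif_measure \<partial>path_space)"
    by (rule nn_integral_path_resample[OF f])
  also have "\<dots> = (\<integral>\<^sup>+ X. ?g X \<partial>path_space)"
  proof (rule nn_integral_cong_AE, use AE_path_good in eventually_elim)
    case (elim X)
    interpret corner_map "path_corner X" by standard fact
    let ?c = "path_corner X"
    let ?t = "target ?c (path_walk \<eta> X k)"
    let ?S = "edges_from ?c ?t"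
    let ?h = "\<lambda>o'. below \<eta> \<sigma> m k X * (of_bool (\<sigma> * snd (?c (origin ?c o')) \<le> m) * ennreal (stay ?c \<sigma> m n (target ?c o')))"
    have "?f (X(k := set_unif (X k) u)) = ?h (choose_edge ?S u)" for u
    proof -
      have "path_label \<eta> (X(k := set_unif (X k) u)) j = path_label \<eta> X j" if "j \<le> k" for j
        using that by (simp add: path_label_def path_walk_upd)
      moreover have "path_label \<eta> (X(k := set_unif (X k) u)) (Suc k) = snd (?c (origin ?c (choose_edge ?S u)))"
        by (simp add: path_label_def path_walk_upd_Suc)
      ultimately have "below \<eta> \<sigma> m (Suc k) (X(k := set_unif (X k) u)) =
         below \<eta> \<sigma> m k X * of_bool (\<sigma> * snd (?c (origin ?c (choose_edge ?S u))) \<le> m)"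
        by (auto simp: below_def le_Suc_eq)
      then show ?thesis by (simp add: path_walk_upd_Suc mult.assoc)
    qed
    then have "(\<integral>\<^sup>+ u. ?f (X(k := set_unif (X k) u)) \<partial>unif_measure) = (\<integral>\<^sup>+ u. ?h (choose_edge ?S u) \<partial>unif_measure)"
      by (simp only:)
    also have "\<dots> = (\<Sum>o'\<in>?S. ?h o') / of_nat (card ?S)"
      by (rule nn_integral_choose_edge[OF finite_edges_from edges_from_nonempty])
    also have "(\<Sum>o'\<in>?S. ?h o') = (\<Sum>o'\<in>?S. below \<eta> \<sigma> m k X * (of_bool (\<sigma> * snd (?c ?t) \<le> m) * ennreal (stay ?c \<sigma> m n (target ?c o'))))"
    proof (intro sum.cong refl)
      fix o' assume "o' \<in> ?S"
      then have "fst (?c (origin ?c o')) = fst (?c ?t)" by (simp add: edges_from_def)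
      from label_cong[OF this]
      show "?h o' = below \<eta> \<sigma> m k X * (of_bool (\<sigma> * snd (?c ?t) \<le> m) * ennreal (stay ?c \<sigma> m n (target ?c o')))" by simp
    qed
    also have "\<dots> = below \<eta> \<sigma> m k X * (of_bool (\<sigma> * snd (?c ?t) \<le> m) * ennreal (\<Sum>o'\<in>?S. stay ?c \<sigma> m n (target ?c o')))"
      by (simp only: sum_distrib_left[symmetric]) (simp add: sum_ennreal stay_bounds)
    also have "\<dots> / of_nat (card ?S) = below \<eta> \<sigma> m k X * (of_bool (\<sigma> * snd (?c ?t) \<le> m) *
        ennreal ((\<Sum>o'\<in>?S. stay ?c \<sigma> m n (target ?c o')) / real (card ?S)))"
      using card_edges_from_pos[of ?t]
      by (simp add: divide_ennreal[symmetric] sum_nonneg stay_bounds ennreal_of_nat_eq_real_of_nat ennreal_times_divide)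
    also have "\<dots> = ?g X"
      by (simp add: ennreal_mult)
    finally show ?case .
  qed
  finally show ?thesis .
qed

text \<open>Each application of the previous identity trades one walk step for one more step of
  \<open>stay\<close>, until the root edge is reached. The constraint on the origin of the root edge
  is then dropped, hence the inequality.\<close>

lemma nn_integral_walk_below:
  "(\<integral>\<^sup>+ X. below \<eta> \<sigma> m k X * ennreal (stay (path_corner X) \<sigma> m n (target (path_corner X) (path_walk \<eta> X k))) \<partial>path_space)
   \<le> (\<integral>\<^sup>+ X. ennreal (stay (path_corner X) \<sigma> m (n + k) (target (path_corner X) (0, \<eta>))) \<partial>path_space)"
proof (induction k arbitrary: n)
  case 0
  show ?case by (rule nn_integral_mono) (simp add: below_def path_walk_def)
next
  case (Suc k)
  show ?case unfolding nn_integral_walk_step using Suc[of "Suc n"] by simp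
qed

lemma label_target:
  assumes "good_corner_map c"
  shows "\<bar>snd (c (target c e)) - snd (c (origin c e))\<bar> = 1"
proof -
  interpret corner_map c by standard fact
  show ?thesis using label_next_corner by (simp add: target_def origin_def)
qed

lemma AE_path_label_unbounded:
  assumes \<sigma>: "\<sigma> = 1 \<or> \<sigma> = -1"
  shows "AE X in path_space. \<forall>m. \<exists>n. m < \<sigma> * path_label \<eta> X n"
proof -
  have "AE X in path_space. \<exists>n. m < \<sigma> * path_label \<eta> X n" for m
  proof -
    define B where "B = {X \<in> space path_space. \<forall>n. \<sigma> * path_label \<eta> X n \<le> m}"
    have "Measurable.pred path_space (\<lambda>X. \<sigma> * path_label \<eta> X n \<le> m)" for n
      by (rule measurable_count_space_fun[OF measurable_path_label])
    then have B: "B \<in> sets path_space" unfolding B_def by measurable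
    \<comment> \<open>The level is m + 1 because \<open>stay\<close> also tests the target of the
      last edge, whose label differs by one from that of its origin.\<close>
    let ?q = "\<lambda>n X. ennreal (stay (path_corner X) \<sigma> (m + 1) n (target (path_corner X) (0, \<eta>)))"
    have mq: "?q n \<in> borel_measurable path_space" for n
      using measurable_stay_target[of \<sigma> "m + 1" n \<eta> 0] by (simp add: path_walk_def)
    have le: "emeasure path_space B \<le> (\<integral>\<^sup>+ X. ?q n X \<partial>path_space)" for n
    proof -
      have "emeasure path_space B = (\<integral>\<^sup>+ X. indicator B X \<partial>path_space)" using B by simp
      also have "\<dots> \<le> (\<integral>\<^sup>+ X. below \<eta> \<sigma> (m + 1) n X * ennreal (stay (path_corner X) \<sigma> (m + 1) 0 (target (path_corner X) (path_walk \<eta> X n))) \<partial>path_space)"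
      proof (rule nn_integral_mono_AE, use AE_path_good in eventually_elim)
        case (elim X)
        show ?case
        proof (cases "X \<in> B")
          case True
          then have *: "\<sigma> * path_label \<eta> X j \<le> m" for j by (simp add: B_def)
          have "\<sigma> * snd (path_corner X (target (path_corner X) (path_walk \<eta> X n))) \<le> m + 1"
            using *[of n] label_target[OF elim, of "path_walk \<eta> X n"] \<sigma> by (auto simp: path_label_def)
          moreover have "\<sigma> * path_label \<eta> X j \<le> m + 1" for j using *[of j] by simp
          ultimately show ?thesis by (simp add: below_def True)
        qed simp
      qed
      also have "\<dots> \<le> (\<integral>\<^sup>+ X. ?q n X \<partial>path_space)"
        using nn_integral_walk_below[of \<eta> \<sigma> "m + 1" n 0] by simp
      finally show ?thesis .
    qed
    \<comment> \<open>The quenched probabilities converge to \<open>stay_forever\<close>, which is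
      almost surely 0.\<close>
    have "(\<lambda>n. \<integral>\<^sup>+ X. ?q n X \<partial>path_space) \<longlonglongrightarrow> (\<integral>\<^sup>+ X. 0 \<partial>path_space)"
    proof (rule nn_integral_dominated_convergence[where w = "\<lambda>_. 1"])
      show "(\<integral>\<^sup>+ X. 1 \<partial>path_space) < \<infinity>"
        using prob_space.emeasure_space_1[OF prob_space_path] by simp
      show "AE X in path_space. ?q n X \<le> 1" for n
        using AE_path_good by eventually_elim (simp add: corner_map.stay_bounds corner_map_def)
      show "AE X in path_space. (\<lambda>n. ?q n X) \<longlonglongrightarrow> 0"
        using AE_path_good AE_path_env[OF AE_stay_forever_eq_0[OF \<sigma>]]
      proof eventually_elim
        case (elim X)
        interpret corner_map "path_corner X" by standard fact
        have "(\<lambda>n. stay (path_corner X) \<sigma> (m + 1) n (target (path_corner X) (0, \<eta>))) \<longlonglongrightarrow> 0"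
          using stay_LIMSEQ[of \<sigma> "m + 1" "target (path_corner X) (0, \<eta>)"] elim(2) by (simp add: path_corner_def)
        then show ?case by (simp add: tendsto_ennrealI flip: ennreal_0)
      qed
    qed (use mq in auto)
    then have "emeasure path_space B \<le> (\<integral>\<^sup>+ X. 0 \<partial>path_space)"
      by (rule tendsto_lowerbound) (use le in auto)
    then have "B \<in> null_sets path_space" using B by auto
    then have "AE X in path_space. X \<notin> B" by (rule AE_not_in)
    then show ?thesis using AE_space by eventually_elim (auto simp: B_def not_le)
  qed
  then show ?thesis by (simp add: AE_all_countable)
qed

lemma AE_path_label_step:
  "AE X in path_space. \<forall>k. \<bar>path_label \<eta> X (Suc k) - path_label \<eta> X k\<bar> = 1"
  using AE_path_good AE_path_unif
proof eventually_elim
  case (elim X)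
  interpret corner_map "path_corner X" by standard fact
  show ?case
  proof
    fix k
    let ?t = "target (path_corner X) (path_walk \<eta> X k)"
    have "path_walk \<eta> X (Suc k) \<in> edges_from (path_corner X) ?t"
      using choose_edge_in[OF finite_edges_from edges_from_nonempty] elim(2) by (simp add: path_walk_def)
    then have "fst (path_corner X (origin (path_corner X) (path_walk \<eta> X (Suc k)))) = fst (path_corner X ?t)"
      by (simp add: edges_from_def)
    from label_cong[OF this] label_target[OF elim(1), of "path_walk \<eta> X k"]
    show "\<bar>path_label \<eta> X (Suc k) - path_label \<eta> X k\<bar> = 1" by (simp add: path_label_def)
  qed
qed

text \<open>After its last visit to \<open>z\<close> the sequence cannot cross \<open>z\<close> by
  unit steps, so it remains on one side. Values on the other side that exceed in size everything
  seen up to time N must occur later, which is a contradiction.\<close>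

lemma visits_infinitely_often:
  fixes s :: "nat \<Rightarrow> int"
  assumes step: "\<And>k. \<bar>s (Suc k) - s k\<bar> = 1"
    and up: "\<And>m. \<exists>n. m < s n" and down: "\<And>m. \<exists>n. s n < m"
  shows "infinite {k. s k = z}"
proof
  assume "finite {k. s k = z}"
  then obtain N where N: "\<And>k. s k = z \<Longrightarrow> k < N"
    using finite_nat_bounded[of "{k. s k = z}"] by auto
  define M where "M = Max ((\<lambda>k. \<bar>s k\<bar>) ` {..N})"
  have M: "\<bar>s k\<bar> \<le> M" if "k \<le> N" for k unfolding M_def using that by (intro Max_ge) auto
  have late: "N \<le> n" if "M < \<bar>s n\<bar>" for n using M[of n] that by (cases "n \<le> N") auto
  have above: "z < s N \<Longrightarrow> z < s (N + j)" and below: "s N < z \<Longrightarrow> s (N + j) < z" for j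
  proof (induction j)
    case (Suc j)
    have "s (N + Suc j) \<noteq> z" using N[of "N + Suc j"] by auto
    then show "z < s N \<Longrightarrow> z < s (N + Suc j)" "s N < z \<Longrightarrow> s (N + Suc j) < z"
      using Suc step[of "N + j"] by auto
  qed auto
  have "s N \<noteq> z" using N[of N] by auto
  then consider "z < s N" | "s N < z" by linarith
  then show False
  proof cases
    case 1
    obtain n where n: "s n < min z (- M)" using down by blast
    then have "N \<le> n" by (intro late) auto
    then show False using above[OF 1, of "n - N"] n by simp
  next
    case 2
    obtain n where n: "max z M < s n" using up by blast
    then have "N \<le> n" by (intro late) auto
    then show False using below[OF 2, of "n - N"] n by simp
  qed
qed

lemma AE_path_recurrent: "AE X in path_space. \<forall>z. infinite {k. path_label \<eta> X k = z}"
  using AE_path_label_step[of \<eta>] AE_path_label_unbounded[of 1 \<eta>, simplified] AE_path_label_unbounded[of "-1" \<eta>, simplified]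
proof eventually_elim
  case (elim X)
  have "\<exists>n. path_label \<eta> X n < m" for m using elim(3)[rule_format, of "- m"] by auto
  then show ?case using elim(1,2) by (intro allI visits_infinitely_often) auto
qed

text \<open>\<open>succ_corner\<close> is a \<open>LEAST\<close> over the integers; it agrees with
  \<open>next_corner\<close> because successors exist in a good corner map. With equal successors
  the two recursions for the walk coincide.\<close>

lemma walk_label_eq:
  assumes "good_corner_map (path_corner (snd \<omega>))"
  shows "walk_label \<omega> k = path_label (fst \<omega>) (snd \<omega>) k"
proof -
  let ?c = "path_corner (snd \<omega>)"
  interpret corner_map ?c by standard fact
  have "environment_of \<omega> = path_env (snd \<omega>)"
    by (auto simp: environment_of_def path_env_def step_def Ltree_def Rtree_def)
  then have c: "corner \<omega> = ?c" by (simp add: corner_eq_env_corner path_corner_def)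
  have succ: "succ_corner \<omega> i = next_corner ?c i" for i
    by (simp add: succ_corner_def c next_corner_eq_Least)
  have o': "oe_origin_corner \<omega> e = origin ?c e" and t: "oe_target_corner \<omega> e = target ?c e" for e
    by (simp_all add: oe_origin_corner_def oe_target_corner_def origin_def target_def succ)
  have out: "out_edges \<omega> (oe_target \<omega> e) = edges_from ?c (target ?c e)" for e
    by (simp add: out_edges_def oe_origin_def oe_target_def o' t c edges_from_def)
  have "walk_edge \<omega> k = path_walk (fst \<omega>) (snd \<omega>) k"
  proof (induction k)
    case 0
    then show ?case by (simp add: path_walk_def eta_def)
  next
    case (Suc k)
    then show ?case
      by (simp add: path_walk_def out choose_edge_def Unif_def path_unif_def)
  qed
  then show ?thesis by (simp add: walk_label_def path_label_def o' c)
qed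

theorem theorem7:
  shows "AE \<omega> in sample_space. \<forall>z::int. infinite {k::nat. walk_label \<omega> k = z}"
proof -
  interpret X: prob_space path_space by (rule prob_space_path)
  interpret HX: pair_prob_space "measure_pmf (bernoulli_pmf (1/2))" path_space ..
  let ?H = "measure_pmf (bernoulli_pmf (1/2))"
  have S: "sample_space = ?H \<Otimes>\<^sub>M path_space" by (simp add: sample_space_def path_space_def)
  have l: "(\<lambda>\<omega>. path_label (fst \<omega>) (snd \<omega>) k) \<in> ?H \<Otimes>\<^sub>M path_space \<rightarrow>\<^sub>M count_space UNIV" for k
  proof (rule measurable_compose_countable[where f = "\<lambda>\<eta> \<omega>. path_label \<eta> (snd \<omega>) k" and g = fst])
    show "(\<lambda>\<omega>. path_label \<eta> (snd \<omega>) k) \<in> ?H \<Otimes>\<^sub>M path_space \<rightarrow>\<^sub>M count_space UNIV" for \<eta>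
      by (rule measurable_compose[OF measurable_snd measurable_path_label])
    show "fst \<in> ?H \<Otimes>\<^sub>M path_space \<rightarrow>\<^sub>M count_space UNIV"
      using measurable_fst[of ?H path_space] by (simp cong: measurable_cong_sets)
  qed
  \<comment> \<open>Recurrence holds for each fixed orientation of the root edge, so the product
    with the law of the sign is treated section by section.\<close>
  have "AE \<omega> in ?H \<Otimes>\<^sub>M path_space. \<forall>z. infinite {k. path_label (fst \<omega>) (snd \<omega>) k = z}"
  proof (rule HX.AE_pair_measure)
    have "Measurable.pred (?H \<Otimes>\<^sub>M path_space) (\<lambda>\<omega>. path_label (fst \<omega>) (snd \<omega>) k = z)" for k z
      by (rule measurable_count_space_fun[OF l])
    then show "{\<omega> \<in> space (?H \<Otimes>\<^sub>M path_space). \<forall>z. infinite {k. path_label (fst \<omega>) (snd \<omega>) k = z}} \<in> sets (?H \<Otimes>\<^sub>M path_space)"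
      unfolding infinite_nat_iff_unbounded mem_Collect_eq by measurable
  qed (simp add: AE_path_recurrent)
  moreover have "AE \<omega> in ?H \<Otimes>\<^sub>M path_space. good_corner_map (path_corner (snd \<omega>))"
  proof (rule AE_distrD[OF measurable_snd])
    have "distr (?H \<Otimes>\<^sub>M path_space) path_space snd = path_space"
    proof (rule measure_eqI)
      fix A assume "A \<in> sets (distr (?H \<Otimes>\<^sub>M path_space) path_space snd)"
      then have A: "A \<in> sets path_space" by simp
      have "snd -` A \<inter> space (?H \<Otimes>\<^sub>M path_space) = UNIV \<times> A"
        using sets.sets_into_space[OF A] by (auto simp: space_pair_measure)
      then have "emeasure (distr (?H \<Otimes>\<^sub>M path_space) path_space snd) A = emeasure (?H \<Otimes>\<^sub>M path_space) (UNIV \<times> A)"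
        using A by (simp add: emeasure_distr)
      also have "\<dots> = emeasure ?H UNIV * emeasure path_space A"
        using A by (intro X.emeasure_pair_measure_Times) auto
      also have "emeasure ?H UNIV = 1"
        using measure_pmf.emeasure_space_1[of "bernoulli_pmf (1/2)"] by simp
      finally show "emeasure (distr (?H \<Otimes>\<^sub>M path_space) path_space snd) A = emeasure path_space A" by simp
    qed simp
    then show "AE X in distr (?H \<Otimes>\<^sub>M path_space) path_space snd. good_corner_map (path_corner X)"
      using AE_path_good by metis
  qed
  ultimately show ?thesis unfolding S
    by eventually_elim (simp add: walk_label_eq)
qed

end
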